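(* Let $n\ge2$ be even, $m\ge1$, let $P_2,\dots,P_n$ be $m\times m$ matrix functions on $[0,1]$ with complex-valued summable entries, and let $L=L(P_2,\dots,P_n)$ be the operator with periodic boundary conditions described in the context. Suppose the eigenvalues $\mu_1,\dots,\mu_m$ of the matrix $C=\int_0^1P_2(x)\,dx$ are simple. Let $\lambda_{k,j}$ be an eigenvalue of $L$ lying in the disk $U(\mu_{k,j},\varepsilon_k)$. If for every $s=1,\dots,m$ (and for both choices of sign) $$\lim_{k\to\infty}\frac{\ln|k|}{k\,b_{s,s,\pm 2k}}=\lim_{k\to\infty}\frac{b_{2k}b_{-2k}}{b_{s,s,\pm2k}}=0,$$ then there exist numbers $c_4>0$ and $N_1\ge N_0$ such that: (a) For $|k|\ge N_1$ the eigenvalue $\lambda_{k,j}$ lies in $U^{-}_{k,j}\cup U^{+}_{k,j}$, where $$U^{\pm}_{k,j}=\{\lambda\in\mathbb C:\ |\lambda-h^{\pm}_{k,j}|<c_4k^{n-2}\gamma_{2k,j}d_k\},\qquad U^{+}_{k,j}\cap U^{-}_{k,j}=\emptyset,$$ $$h^{\pm}_{k,j}=(2\pi ki)^n+\mu_j(2\pi ki)^{n-2}\pm(2\pi ki)^{n-2}q_{2k,j}.$$ (b) For $|k|\ge N_1$ the geometric multiplicity of the eigenvalue $\lambda_{k,j}$ is $1$. If $\lambda_{k,j}$ lies in $U^{\pm}_{k,j}$, then any normalized eigenfunction $\Psi_{k,j}$ of $L$ corresponding to $\lambda_{k,j}$ satisfies, up to multiplication by a constant of modulus one, $$\Psi_{k,j}=\left(1+|\alpha^{\pm}_{2k,j}|^2\right)^{-\frac12}\left(\Phi_{k,j}+\alpha^{\pm}_{2k,j}\Phi_{-k,j}\right)+O(b_{2k})+O(b_{-2k})+O\left(|k|^{-1}\ln|k|\right),$$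 where $\alpha^{\pm}_{2k,j}$ is a number satisfying $\alpha^{\pm}_{2k,j}=\pm\dfrac{q_{2k,j}}{b_{j,j,2k}}(1+o(1))$ as $|k|\to\infty$.
   Context: $L_2^m[0,1]$ is the space of vector functions $f=(f_1,\dots,f_m)$ with $f_i\in L_2[0,1]$, with inner product $(f,g)=\int_0^1\langle f(x),g(x)\rangle dx$ and norm $\|f\|^2=\int_0^1|f(x)|^2dx$, where $\langle\cdot,\cdot\rangle$ and $|\cdot|$ are the inner product (linear in the first argument) and norm of $\mathbb C^m$. $L(P_2,\dots,P_n)$ is the operator generated in $L_2^m[0,1]$ by the differential expression $y^{(n)}+P_2(x)y^{(n-2)}+P_3(x)y^{(n-3)}+\dots+P_n(x)y$ and the periodic boundary conditions $y^{(\nu)}(1)=y^{(\nu)}(0)$, $\nu=0,\dots,n-1$. It is known that all large eigenvalues of $L$ (counted with multiplicity) consist of sequences $\{\lambda_{k,j}:|k|\ge N\}$, $k\in\mathbb Z$, $j=1,\dots,m$, with $\lambda_{k,j}=(2\pi ki)^n+O(k^{n-1-\frac1{2m}})$; $\Psi_{k,j}$ denotes a normalized eigenfunction for $\lambda_{k,j}$. $v_1,\dots,v_m$ are normalized eigenvectors of $C$ for $\mu_1,\dots,\mu_m$; $w_j$ is the eigenvector of $C^*$ for $\overline{\mu_j}$ with $\langle w_j,v_j\rangle=1$; $V$ is the matrix with columns $v_1,\dots,v_m$. Put $\mu_{k,j}=(2\pi ki)^n+\mu_j(2\pi ki)^{n-2}$, $\Phi_{k,j}(x)=v_je^{2\pi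 ikx}$, $\widetilde\Phi_{k,j}(x)=w_je^{2\pi ikx}$. For $p,k\in\mathbb Z$: $$b_{s,q}(x)=\langle P_2(x)v_q,w_s\rangle,\quad b_{s,q,p}=\int_0^1b_{s,q}(x)e^{-2\pi ipx}dx,\quad b_k=\max_{i,j=1,\dots,m}|b_{i,j,k}|.$$ The limit hypotheses include that $b_{s,s,\pm2k}\ne0$ for all large $k$. Further (for a fixed choice of square root) $$q_{k,j}=(b_{j,j,k}b_{j,j,-k})^{1/2},\quad \gamma_{k,j}=\max\left\{\left(\tfrac{|b_{j,j,k}|}{|b_{j,j,-k}|}\right)^{1/2},\left(\tfrac{|b_{j,j,-k}|}{|b_{j,j,k}|}\right)^{1/2}\right\},\quad d_k=\max\{b_{2k}b_{-2k},|k|^{-1}\ln|k|\}.$$ $U(\mu,c)=\{\lambda\in\mathbb C:|\lambda-\mu|<c\}$ and $\varepsilon_k=2mc_3k^{n-2}(b_{2k}+b_{-2k}+|k|^{-1}\ln|k|)\|V\|$, where $c_3>0$ is a fixed constant (it exists) such that $|(\lambda_{k,j}-\mu_{k,s})(\Psi_{k,j},\widetilde\Phi_{\pm k,s})|<c_3k^{n-2}(b_{\pm2k}+|k|^{-1}\ln|k|)$ for all $|k|\ge N$ and all $j,s$ ($N$ sufficiently large). $N_0\ge N$ is a number (it exists) such that for $|k|\ge N_0$ the disks $U(\mu_{k,1},\varepsilon_k),\dots,U(\mu_{k,m},\varepsilon_k)$ are pairwise disjoint, their union contains $\lambda_{k,1},\dots,\lambda_{k,m}$, and each of them contains precisely two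 eigenvalues of $L$ counted with multiplicity. The $O$-terms in (b) are in the norm of $L_2^m[0,1]$ as $|k|\to\infty$. *)

theory Defs
  imports "HOL-Analysis.Analysis" "HOL-Library.Function_Algebras"
begin

section \<open>The space of square integrable vector functions on the unit interval\<close>

text \<open>The sesquilinear product of complex vectors, linear in the first argument. (The library's
  inner product on this type is its real part.)\<close>

definition cdot :: "complex^'m \<Rightarrow> complex^'m \<Rightarrow> complex" where
  "cdot a b = (\<Sum>i\<in>UNIV. a $ i * cnj (b $ i))"

definition square_integrable :: "(real \<Rightarrow> complex^'m) \<Rightarrow> bool" where
  "square_integrable f \<longleftrightarrow> f \<in> borel_measurable (lebesgue_on {0..1}) \<and>
     (\<lambda>x. (norm (f x))\<^sup>2) absolutely_integrable_on {0..1}"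

definition L2_inner :: "(real \<Rightarrow> complex^'m) \<Rightarrow> (real \<Rightarrow> complex^'m) \<Rightarrow> complex" where
  "L2_inner f g = integral {0..1} (\<lambda>x. cdot (f x) (g x))"

definition L2_norm :: "(real \<Rightarrow> complex^'m) \<Rightarrow> real" where
  "L2_norm f = sqrt (integral {0..1} (\<lambda>x. (norm (f x))\<^sup>2))"

text \<open>Vector functions as a complex vector space; \<open>fun_vs.dim\<close> is the complex dimension.\<close>

definition fun_scale :: "complex \<Rightarrow> (real \<Rightarrow> complex^'m) \<Rightarrow> real \<Rightarrow> complex^'m" where
  "fun_scale c f = (\<lambda>x. c *s f x)"

interpretation fun_vs: vector_space fun_scale
  by unfold_locales
    (simp_all add: fun_scale_def fun_eq_iff vector_add_ldistrib vector_sadd_rdistrib vector_smult_assoc)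


section \<open>The periodic differential operator\<close>

definition abs_continuous_on_unit :: "(real \<Rightarrow> complex^'m) \<Rightarrow> bool" where
  "abs_continuous_on_unit f \<longleftrightarrow>
     (\<forall>\<epsilon>>0. \<exists>\<delta>>0. \<forall>(r::nat) (a::nat \<Rightarrow> real) (b::nat \<Rightarrow> real).
        (\<forall>i<r. 0 \<le> a i \<and> a i \<le> b i \<and> b i \<le> 1) \<longrightarrow>
        disjoint_family_on (\<lambda>i. {a i<..<b i}) {..<r} \<longrightarrow>
        (\<Sum>i<r. b i - a i) < \<delta> \<longrightarrow> (\<Sum>i<r. norm (f (b i) - f (a i))) < \<epsilon>)"

text \<open>Iterated derivatives on the unit interval, one-sided at the end points. The value is
  unspecified where the derivative does not exist.\<close>

primrec deriv01 :: "nat \<Rightarrow> (real \<Rightarrow> complex^'m) \<Rightarrow> real \<Rightarrow> complex^'m" where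
  "deriv01 0 y = y"
| "deriv01 (Suc \<nu>) y = (\<lambda>x. vector_derivative (deriv01 \<nu> y) (at x within {0..1}))"

definition diff_expr ::
    "nat \<Rightarrow> (nat \<Rightarrow> real \<Rightarrow> complex^'m^'m) \<Rightarrow> (real \<Rightarrow> complex^'m) \<Rightarrow> real \<Rightarrow> complex^'m" where
  "diff_expr n P y x = deriv01 n y x + (\<Sum>\<nu>=2..n. P \<nu> x *v deriv01 (n - \<nu>) y x)"

text \<open>The domain of the operator. Its elements are continuous on the unit interval, so each class
  modulo null sets has exactly one representative that vanishes outside the unit interval;
  this makes dimensions of subspaces of the domain meaningful.\<close>

definition op_domain :: "nat \<Rightarrow> (nat \<Rightarrow> real \<Rightarrow> complex^'m^'m) \<Rightarrow> (real \<Rightarrow> complex^'m) set" where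
  "op_domain n P = {y.
     (\<forall>x. x \<notin> {0..1} \<longrightarrow> y x = 0) \<and>
     (\<forall>\<nu><n-1. deriv01 \<nu> y differentiable_on {0..1}) \<and>
     abs_continuous_on_unit (deriv01 (n-1) y) \<and>
     square_integrable (diff_expr n P y) \<and>
     (\<forall>\<nu><n. deriv01 \<nu> y 1 = deriv01 \<nu> y 0)}"

definition eigenspace ::
    "nat \<Rightarrow> (nat \<Rightarrow> real \<Rightarrow> complex^'m^'m) \<Rightarrow> complex \<Rightarrow> (real \<Rightarrow> complex^'m) set" where
  "eigenspace n P l = {y \<in> op_domain n P.
     AE x in lebesgue_on {0..1}. diff_expr n P y x = l *s y x}"

definition is_eigenvalue :: "nat \<Rightarrow> (nat \<Rightarrow> real \<Rightarrow> complex^'m^'m) \<Rightarrow> complex \<Rightarrow> bool" where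
  "is_eigenvalue n P l \<longleftrightarrow> (\<exists>y \<in> eigenspace n P l. y \<noteq> (\<lambda>x. 0))"

definition normalized_eigenfunction ::
    "nat \<Rightarrow> (nat \<Rightarrow> real \<Rightarrow> complex^'m^'m) \<Rightarrow> complex \<Rightarrow> (real \<Rightarrow> complex^'m) \<Rightarrow> bool" where
  "normalized_eigenfunction n P l y \<longleftrightarrow> y \<in> eigenspace n P l \<and> L2_norm y = 1"

text \<open>\<open>root_space n P l p\<close> is the kernel of the \<open>p\<close>-th power of the operator minus \<open>l\<close>, on the
  natural domain of that power.\<close>

primrec root_space ::
    "nat \<Rightarrow> (nat \<Rightarrow> real \<Rightarrow> complex^'m^'m) \<Rightarrow> complex \<Rightarrow> nat \<Rightarrow> (real \<Rightarrow> complex^'m) set" where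
  "root_space n P l 0 = {\<lambda>x. 0}"
| "root_space n P l (Suc p) = {y \<in> op_domain n P. \<exists>z \<in> root_space n P l p.
     AE x in lebesgue_on {0..1}. diff_expr n P y x - l *s y x = z x}"

definition geom_mult :: "nat \<Rightarrow> (nat \<Rightarrow> real \<Rightarrow> complex^'m^'m) \<Rightarrow> complex \<Rightarrow> nat" where
  "geom_mult n P l = fun_vs.dim (eigenspace n P l)"

definition alg_mult :: "nat \<Rightarrow> (nat \<Rightarrow> real \<Rightarrow> complex^'m^'m) \<Rightarrow> complex \<Rightarrow> nat" where
  "alg_mult n P l = fun_vs.dim (\<Union>p. root_space n P l p)"

definition num_eigenvalues_in ::
    "nat \<Rightarrow> (nat \<Rightarrow> real \<Rightarrow> complex^'m^'m) \<Rightarrow> complex set \<Rightarrow> nat" where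
  "num_eigenvalues_in n P U = (\<Sum>l | l \<in> U \<and> is_eigenvalue n P l. alg_mult n P l)"

definition freq :: "int \<Rightarrow> complex" where
  "freq k = 2 * complex_of_real pi * of_int k * \<i>"

definition eigenvalue_sequences ::
    "nat \<Rightarrow> (nat \<Rightarrow> real \<Rightarrow> complex^'m^'m) \<Rightarrow> int \<Rightarrow> (int \<Rightarrow> 'm \<Rightarrow> complex) \<Rightarrow> bool" where
  "eigenvalue_sequences n P N lam \<longleftrightarrow>
     (\<forall>k j. N \<le> \<bar>k\<bar> \<longrightarrow> is_eigenvalue n P (lam k j)) \<and>
     (\<exists>R. \<forall>l. R \<le> norm l \<longrightarrow> is_eigenvalue n P l \<longrightarrow>
        card {(k, j). N \<le> \<bar>k\<bar> \<and> lam k j = l} = alg_mult n P l) \<and>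
     (\<exists>M. \<forall>k j. N \<le> \<bar>k\<bar> \<longrightarrow> norm (lam k j - freq k ^ n)
        \<le> M * real_of_int \<bar>k\<bar> powr (real n - 1 - 1 / (2 * real CARD('m))))"


section \<open>Quantities attached to the leading coefficient\<close>

definition mean_matrix :: "(real \<Rightarrow> complex^'m^'m) \<Rightarrow> complex^'m^'m" where
  "mean_matrix Q = (\<chi> i j. integral {0..1} (\<lambda>x. Q x $ i $ j))"

definition adjoint_matrix :: "complex^'m^'m \<Rightarrow> complex^'m^'m" where
  "adjoint_matrix A = (\<chi> i j. cnj (A $ j $ i))"

definition exp_fun :: "complex^'m \<Rightarrow> int \<Rightarrow> real \<Rightarrow> complex^'m" where
  "exp_fun u k x = exp (freq k * of_real x) *s u"

definition coeff_b ::
    "(real \<Rightarrow> complex^'m^'m) \<Rightarrow> ('m \<Rightarrow> complex^'m) \<Rightarrow> ('m \<Rightarrow> complex^'m) \<Rightarrow> 'm \<Rightarrow> 'm \<Rightarrow> int \<Rightarrow> complex"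
  where
  "coeff_b Q v w s q p =
     integral {0..1} (\<lambda>x. cdot (Q x *v v q) (w s) * exp (- freq p * of_real x))"

text \<open>In the following definitions \<open>b s q p\<close> stands for the array of coefficients \<open>coeff_b\<close>.\<close>

definition max_b :: "('m::finite \<Rightarrow> 'm \<Rightarrow> int \<Rightarrow> complex) \<Rightarrow> int \<Rightarrow> real" where
  "max_b b k = Max {norm (b i j k) | i j. True}"

definition log_ratio :: "int \<Rightarrow> real" where
  "log_ratio k = ln (real_of_int \<bar>k\<bar>) / real_of_int \<bar>k\<bar>"

definition gamma_b :: "('m \<Rightarrow> 'm \<Rightarrow> int \<Rightarrow> complex) \<Rightarrow> int \<Rightarrow> 'm \<Rightarrow> real" where
  "gamma_b b k j = max (sqrt (norm (b j j k) / norm (b j j (-k))))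
                       (sqrt (norm (b j j (-k)) / norm (b j j k)))"

definition d_b :: "('m::finite \<Rightarrow> 'm \<Rightarrow> int \<Rightarrow> complex) \<Rightarrow> int \<Rightarrow> real" where
  "d_b b k = max (max_b b (2*k) * max_b b (-2*k)) (log_ratio k)"

definition mu_approx :: "nat \<Rightarrow> ('m \<Rightarrow> complex) \<Rightarrow> int \<Rightarrow> 'm \<Rightarrow> complex" where
  "mu_approx n \<mu> k j = freq k ^ n + \<mu> j * freq k ^ (n-2)"

text \<open>The matrix norm in \<open>eps_radius\<close> is the operator norm of the matrix with columns \<open>v j\<close>.\<close>

definition eps_radius ::
    "nat \<Rightarrow> real \<Rightarrow> ('m \<Rightarrow> complex^'m) \<Rightarrow> ('m::finite \<Rightarrow> 'm \<Rightarrow> int \<Rightarrow> complex) \<Rightarrow> int \<Rightarrow> real" where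
  "eps_radius n c v b k = 2 * real CARD('m) * c * real_of_int k ^ (n-2)
     * (max_b b (2*k) + max_b b (-2*k) + log_ratio k)
     * onorm (\<lambda>x. (\<chi> i j. v j $ i) *v x)"

text \<open>The sign is encoded by \<open>\<sigma> = 1\<close> or \<open>\<sigma> = -1\<close>; \<open>q k j\<close> is the chosen square root of
  \<open>b j j k * b j j (-k)\<close>.\<close>

definition h_center ::
    "nat \<Rightarrow> ('m \<Rightarrow> complex) \<Rightarrow> (int \<Rightarrow> 'm \<Rightarrow> complex) \<Rightarrow> int \<Rightarrow> int \<Rightarrow> 'm \<Rightarrow> complex" where
  "h_center n \<mu> q \<sigma> k j =
     freq k ^ n + \<mu> j * freq k ^ (n-2) + of_int \<sigma> * freq k ^ (n-2) * q (2*k) j"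

definition U_disk ::
    "nat \<Rightarrow> ('m \<Rightarrow> complex) \<Rightarrow> ('m::finite \<Rightarrow> 'm \<Rightarrow> int \<Rightarrow> complex) \<Rightarrow> (int \<Rightarrow> 'm \<Rightarrow> complex) \<Rightarrow> real
      \<Rightarrow> int \<Rightarrow> int \<Rightarrow> 'm \<Rightarrow> complex set" where
  "U_disk n \<mu> b q c \<sigma> k j =
     {l. norm (l - h_center n \<mu> q \<sigma> k j) < c * real_of_int k ^ (n-2) * gamma_b b (2*k) j * d_b b k}"

end

theory Submission
  imports Defs
begin

text \<open>On the exponential with frequency \<open>p\<close> the unperturbed operator acts as the scalar \<open>freq p ^ n\<close>, and as \<open>n\<close>
  is even, exactly the frequencies \<open>k\<close> and \<open>- k\<close> share the value \<open>freq k ^ n\<close>. The theorem holds because an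
  eigenfunction whose eigenvalue is close to \<open>mu_approx n \<mu> k j\<close> lives, up to small errors, on these two
  frequencies, where a two-by-two matrix governs it.
  
  Let \<open>y\<close> be a normalized eigenfunction with eigenvalue \<open>l\<close>. Taking Fourier coefficients in the differential
  equation expresses \<open>(l - freq p ^ n) c\<^sub>p\<close>, where \<open>c\<^sub>p\<close> is the coefficient of \<open>y\<close>, by the coefficients of the
  products \<open>P\<^sub>\<nu> y\<^sup>(\<^sup>n\<^sup>-\<^sup>\<nu>\<^sup>)\<close> (\<open>eigenfunction_fourier_coeff\<close>). This is an integration by parts for a function that
  is only absolutely continuous; it rests on Lebesgue's theorem \<open>ac01_differentiable_ae\<close> and on
  \<open>ac01_fundamental_theorem\<close>. Since \<open>l\<close> differs from \<open>freq k ^ n\<close> by \<open>O(k\<^sup>n\<^sup>-\<^sup>2)\<close>, the factor \<open>l - freq p ^ n\<close> is large for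
  all other frequencies (\<open>spectral_gap\<close>), and \<open>resonance_sum\<close> adds up what they contribute: a fraction
  \<open>O(ln k / k)\<close> of the size of \<open>y\<close> (\<open>resonant_approximation\<close>). The coefficients at \<open>k\<close> and \<open>- k\<close> are at most \<open>1\<close>, so
  the size of \<open>y\<close> and of its derivatives is bounded outright (\<open>derivative_bound\<close>).
  
  The equations with \<open>p = k\<close> and \<open>p = - k\<close>, tested against the eigenvectors \<open>w\<^sub>s\<close>, now become a linear system for
  the amplitudes of \<open>y\<close> along the functions \<open>exp_fun (v s) (\<plusminus>k)\<close> (\<open>resonant_system\<close>). The amplitudes with \<open>s \<noteq> j\<close>
  are \<open>O(b\<^sub>2\<^sub>k + b\<^sub>-\<^sub>2\<^sub>k + ln k / k)\<close>, because \<open>\<mu>\<^sub>s\<close> stays away from \<open>\<mu>\<^sub>j\<close>. For the remaining two, \<open>u\<close> at \<open>k\<close> and \<open>u'\<close>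
  at \<open>- k\<close>, and for \<open>x = (l - mu_approx n \<mu> k j) / freq k ^ (n - 2)\<close>, one is left (\<open>reduced_system\<close>) with
  \<open>x u = b\<^sub>j\<^sub>j\<^sub>,\<^sub>2\<^sub>k u' + O(d\<^sub>k)\<close> and \<open>x u' = b\<^sub>j\<^sub>j\<^sub>,\<^sub>-\<^sub>2\<^sub>k u + O(d\<^sub>k)\<close>.
  
  The limit hypotheses make \<open>d\<^sub>k\<close> negligible against both coefficients and force \<open>b\<^sub>2\<^sub>k\<close> and \<open>b\<^sub>-\<^sub>2\<^sub>k\<close> to tend to \<open>0\<close>
  (\<open>d_b_relatively_small\<close>). Elimination of \<open>u\<close> and \<open>u'\<close> puts \<open>x\<close> within \<open>O(\<gamma> d\<^sub>k)\<close> of a square root of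
  \<open>b\<^sub>j\<^sub>j\<^sub>,\<^sub>2\<^sub>k b\<^sub>j\<^sub>j\<^sub>,\<^sub>-\<^sub>2\<^sub>k\<close> (\<open>near_square_root\<close>), which locates the eigenvalue. Substituting back gives
  \<open>u' / u = \<plusminus> (q / b\<^sub>j\<^sub>j\<^sub>,\<^sub>2\<^sub>k) (1 + o(1))\<close> (\<open>amplitude_ratio\<close>). In particular \<open>u\<close> never vanishes on a normalized
  eigenfunction; as \<open>u\<close> depends linearly on \<open>y\<close>, the eigenspace is a line (\<open>eigenspace_one_dimensional\<close>) and
  \<open>\<alpha> = u' / u\<close> depends on the eigenvalue only. Finally \<open>|u|\<^sup>2 + |u'|\<^sup>2\<close> is almost \<open>1\<close>, which turns
  \<open>y \<approx> u exp_fun (v j) k + u' exp_fun (v j) (- k)\<close> into the asserted formula (\<open>two_mode_profile\<close>).\<close>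

section \<open>Absolute continuity on the unit interval\<close>

text \<open>This is the condition of \<open>abs_continuous_on_unit\<close> for an arbitrary normed codomain: it is applied to the real
  coordinates of a derivative, where differentiability is decided, and to complex products with an exponential,
  to which the fundamental theorem of calculus is applied.\<close>

definition ac01 :: "(real \<Rightarrow> 'a::real_normed_vector) \<Rightarrow> bool" where
  "ac01 f \<longleftrightarrow>
     (\<forall>\<epsilon>>0. \<exists>\<delta>>0. \<forall>(r::nat) (a::nat \<Rightarrow> real) (b::nat \<Rightarrow> real).
        (\<forall>i<r. 0 \<le> a i \<and> a i \<le> b i \<and> b i \<le> 1) \<longrightarrow>
        disjoint_family_on (\<lambda>i. {a i<..<b i}) {..<r} \<longrightarrow>
        (\<Sum>i<r. b i - a i) < \<delta> \<longrightarrow> (\<Sum>i<r. norm (f (b i) - f (a i))) < \<epsilon>)"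

text \<open>Families indexed by any finite set, in particular by a division of an interval or by a tagged division, are
  more convenient than numbered ones.\<close>

lemma ac01_finite:
  assumes "ac01 f" "\<epsilon> > 0"
  obtains \<delta> where "\<delta> > 0"
    "\<And>I (a::'i \<Rightarrow> real) b. finite I \<Longrightarrow> (\<And>i. i \<in> I \<Longrightarrow> 0 \<le> a i \<and> a i \<le> b i \<and> b i \<le> 1) \<Longrightarrow>
      disjoint_family_on (\<lambda>i. {a i<..<b i}) I \<Longrightarrow> (\<Sum>i\<in>I. b i - a i) < \<delta> \<Longrightarrow>
      (\<Sum>i\<in>I. norm (f (b i) - f (a i))) < \<epsilon>"
proof -
  obtain \<delta> where \<delta>: "\<delta> > 0" and main: "\<And>(r::nat) a b.
        (\<forall>i<r. 0 \<le> a i \<and> a i \<le> b i \<and> b i \<le> 1) \<Longrightarrow>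
        disjoint_family_on (\<lambda>i. {a i<..<b i}) {..<r} \<Longrightarrow>
        (\<Sum>i<r. b i - a i) < \<delta> \<Longrightarrow> (\<Sum>i<r. norm (f (b i) - f (a i))) < \<epsilon>"
    using assms unfolding ac01_def by meson
  show thesis
  proof (rule that[OF \<delta>])
    fix I and a b :: "'i \<Rightarrow> real"
    assume I: "finite I" and ab: "\<And>i. i \<in> I \<Longrightarrow> 0 \<le> a i \<and> a i \<le> b i \<and> b i \<le> 1"
      and disj: "disjoint_family_on (\<lambda>i. {a i<..<b i}) I" and less: "(\<Sum>i\<in>I. b i - a i) < \<delta>"
    obtain h where h: "bij_betw h {..<card I} I"
      using ex_bij_betw_nat_finite[OF I] by (auto simp: atLeast0LessThan)
    have h_in: "h i \<in> I" if "i < card I" for i using h that by (auto simp: bij_betw_def)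
    have "(\<Sum>i<card I. norm (f (b (h i)) - f (a (h i)))) < \<epsilon>"
    proof (rule main)
      show "\<forall>i<card I. 0 \<le> a (h i) \<and> a (h i) \<le> b (h i) \<and> b (h i) \<le> 1"
        using ab h_in by blast
      show "disjoint_family_on (\<lambda>i. {a (h i)<..<b (h i)}) {..<card I}"
        unfolding disjoint_family_on_def
      proof safe
        fix i j x assume ij: "i < card I" "j < card I" "i \<noteq> j"
          and x: "x \<in> {a (h i)<..<b (h i)}" "x \<in> {a (h j)<..<b (h j)}"
        have "h i \<noteq> h j" using ij h by (auto simp: bij_betw_def inj_on_def)
        then show "x \<in> {}" using disj h_in ij x unfolding disjoint_family_on_def by blast
      qed
      show "(\<Sum>i<card I. b (h i) - a (h i)) < \<delta>"
        using less sum.reindex_bij_betw[OF h, of "\<lambda>i. b i - a i"] by simp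
    qed
    then show "(\<Sum>i\<in>I. norm (f (b i) - f (a i))) < \<epsilon>"
      using sum.reindex_bij_betw[OF h, of "\<lambda>i. norm (f (b i) - f (a i))"] by simp
  qed
qed

lemma ac01_single:
  assumes "ac01 f" "\<epsilon> > 0"
  obtains \<delta> where "\<delta> > 0"
    "\<And>a b. 0 \<le> a \<Longrightarrow> a \<le> b \<Longrightarrow> b \<le> 1 \<Longrightarrow> b - a < \<delta> \<Longrightarrow> norm (f b - f a) < \<epsilon>"
proof -
  obtain \<delta> where \<delta>: "\<delta> > 0" and main: "\<And>I (a::unit \<Rightarrow> real) b. finite I \<Longrightarrow>
      (\<And>i. i \<in> I \<Longrightarrow> 0 \<le> a i \<and> a i \<le> b i \<and> b i \<le> 1) \<Longrightarrow>
      disjoint_family_on (\<lambda>i. {a i<..<b i}) I \<Longrightarrow> (\<Sum>i\<in>I. b i - a i) < \<delta> \<Longrightarrow>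
      (\<Sum>i\<in>I. norm (f (b i) - f (a i))) < \<epsilon>"
    by (rule ac01_finite[OF assms]) blast
  show thesis
  proof (rule that[OF \<delta>])
    fix a b :: real assume "0 \<le> a" "a \<le> b" "b \<le> 1" "b - a < \<delta>"
    then show "norm (f b - f a) < \<epsilon>"
      using main[of "{()}" "\<lambda>_. a" "\<lambda>_. b"] by (simp add: disjoint_family_on_def)
  qed
qed

lemma ac01_continuous:
  assumes "ac01 f" shows "continuous_on {0..1} f"
  unfolding continuous_on_iff
proof safe
  fix x e :: real assume x: "x \<in> {0..1}" and e: "0 < e"
  obtain \<delta> where \<delta>: "\<delta> > 0"
    and m: "\<And>a b. 0 \<le> a \<Longrightarrow> a \<le> b \<Longrightarrow> b \<le> 1 \<Longrightarrow> b - a < \<delta> \<Longrightarrow> norm (f b - f a) < e"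
    using ac01_single[OF assms e] by metis
  show "\<exists>d>0. \<forall>x'\<in>{0..1}. dist x' x < d \<longrightarrow> dist (f x') (f x) < e"
  proof (intro exI conjI ballI impI)
    fix x' assume x': "x' \<in> {0..1}" "dist x' x < \<delta>"
    show "dist (f x') (f x) < e"
      using m[of x x'] m[of x' x] x x'
      by (cases "x \<le> x'") (auto simp: dist_norm norm_minus_commute)
  qed (use \<delta> in auto)
qed

lemma ac01_ident: "ac01 (\<lambda>x::real. x)"
  unfolding ac01_def
proof (intro allI impI exI conjI)
  fix \<epsilon> :: real and r :: nat and a b :: "nat \<Rightarrow> real"
  assume A: "\<forall>i<r. 0 \<le> a i \<and> a i \<le> b i \<and> b i \<le> 1" and s: "(\<Sum>i<r. b i - a i) < \<epsilon>"
  have "(\<Sum>i<r. norm (b i - a i)) = (\<Sum>i<r. b i - a i)" using A by (intro sum.cong) auto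
  then show "(\<Sum>i<r. norm (b i - a i)) < \<epsilon>" using s by simp
qed

text \<open>Both sums of increments can be made small at once, by taking the smaller of the two \<open>\<delta>\<close>. The closure
  properties below only differ in how they bound an increment of the new function.\<close>

lemma ac01_dominated:
  assumes f: "ac01 f" and g: "ac01 g"
    and dom: "\<And>a b. 0 \<le> a \<Longrightarrow> a \<le> b \<Longrightarrow> b \<le> 1 \<Longrightarrow>
      norm (h b - h a) \<le> K * norm (f b - f a) + L * norm (g b - g a)"
  shows "ac01 h"
  unfolding ac01_def
proof (intro allI impI)
  fix \<epsilon> :: real assume \<epsilon>: "\<epsilon> > 0"
  define M where "M = max 1 (max K L)"
  have M: "M > 0" "K \<le> M" "L \<le> M" unfolding M_def by auto
  have \<epsilon>': "\<epsilon> / (2 * M) > 0" using \<epsilon> M by simp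
  obtain \<delta>1 where \<delta>1: "\<delta>1 > 0" "\<And>(r::nat) a b.
        (\<forall>i<r. 0 \<le> a i \<and> a i \<le> b i \<and> b i \<le> 1) \<Longrightarrow>
        disjoint_family_on (\<lambda>i. {a i<..<b i}) {..<r} \<Longrightarrow>
        (\<Sum>i<r. b i - a i) < \<delta>1 \<Longrightarrow> (\<Sum>i<r. norm (f (b i) - f (a i))) < \<epsilon> / (2 * M)"
    using f \<epsilon>' unfolding ac01_def by meson
  obtain \<delta>2 where \<delta>2: "\<delta>2 > 0" "\<And>(r::nat) a b.
        (\<forall>i<r. 0 \<le> a i \<and> a i \<le> b i \<and> b i \<le> 1) \<Longrightarrow>
        disjoint_family_on (\<lambda>i. {a i<..<b i}) {..<r} \<Longrightarrow>
        (\<Sum>i<r. b i - a i) < \<delta>2 \<Longrightarrow> (\<Sum>i<r. norm (g (b i) - g (a i))) < \<epsilon> / (2 * M)"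
    using g \<epsilon>' unfolding ac01_def by meson
  show "\<exists>\<delta>>0. \<forall>(r::nat) a b.
        (\<forall>i<r. 0 \<le> a i \<and> a i \<le> b i \<and> b i \<le> 1) \<longrightarrow>
        disjoint_family_on (\<lambda>i. {a i<..<b i}) {..<r} \<longrightarrow>
        (\<Sum>i<r. b i - a i) < \<delta> \<longrightarrow> (\<Sum>i<r. norm (h (b i) - h (a i))) < \<epsilon>"
  proof (intro exI conjI allI impI)
    show "min \<delta>1 \<delta>2 > 0" using \<delta>1 \<delta>2 by simp
    fix r :: nat and a b :: "nat \<Rightarrow> real"
    assume A: "\<forall>i<r. 0 \<le> a i \<and> a i \<le> b i \<and> b i \<le> 1"
        "disjoint_family_on (\<lambda>i. {a i<..<b i}) {..<r}" and s: "(\<Sum>i<r. b i - a i) < min \<delta>1 \<delta>2"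
    have "(\<Sum>i<r. norm (h (b i) - h (a i)))
        \<le> (\<Sum>i<r. M * (norm (f (b i) - f (a i)) + norm (g (b i) - g (a i))))"
    proof (rule sum_mono)
      fix i assume "i \<in> {..<r}"
      then have "norm (h (b i) - h (a i)) \<le> K * norm (f (b i) - f (a i)) + L * norm (g (b i) - g (a i))"
        using A(1) by (intro dom) auto
      also have "\<dots> \<le> M * norm (f (b i) - f (a i)) + M * norm (g (b i) - g (a i))"
        using M by (intro add_mono mult_right_mono) auto
      finally show "norm (h (b i) - h (a i)) \<le> M * (norm (f (b i) - f (a i)) + norm (g (b i) - g (a i)))"
        by (simp add: distrib_left)
    qed
    also have "\<dots> = M * ((\<Sum>i<r. norm (f (b i) - f (a i))) + (\<Sum>i<r. norm (g (b i) - g (a i))))"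
      by (simp only: sum_distrib_left[symmetric] sum.distrib)
    also have "\<dots> < M * (\<epsilon> / (2 * M) + \<epsilon> / (2 * M))"
      using \<delta>1(2)[OF A] \<delta>2(2)[OF A] s M by (intro mult_strict_left_mono add_strict_mono) auto
    also have "\<dots> = \<epsilon>" using M by simp
    finally show "(\<Sum>i<r. norm (h (b i) - h (a i))) < \<epsilon>" .
  qed
qed

lemma ac01_bounded_linear:
  assumes f: "ac01 f" and h: "bounded_linear h" shows "ac01 (\<lambda>x. h (f x))"
proof -
  interpret h: bounded_linear h by fact
  obtain B where B: "\<And>x. norm (h x) \<le> norm x * B" using h.bounded by blast
  show ?thesis
    by (rule ac01_dominated[OF f f, of _ B 0]) (use B in \<open>simp add: mult.commute flip: h.diff\<close>)
qed

lemma ac01_times_Lipschitz: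
  fixes f g :: "real \<Rightarrow> complex"
  assumes f: "ac01 f"
    and g: "\<And>a b. 0 \<le> a \<Longrightarrow> a \<le> b \<Longrightarrow> b \<le> 1 \<Longrightarrow> norm (g b - g a) \<le> K * (b - a)"
    and gb: "\<And>x. 0 \<le> x \<Longrightarrow> x \<le> 1 \<Longrightarrow> norm (g x) \<le> G"
  shows "ac01 (\<lambda>x. f x * g x)"
proof -
  have "compact (f ` {0..1})"
    by (intro compact_continuous_image ac01_continuous f) simp
  then obtain M where M: "\<forall>y\<in>f ` {0..1}. norm y \<le> M"
    using compact_imp_bounded bounded_iff by blast
  show ?thesis
  proof (rule ac01_dominated[OF f ac01_ident, of _ G "M * K"])
    fix a b :: real assume ab: "0 \<le> a" "a \<le> b" "b \<le> 1"
    have Ma: "norm (f a) \<le> M" using M ab by auto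
    have "f b * g b - f a * g a = (f b - f a) * g b + f a * (g b - g a)" by (simp add: algebra_simps)
    then have "norm (f b * g b - f a * g a) \<le> norm (f b - f a) * norm (g b) + norm (f a) * norm (g b - g a)"
      by (metis norm_mult norm_triangle_ineq)
    also have "\<dots> \<le> norm (f b - f a) * G + M * (K * (b - a))"
      using gb[of b] g[OF ab] Ma ab order_trans[OF norm_ge_zero Ma]
      by (intro add_mono mult_left_mono mult_mono) auto
    finally show "norm (f b * g b - f a * g a) \<le> G * norm (f b - f a) + M * K * norm (b - a)"
      using ab by (simp add: mult_ac)
  qed
qed

lemma ac01_Lipschitz:
  assumes g: "\<And>a b. 0 \<le> a \<Longrightarrow> a \<le> b \<Longrightarrow> b \<le> 1 \<Longrightarrow> norm (g b - g a) \<le> K * (b - a)"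
  shows "ac01 g"
  by (rule ac01_dominated[OF ac01_ident ac01_ident, of _ K 0]) (use g in auto)

lemma ac01_add:
  assumes f: "ac01 f" and g: "ac01 g" shows "ac01 (\<lambda>x. f x + g x)"
  by (rule ac01_dominated[OF f g, of _ 1 1]) (simp add: norm_diff_triangle_ineq)

lemma ac01_cong:
  assumes "\<And>x. x \<in> {0..1} \<Longrightarrow> f x = g x" shows "ac01 f \<longleftrightarrow> ac01 g"
proof
  assume "ac01 f" then show "ac01 g"
    by (rule ac01_dominated[where g = f and K = 1 and L = 0, rotated]) (use assms \<open>ac01 f\<close> in auto)
next
  assume "ac01 g" then show "ac01 f"
    by (rule ac01_dominated[where g = g and K = 1 and L = 0, rotated]) (use assms \<open>ac01 g\<close> in auto)
qed

section \<open>Differentiability almost everywhere\<close>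

text \<open>Choosing the left end point of each interval as its tag reduces this to the additivity of increments over
  tagged divisions.\<close>

lemma division_telescope:
  fixes f :: "real \<Rightarrow> 'a::real_normed_vector"
  assumes "D division_of {a..b}" "a \<le> b"
  shows "(\<Sum>K\<in>D. f (Sup K) - f (Inf K)) = f b - f a"
proof -
  let ?p = "(\<lambda>K. (Inf K, K)) ` D"
  have fin: "finite D" using assms(1) by auto
  have inj: "inj_on (\<lambda>K. (Inf K, K)) D" by (auto simp: inj_on_def)
  have "?p tagged_division_of {a..b}"
    unfolding tagged_division_of
  proof (intro conjI allI impI)
    show "finite ?p" using fin by simp
    show "\<Union>{k. \<exists>x. (x, k) \<in> ?p} = {a..b}"
    proof -
      have "{k. \<exists>x. (x, k) \<in> ?p} = D" by auto
      then show ?thesis using assms(1) by (simp add: division_of_def)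
    qed
    fix x K assume xK: "(x, K) \<in> ?p"
    then have K: "K \<in> D" "x = Inf K" by auto
    show "K \<subseteq> {a..b}" using assms(1) K by auto
    show cd: "\<exists>c d. K = cbox c d" using division_ofD(4)[OF assms(1) K(1)] .
    obtain c d where "K = cbox c d" using cd by blast
    moreover have "K \<noteq> {}" using assms(1) K by auto
    ultimately show "x \<in> K" using K by auto
  next
    fix x1 k1 x2 k2 assume "(x1, k1) \<in> ?p \<and> (x2, k2) \<in> ?p \<and> (x1, k1) \<noteq> (x2, k2)"
    then have "k1 \<in> D" "k2 \<in> D" "k1 \<noteq> k2" by auto
    then show "interior k1 \<inter> interior k2 = {}" by (rule division_ofD(5)[OF assms(1)])
  qed
  from additive_tagged_division_1[OF assms(2) this, of f]
  show ?thesis by (simp add: sum.reindex[OF inj])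
qed

lemma ac01_division:
  assumes "ac01 f" "\<epsilon> > 0"
  obtains \<delta> where "\<delta> > 0"
    "\<And>D. D division_of \<Union>D \<Longrightarrow> \<Union>D \<subseteq> {0..1} \<Longrightarrow> (\<Sum>K\<in>D. Sup K - Inf K) < \<delta> \<Longrightarrow>
      (\<Sum>K\<in>D. norm (f (Sup K) - f (Inf K))) < \<epsilon>"
proof -
  obtain \<delta> where \<delta>: "\<delta> > 0" and main: "\<And>I (a::real set \<Rightarrow> real) b. finite I \<Longrightarrow>
      (\<And>i. i \<in> I \<Longrightarrow> 0 \<le> a i \<and> a i \<le> b i \<and> b i \<le> 1) \<Longrightarrow>
      disjoint_family_on (\<lambda>i. {a i<..<b i}) I \<Longrightarrow> (\<Sum>i\<in>I. b i - a i) < \<delta> \<Longrightarrow>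
      (\<Sum>i\<in>I. norm (f (b i) - f (a i))) < \<epsilon>"
    by (rule ac01_finite[OF assms]) blast
  show thesis
  proof (rule that[OF \<delta>])
    fix D :: "real set set"
    assume D: "D division_of \<Union>D" "\<Union>D \<subseteq> {0..1}" "(\<Sum>K\<in>D. Sup K - Inf K) < \<delta>"
    have K: "K = {Inf K..Sup K} \<and> Inf K \<le> Sup K" if KD: "K \<in> D" for K
    proof -
      obtain a b where "K = cbox a b" using division_ofD(4)[OF D(1) KD] by blast
      moreover have "K \<noteq> {}" using division_ofD(3)[OF D(1) KD] .
      ultimately show ?thesis by auto
    qed
    show "(\<Sum>K\<in>D. norm (f (Sup K) - f (Inf K))) < \<epsilon>"
    proof (rule main)
      show "finite D" using D(1) by auto
      show "0 \<le> Inf K \<and> Inf K \<le> Sup K \<and> Sup K \<le> 1" if "K \<in> D" for K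
      proof -
        have le: "Inf K \<le> Sup K" using K[OF that] by blast
        then have "Inf K \<in> {Inf K..Sup K}" "Sup K \<in> {Inf K..Sup K}" by auto
        then have "Inf K \<in> K" "Sup K \<in> K" using K[OF that] by blast+
        then have "Inf K \<in> {0..1}" "Sup K \<in> {0..1}" using that D(2) by blast+
        then show ?thesis using le by simp
      qed
      show "disjoint_family_on (\<lambda>K. {Inf K<..<Sup K}) D"
        unfolding disjoint_family_on_def
      proof (intro ballI impI)
        fix K L assume KL: "K \<in> D" "L \<in> D" "K \<noteq> L"
        have "interior K \<inter> interior L = {}" using division_ofD(5)[OF D(1) KL] .
        moreover have "interior K = {Inf K<..<Sup K}" "interior L = {Inf L<..<Sup L}"
          using K[OF KL(1)] K[OF KL(2)] interior_atLeastAtMost_real by metis+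
        ultimately show "{Inf K<..<Sup K} \<inter> {Inf L<..<Sup L} = {}" by simp
      qed
    qed (use D(3) in simp)
  qed
qed

text \<open>Vitali's covering theorem, with two changes. The end points of the countably many intervals form a null set, so
  the interiors still exhaust \<open>E\<close>; and by continuity of measure from below finitely many intervals suffice up to
  \<open>e\<close>. The set \<open>E\<close> is thus covered by open intervals, inside which a second covering can be chosen.\<close>

lemma Vitali_finite_intervals:
  fixes E :: "real set"
  assumes E: "E \<in> lmeasurable" and e: "e > 0"
    and fine: "\<And>x d. x \<in> E \<Longrightarrow> d > 0 \<Longrightarrow> \<exists>a b. a < x \<and> x < b \<and> b - a < d \<and> Q a b"
  obtains C where "finite C" "pairwise disjnt C"
    "\<forall>K\<in>C. \<exists>a b. a < b \<and> K = {a..b} \<and> Q a b"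
    "measure lebesgue E - e < measure lebesgue (E \<inter> (\<Union>K\<in>C. interior K))"
proof -
  define I where "I = {(a, b). a < b \<and> Q a b}"
  define c where "c = (\<lambda>(a::real, b). (a + b) / 2)"
  define r where "r = (\<lambda>(a::real, b). (b - a) / 2)"
  have cb: "cball (c i) (r i) = {fst i..snd i}" for i
    by (cases i) (auto simp: c_def r_def cball_eq_atLeastAtMost field_simps)
  have rpos: "0 < r i" if "i \<in> I" for i using that by (auto simp: I_def r_def)
  have fineI: "\<exists>i. i \<in> I \<and> x \<in> cball (c i) (r i) \<and> r i < d" if xd: "x \<in> E" "0 < d" for x d
  proof -
    obtain a b where "a < x" "x < b" "b - a < d" "Q a b" using fine[OF xd] by blast
    then show ?thesis by (intro exI[of _ "(a,b)"], unfold cb) (auto simp: I_def r_def)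
  qed
  obtain C0 where C0: "countable C0" "C0 \<subseteq> I"
     "pairwise (\<lambda>i j. disjnt (cball (c i) (r i)) (cball (c j) (r j))) C0"
     "negligible (E - (\<Union>i \<in> C0. cball (c i) (r i)))"
    by (rule Vitali_covering_theorem_cballs[of I r E c, OF rpos fineI])
  let ?J = "\<lambda>i. {fst i<..<snd i}"
  have neg: "negligible (E - (\<Union>i\<in>C0. ?J i))"
  proof (rule negligible_subset)
    show "negligible ((E - (\<Union>i \<in> C0. cball (c i) (r i))) \<union> (fst ` C0 \<union> snd ` C0))"
    proof (rule negligible_Un[OF C0(4)])
      have "fst ` C0 \<union> snd ` C0 \<in> null_sets lborel"
        using C0(1) by (intro countable_imp_null_set_lborel) auto
      then show "negligible (fst ` C0 \<union> snd ` C0)"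
        by (auto simp: negligible_iff_null_sets intro: null_sets_completionI)
    qed
    show "E - (\<Union>i\<in>C0. ?J i) \<subseteq> (E - (\<Union>i \<in> C0. cball (c i) (r i))) \<union> (fst ` C0 \<union> snd ` C0)"
      unfolding cb by force
  qed
  have inI: "\<exists>a b. a < b \<and> {fst i..snd i} = {a..b} \<and> Q a b" if "i \<in> C0" for i
    using that C0(2) by (auto simp: I_def)
  have meas: "measure lebesgue E = measure lebesgue (E \<inter> (\<Union>i\<in>C0. ?J i))"
  proof (rule measure_negligible_symdiff[OF E, symmetric])
    show "negligible (sym_diff E (E \<inter> (\<Union>i\<in>C0. ?J i)))"
      by (rule negligible_subset[OF neg]) auto
  qed
  have "\<exists>C1. finite C1 \<and> C1 \<subseteq> C0 \<and> measure lebesgue E - e < measure lebesgue (E \<inter> (\<Union>i\<in>C1. ?J i))"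
  proof (cases "C0 = {}")
    case True
    then show ?thesis using meas e by (intro exI[of _ "{}"]) auto
  next
    case False
    define A where "A = (\<lambda>n::nat. E \<inter> (\<Union>i\<in>from_nat_into C0 ` {..n}. ?J i))"
    have UA: "(\<Union>n. A n) = E \<inter> (\<Union>i\<in>C0. ?J i)"
    proof -
      have "C0 = range (from_nat_into C0)" using False C0(1) by (simp add: range_from_nat_into)
      then have "E \<inter> (\<Union>i\<in>C0. ?J i) = E \<inter> (\<Union>i\<in>range (from_nat_into C0). ?J i)" by simp
      also have "\<dots> = (\<Union>n. A n)" unfolding A_def by blast
      finally show ?thesis by simp
    qed
    have Am: "A n \<in> lmeasurable" for n
      unfolding A_def by (intro fmeasurable_Int_fmeasurable[OF E]) auto
    have "(\<lambda>n. measure lebesgue (A n)) \<longlonglongrightarrow> measure lebesgue (\<Union>n. A n)"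
    proof (rule Lim_measure_incseq)
      show "range A \<subseteq> sets lebesgue" using Am by (auto simp: fmeasurable_def)
      show "incseq A" unfolding A_def incseq_def by force
      have "(\<Union>n. A n) \<in> lmeasurable"
        unfolding UA using C0(1) by (intro fmeasurable_Int_fmeasurable[OF E] sets.countable_UN'') auto
      then show "emeasure lebesgue (\<Union>n. A n) \<noteq> \<infinity>" by (auto simp: fmeasurable_def)
    qed
    then have "(\<lambda>n. measure lebesgue (A n)) \<longlonglongrightarrow> measure lebesgue E" using UA meas by simp
    then have "\<forall>\<^sub>F n in sequentially. measure lebesgue E - e < measure lebesgue (A n)"
      by (rule order_tendstoD) (use e in simp)
    then obtain n where "measure lebesgue E - e < measure lebesgue (A n)"
      by (auto simp: eventually_sequentially)
    then show ?thesis
      unfolding A_def using from_nat_into[OF False]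
      by (intro exI[of _ "from_nat_into C0 ` {..n}"]) blast
  qed
  then obtain C1 where C1: "finite C1" "C1 \<subseteq> C0"
    "measure lebesgue E - e < measure lebesgue (E \<inter> (\<Union>i\<in>C1. ?J i))" by blast
  show thesis
  proof (rule that[of "(\<lambda>i. {fst i..snd i}) ` C1"])
    show "finite ((\<lambda>i. {fst i..snd i}) ` C1)" using C1 by simp
    show "pairwise disjnt ((\<lambda>i. {fst i..snd i}) ` C1)"
    proof -
      have "pairwise (\<lambda>i j. disjnt {fst i..snd i} {fst j..snd j}) C1"
        using pairwise_subset[OF C0(3) C1(2)] unfolding cb .
      then show ?thesis unfolding pairwise_image by (rule pairwise_mono) auto
    qed
    show "\<forall>K\<in>(\<lambda>i. {fst i..snd i}) ` C1. \<exists>a b. a < b \<and> K = {a..b} \<and> Q a b"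
      using inI C1(2) by blast
    have "(\<Union>K\<in>(\<lambda>i. {fst i..snd i}) ` C1. interior K) = (\<Union>i\<in>C1. ?J i)"
      by (simp add: interior_atLeastAtMost_real)
    then show "measure lebesgue E - e
        < measure lebesgue (E \<inter> (\<Union>K\<in>(\<lambda>i. {fst i..snd i}) ` C1. interior K))"
      using C1(3) by simp
  qed
qed

text \<open>A point is steep for the slope \<open>v\<close> if arbitrarily short intervals around it have a difference quotient above
  \<open>v\<close>. Intervals that contain the point in their interior take the place of one-sided Dini derivatives: they make
  the set a countable intersection of open sets, for any function, and are what a Vitali covering needs.\<close>

definition steep :: "(real \<Rightarrow> real) \<Rightarrow> real \<Rightarrow> real set" where
  "steep f v = {x. \<forall>d>0. \<exists>a b. 0 \<le> a \<and> a < x \<and> x < b \<and> b \<le> 1 \<and> b - a < d \<and> f b - f a > v * (b - a)}"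

lemma steep_subset: "steep f v \<subseteq> {0<..<1}"
proof
  fix x assume "x \<in> steep f v"
  then obtain a b where "0 \<le> a" "a < x" "x < b" "b \<le> 1"
    unfolding steep_def using zero_less_one[where ?'a=real] by blast
  then show "x \<in> {0<..<1}" by auto
qed

lemma steep_lmeasurable: "steep f v \<in> lmeasurable"
proof -
  let ?U = "\<lambda>n::nat. \<Union>{{a<..<b} | a b. 0 \<le> a \<and> b \<le> 1 \<and> b - a < inverse (real (Suc n)) \<and> f b - f a > v * (b - a)}"
  have "steep f v = (\<Inter>n. ?U n)"
  proof (intro subset_antisym subsetI)
    fix x assume x: "x \<in> steep f v"
    show "x \<in> (\<Inter>n. ?U n)"
    proof
      fix n
      have "inverse (real (Suc n)) > 0" by simp
      then obtain a b where "0 \<le> a" "a < x" "x < b" "b \<le> 1" "b - a < inverse (real (Suc n))" "f b - f a > v * (b - a)"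
        using x unfolding steep_def by blast
      then show "x \<in> ?U n" by (intro UnionI[of "{a<..<b}"]) auto
    qed
  next
    fix x assume x: "x \<in> (\<Inter>n. ?U n)"
    show "x \<in> steep f v"
      unfolding steep_def
    proof (intro CollectI allI impI)
      fix d :: real assume "d > 0"
      then obtain n where n: "inverse (real (Suc n)) < d" using reals_Archimedean by blast
      have "x \<in> ?U n" using x by blast
      then obtain a b where "0 \<le> a" "b \<le> 1" "b - a < inverse (real (Suc n))" "f b - f a > v * (b - a)" "x \<in> {a<..<b}"
        by blast
      then show "\<exists>a b. 0 \<le> a \<and> a < x \<and> x < b \<and> b \<le> 1 \<and> b - a < d \<and> f b - f a > v * (b - a)"
        using n by (intro exI[of _ a] exI[of _ b]) auto
    qed
  qed
  moreover have "?U n \<in> sets borel" for n by (intro borel_open open_Union) auto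
  ultimately have "steep f v \<in> sets borel" by auto
  then have "steep f v \<in> sets lebesgue" by simp
  moreover have "bounded (steep f v)" 
    by (rule bounded_subset[OF bounded_closed_interval[of 0 1]]) (use steep_subset[of f v] in auto)
  ultimately show ?thesis by (rule bounded_set_imp_lmeasurable[rotated])
qed

lemma sum_lengths_eq_measure:
  assumes "finite C" "pairwise disjnt C" "\<forall>K\<in>C. \<exists>a b::real. a < b \<and> K = {a..b}"
  shows "(\<Sum>K\<in>C. Sup K - Inf K) = measure lebesgue (\<Union>C)" "\<Union>C \<in> lmeasurable"
    "C division_of \<Union>C"
proof -
  have K: "K = {Inf K..Sup K} \<and> Inf K < Sup K" if "K \<in> C" for K
    using assms(3) that by fastforce
  have m: "K \<in> lmeasurable" if "K \<in> C" for K
    using K[OF that] by (metis lmeasurable_cbox box_real(2))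
  have "measure lebesgue (\<Union>C) = (\<Sum>K\<in>C. measure lebesgue K)"
    using assms(1,2) m by (intro measure_Union') auto
  also have "\<dots> = (\<Sum>K\<in>C. Sup K - Inf K)"
  proof (rule sum.cong)
    fix A assume "A \<in> C"
    then obtain a b where "a < b" "A = {a..b}" using assms(3) by blast
    then show "measure lebesgue A = Sup A - Inf A" by simp
  qed simp
  finally show "(\<Sum>K\<in>C. Sup K - Inf K) = measure lebesgue (\<Union>C)" by simp
  show "\<Union>C \<in> lmeasurable" using assms(1) m by (intro fmeasurable.finite_Union) auto
  show "C division_of \<Union>C"
    unfolding division_of_def
  proof (intro conjI ballI impI)
    fix A assume A: "A \<in> C"
    show "A \<subseteq> \<Union>C" using A by blast
    show "A \<noteq> {}" using assms(3) A by fastforce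
    show "\<exists>a b. A = cbox a b" using assms(3) A by (metis box_real(2))
  next
    fix A B assume "A \<in> C" "B \<in> C" "A \<noteq> B"
    then have "disjnt A B" using assms(2) by (auto simp: pairwise_def)
    then show "interior A \<inter> interior B = {}"
      unfolding disjnt_def using interior_subset by fast
  qed (simp_all add: assms(1))
qed

text \<open>At the points of this set \<open>E\<close> the slope is below \<open>u\<close> on some short intervals and above \<open>v\<close> on others. Cover \<open>E\<close>
  up to a small error by disjoint intervals \<open>C1\<close> of slope below \<open>u\<close>, contained in an open set hardly larger than
  \<open>E\<close>, and then cover \<open>E\<close> inside these by intervals \<open>C2\<close> of slope above \<open>v\<close>. The gaps \<open>C1 - C2\<close> have small total
  length, so by absolute continuity \<open>f\<close> has nearly the same total increment over \<open>C1\<close> as over \<open>C2\<close>. The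
  former is at most about \<open>u\<close> times the measure of \<open>E\<close>, the latter at least about \<open>v\<close> times it, so the measure is \<open>0\<close>.\<close>

lemma steep_opposed_negligible:
  assumes f: "ac01 f" and uv: "u < v"
  shows "negligible (steep f v \<inter> steep (\<lambda>x. - f x) (- u))"
proof -
  define E where "E = steep f v \<inter> steep (\<lambda>x. - f x) (- u)"
  have Em: "E \<in> lmeasurable"
    unfolding E_def by (intro fmeasurable_Int_fmeasurable steep_lmeasurable fmeasurableD)
  have "measure lebesgue E = 0"
  proof (rule ccontr)
    assume "measure lebesgue E \<noteq> 0"
    then have e: "measure lebesgue E > 0" (is "?e > 0") by (simp add: zero_less_measure_iff)
    \<comment> \<open>The factor \<open>1 + |u|\<close> absorbs the error \<open>u (l1 - l2)\<close> below; the contradiction at the end is \<open>l2 < ?e / 4\<close>.\<close>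
    define \<epsilon> where "\<epsilon> = (v - u) * ?e / (4 * (1 + \<bar>u\<bar>))"
    have \<epsilon>: "\<epsilon> > 0" unfolding \<epsilon>_def using uv e by (intro divide_pos_pos mult_pos_pos) auto
    obtain \<delta>0 where \<delta>0: "\<delta>0 > 0" and ac: "\<And>D. D division_of \<Union>D \<Longrightarrow> \<Union>D \<subseteq> {0..1} \<Longrightarrow>
        (\<Sum>K\<in>D. Sup K - Inf K) < \<delta>0 \<Longrightarrow> (\<Sum>K\<in>D. norm (f (Sup K) - f (Inf K))) < \<epsilon>"
      by (rule ac01_division[OF f \<epsilon>]) blast
    define \<delta> where "\<delta> = min \<delta>0 (min \<epsilon> ?e)"
    have \<delta>: "\<delta> > 0" "\<delta> \<le> \<delta>0" "\<delta> \<le> \<epsilon>" "\<delta> \<le> ?e" unfolding \<delta>_def using \<delta>0 \<epsilon> e by auto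
    obtain T where T: "open T" "E \<subseteq> T" "(T - E) \<in> lmeasurable" "emeasure lebesgue (T - E) < ennreal (\<delta> / 2)"
      using sets_lebesgue_outer_open[of E "\<delta>/2"] Em \<delta>(1) by (auto simp: fmeasurable_def)
    have Tm: "T \<in> lmeasurable"
    proof -
      have "T = E \<union> (T - E)" using T(2) by blast
      then show ?thesis using fmeasurable.Un[OF Em T(3)] by simp
    qed
    have mT: "measure lebesgue T < ?e + \<delta> / 2"
    proof -
      have "measure lebesgue (T - E) < \<delta> / 2"
        using T(3,4) \<delta>(1) by (simp add: emeasure_eq_measure2 ennreal_less_iff)
      moreover have "measure lebesgue T = ?e + measure lebesgue (T - E)"
        using T(2) Em Tm by (simp add: measurable_measure_Diff fmeasurableD)
      ultimately show ?thesis by simp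
    qed
    define Q1 where "Q1 = (\<lambda>a b. 0 \<le> a \<and> b \<le> 1 \<and> {a..b} \<subseteq> T \<and> f b - f a < u * (b - a))"
    have fine1: "\<exists>a b. a < x \<and> x < b \<and> b - a < d \<and> Q1 a b" if x: "x \<in> E" and d: "d > 0" for x d
    proof -
      obtain r where r: "r > 0" "ball x r \<subseteq> T" using T(1,2) x open_contains_ball by blast
      have "min d r > 0" "x \<in> steep (\<lambda>x. - f x) (- u)" using d r x unfolding E_def by auto
      then obtain a b where ab: "0 \<le> a" "a < x" "x < b" "b \<le> 1" "b - a < min d r"
          "- f b - - f a > - u * (b - a)"
        unfolding steep_def by blast
      have "{a..b} \<subseteq> ball x r" using ab by (auto simp: dist_real_def)
      then show ?thesis using ab r unfolding Q1_def by (intro exI[of _ a] exI[of _ b]) auto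
    qed
    have \<delta>4: "\<delta> / 4 > 0" using \<delta> by simp
    obtain C1 where C1: "finite C1" "pairwise disjnt C1"
      "\<forall>K\<in>C1. \<exists>a b. a < b \<and> K = {a..b} \<and> Q1 a b"
      "?e - \<delta> / 4 < measure lebesgue (E \<inter> (\<Union>K\<in>C1. interior K))"
      by (rule Vitali_finite_intervals[OF Em \<delta>4 fine1]) blast
    define E1 where "E1 = E \<inter> (\<Union>K\<in>C1. interior K)"
    have E1m: "E1 \<in> lmeasurable"
      unfolding E1_def using C1(1) by (intro fmeasurable_Int_fmeasurable[OF Em]) auto
    define Q2 where "Q2 = (\<lambda>a b. (\<exists>K\<in>C1. {a..b} \<subseteq> K) \<and> f b - f a > v * (b - a))"
    have fine2: "\<exists>a b. a < x \<and> x < b \<and> b - a < d \<and> Q2 a b" if x: "x \<in> E1" and d: "d > 0" for x d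
    proof -
      obtain K where K: "K \<in> C1" "x \<in> interior K" using x unfolding E1_def by blast
      obtain r where r: "r > 0" "ball x r \<subseteq> K" using K(2) mem_interior by blast
      have "min d r > 0" "x \<in> steep f v" using d r x unfolding E1_def E_def by auto
      then obtain a b where ab: "a < x" "x < b" "b - a < min d r" "f b - f a > v * (b - a)"
        unfolding steep_def by blast
      have "{a..b} \<subseteq> ball x r" using ab by (auto simp: dist_real_def)
      then show ?thesis using ab r K unfolding Q2_def by (intro exI[of _ a] exI[of _ b]) auto
    qed
    obtain C2 where C2: "finite C2" "pairwise disjnt C2"
      "\<forall>K\<in>C2. \<exists>a b. a < b \<and> K = {a..b} \<and> Q2 a b"
      "measure lebesgue E1 - \<delta> / 4 < measure lebesgue (E1 \<inter> (\<Union>K\<in>C2. interior K))"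
      by (rule Vitali_finite_intervals[OF E1m \<delta>4 fine2]) blast
    have C1': "\<forall>K\<in>C1. \<exists>a b. a < b \<and> K = {a..b}" using C1(3) by blast
    have C2': "\<forall>K\<in>C2. \<exists>a b. a < b \<and> K = {a..b}" using C2(3) by blast
    note L1 = sum_lengths_eq_measure[OF C1(1,2) C1']
    note L2 = sum_lengths_eq_measure[OF C2(1,2) C2']
    define l1 where "l1 = (\<Sum>K\<in>C1. Sup K - Inf K)"
    define l2 where "l2 = (\<Sum>K\<in>C2. Sup K - Inf K)"
    have l1: "l1 < ?e + \<delta> / 2"
    proof -
      have "\<Union>C1 \<subseteq> T" using C1(3) unfolding Q1_def by blast
      then have "l1 \<le> measure lebesgue T"
        unfolding l1_def L1(1) using L1(2) Tm by (intro measure_mono_fmeasurable) (auto intro: fmeasurableD)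
      then show ?thesis using mT by simp
    qed
    have l2: "l2 > ?e - \<delta> / 2"
    proof -
      have "measure lebesgue (E1 \<inter> (\<Union>K\<in>C2. interior K)) \<le> measure lebesgue (\<Union>C2)"
      proof (rule measure_mono_fmeasurable)
        show "E1 \<inter> (\<Union>K\<in>C2. interior K) \<subseteq> \<Union>C2" using interior_subset by fast
        show "E1 \<inter> (\<Union>K\<in>C2. interior K) \<in> sets lebesgue"
          using fmeasurableD[OF E1m] C2(1) by (intro sets.Int sets.finite_UN) auto
      qed (rule L2(2))
      then show ?thesis using C1(4) C2(4) L2(1) unfolding l2_def E1_def by linarith
    qed
    \<comment> \<open>Each interval of \<open>C1\<close> is divided into the intervals of \<open>C2\<close> it contains and further ones, the gaps.\<close>
    define Q where "Q = (\<lambda>I. {K \<in> C2. K \<subseteq> I})"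
    have "\<exists>q. Q I \<subseteq> q \<and> q division_of I" if I: "I \<in> C1" for I
    proof -
      obtain a b where ab: "a < b" "I = {a..b}" using C1' I by blast
      have "Q I division_of \<Union>(Q I)"
        by (rule division_of_subset[OF L2(3)]) (auto simp: Q_def)
      moreover have "\<Union>(Q I) \<subseteq> cbox a b" unfolding Q_def using ab by auto
      ultimately obtain q where "Q I \<subseteq> q" "q division_of cbox a b"
        by (rule partial_division_extend_interval)
      then show ?thesis using ab by auto
    qed
    then obtain q where q: "\<And>I. I \<in> C1 \<Longrightarrow> Q I \<subseteq> q I \<and> q I division_of I" by metis
    define G where "G = (\<Union>I\<in>C1. q I - Q I)"
    have finq: "finite (q I)" if "I \<in> C1" for I using q[OF that] by auto
    have sub: "K \<subseteq> I" "K \<noteq> {}" if "K \<in> q I" "I \<in> C1" for K I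
      using q[OF that(2)] that(1) by auto
    have eqI: "I = J" if "I \<in> C1" "J \<in> C1" "K \<subseteq> I" "K \<subseteq> J" "K \<noteq> {}" for I J K
      using C1(2) that unfolding pairwise_def disjnt_def by blast
    have disj: "q I \<inter> q J = {}" if IJ: "I \<in> C1" "J \<in> C1" "I \<noteq> J" for I J
    proof (rule ccontr)
      assume "q I \<inter> q J \<noteq> {}"
      then obtain K where "K \<in> q I" "K \<in> q J" by blast
      then show False using eqI[OF IJ(1,2)] sub IJ by metis
    qed
    have C2_eq: "C2 = (\<Union>I\<in>C1. Q I)"
    proof (intro subset_antisym subsetI)
      fix K assume K: "K \<in> C2"
      then obtain a b where "K = {a..b}" "Q2 a b" using C2(3) by blast
      then obtain I where "I \<in> C1" "K \<subseteq> I" unfolding Q2_def by blast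
      then show "K \<in> (\<Union>I\<in>C1. Q I)" using K unfolding Q_def by blast
    qed (auto simp: Q_def)
    have gaps: "(\<Sum>K\<in>G. g (Sup K) - g (Inf K))
        = (\<Sum>K\<in>C1. g (Sup K) - g (Inf K)) - (\<Sum>K\<in>C2. g (Sup K) - g (Inf K))" for g :: "real \<Rightarrow> real"
    proof -
      let ?D = "\<lambda>K. g (Sup K) - g (Inf K)"
      have "sum ?D G = (\<Sum>I\<in>C1. sum ?D (q I - Q I))"
        unfolding G_def
      proof (rule sum.UNION_disjoint[OF C1(1)])
        show "\<forall>I\<in>C1. finite (q I - Q I)" by (intro ballI finite_Diff finq)
        show "\<forall>I\<in>C1. \<forall>J\<in>C1. I \<noteq> J \<longrightarrow> (q I - Q I) \<inter> (q J - Q J) = {}"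
          by (intro ballI impI equals0I) (use disj in blast)
      qed
      also have "\<dots> = (\<Sum>I\<in>C1. ?D I - sum ?D (Q I))"
      proof (rule sum.cong)
        fix I assume I: "I \<in> C1"
        obtain a b where ab: "a < b" "I = {a..b}" using C1' I by blast
        have "sum ?D (q I - Q I) = sum ?D (q I) - sum ?D (Q I)"
          using q[OF I] finq[OF I] by (intro sum_diff) auto
        also have "sum ?D (q I) = ?D I"
          using division_telescope[of "q I" a b g] q[OF I] ab by simp
        finally show "sum ?D (q I - Q I) = ?D I - sum ?D (Q I)" .
      qed simp
      also have "\<dots> = sum ?D C1 - (\<Sum>I\<in>C1. sum ?D (Q I))" by (simp add: sum_subtractf)
      also have "(\<Sum>I\<in>C1. sum ?D (Q I)) = sum ?D C2"
        unfolding C2_eq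
      proof (rule sum.UNION_disjoint[OF C1(1), symmetric])
        show "\<forall>I\<in>C1. finite (Q I)" using C2(1) unfolding Q_def by simp
        show "\<forall>I\<in>C1. \<forall>J\<in>C1. I \<noteq> J \<longrightarrow> Q I \<inter> Q J = {}"
        proof (intro ballI impI equals0I)
          fix I J K assume IJ: "I \<in> C1" "J \<in> C1" "I \<noteq> J" and K: "K \<in> Q I \<inter> Q J"
          have "K \<in> q I" "K \<in> q J" using K q[OF IJ(1)] q[OF IJ(2)] by blast+
          then show False using disj[OF IJ] by blast
        qed
      qed
      finally show ?thesis .
    qed
    have Gdiv: "G division_of \<Union>G"
      unfolding division_of_def
    proof (intro conjI ballI impI)
      show "finite G" unfolding G_def using C1(1) finq by auto
      fix K assume K: "K \<in> G"
      show "K \<subseteq> \<Union>G" using K by blast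
      obtain I where I: "I \<in> C1" "K \<in> q I" using K unfolding G_def by blast
      show "K \<noteq> {}" using sub I by blast
      show "\<exists>a b. K = cbox a b" 
        using division_ofD(4)[of "q I" I K] q[OF I(1)] I(2) by blast
    next
      fix K L assume KL: "K \<in> G" "L \<in> G" "K \<noteq> L"
      obtain I J where IJ: "I \<in> C1" "K \<in> q I" "J \<in> C1" "L \<in> q J" using KL unfolding G_def by blast
      show "interior K \<inter> interior L = {}"
      proof (cases "I = J")
        case True
        then show ?thesis
          using division_ofD(5)[of "q I" I K L] q[OF IJ(1)] IJ(2,4) KL(3) by blast
      next
        case False
        then have "I \<inter> J = {}" using C1(2) IJ unfolding pairwise_def disjnt_def by blast
        then show ?thesis using sub(1)[OF IJ(2,1)] sub(1)[OF IJ(4,3)] interior_subset by fast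
      qed
    qed simp
    have "(\<Sum>K\<in>G. norm (f (Sup K) - f (Inf K))) < \<epsilon>"
    proof (rule ac[OF Gdiv])
      have "I \<subseteq> {0..1}" if "I \<in> C1" for I using C1(3) that unfolding Q1_def by auto
      then show "\<Union>G \<subseteq> {0..1}" unfolding G_def using sub by blast
      have "(\<Sum>K\<in>G. Sup K - Inf K) = l1 - l2" using gaps[of "\<lambda>x. x"] unfolding l1_def l2_def .
      then show "(\<Sum>K\<in>G. Sup K - Inf K) < \<delta>0" using l1 l2 \<delta> by linarith
    qed
    moreover have "\<bar>\<Sum>K\<in>G. f (Sup K) - f (Inf K)\<bar> \<le> (\<Sum>K\<in>G. norm (f (Sup K) - f (Inf K)))"
      unfolding real_norm_def by (rule sum_abs)
    ultimately have small: "\<bar>(\<Sum>K\<in>C1. f (Sup K) - f (Inf K)) - (\<Sum>K\<in>C2. f (Sup K) - f (Inf K))\<bar> < \<epsilon>"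
      using gaps[of f] by simp
    have s1: "(\<Sum>K\<in>C1. f (Sup K) - f (Inf K)) \<le> u * l1"
      unfolding l1_def sum_distrib_left
    proof (rule sum_mono)
      fix K assume "K \<in> C1"
      then show "f (Sup K) - f (Inf K) \<le> u * (Sup K - Inf K)" using C1(3) unfolding Q1_def by fastforce
    qed
    have s2: "v * l2 \<le> (\<Sum>K\<in>C2. f (Sup K) - f (Inf K))"
      unfolding l2_def sum_distrib_left
    proof (rule sum_mono)
      fix K assume "K \<in> C2"
      then show "v * (Sup K - Inf K) \<le> f (Sup K) - f (Inf K)" using C2(3) unfolding Q2_def by fastforce
    qed
    have nn: "0 \<le> l1 - l2"
    proof -
      have "\<Union>C2 \<subseteq> \<Union>C1" using C2_eq unfolding Q_def by blast
      then show ?thesis unfolding l1_def l2_def L1(1) L2(1)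
        using L1(2) L2(2) by (simp add: measure_mono_fmeasurable fmeasurableD)
    qed
    have "u * (l1 - l2) \<le> \<bar>u\<bar> * (l1 - l2)" using nn by (intro mult_right_mono) auto
    also have "\<dots> \<le> \<bar>u\<bar> * \<epsilon>" using l1 l2 \<delta> by (intro mult_left_mono) auto
    finally have "u * (l1 - l2) \<le> \<bar>u\<bar> * \<epsilon>" .
    then have "u * l1 - u * l2 \<le> \<bar>u\<bar> * \<epsilon>" by (simp add: right_diff_distrib)
    then have "(v - u) * l2 < \<epsilon> * (1 + \<bar>u\<bar>)" using small s1 s2 by (simp add: algebra_simps)
    also have "\<dots> = (v - u) * ?e / 4" unfolding \<epsilon>_def by (simp add: field_simps)
    finally have "(v - u) * l2 < (v - u) * (?e / 4)" by simp
    then have "l2 < ?e / 4" using uv by (subst (asm) mult_less_cancel_left_pos) auto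
    then show False using l2 \<delta>(4) e by linarith
  qed
  then show ?thesis using negligible_iff_measure0[OF Em] E_def by simp
qed

text \<open>On a set of positive measure, contained in an interval of length below \<open>\<delta>\<close>, a Vitali covering by intervals of
  very large slope would produce a total increment of at least \<open>1\<close> over a total length below \<open>\<delta>\<close>.\<close>

lemma steep_unbounded_negligible:
  assumes f: "ac01 f"
  shows "negligible (\<Inter>n::nat. steep f (real n))"
proof -
  define E where "E = (\<Inter>n::nat. steep f (real n))"
  have "E \<in> sets lebesgue"
    unfolding E_def by (intro sets.countable_INT) (auto intro: fmeasurableD steep_lmeasurable)
  moreover have "E \<subseteq> {0<..<1}" unfolding E_def using steep_subset by blast
  ultimately have Em: "E \<in> lmeasurable"
    by (intro bounded_set_imp_lmeasurable bounded_subset[OF bounded_closed_interval[of 0 1]]) auto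
  obtain \<delta> where \<delta>: "\<delta> > 0" and ac: "\<And>D. D division_of \<Union>D \<Longrightarrow> \<Union>D \<subseteq> {0..1} \<Longrightarrow>
      (\<Sum>K\<in>D. Sup K - Inf K) < \<delta> \<Longrightarrow> (\<Sum>K\<in>D. norm (f (Sup K) - f (Inf K))) < 1"
    by (rule ac01_division[OF f zero_less_one]) blast
  have loc: "negligible (E \<inter> {c<..<d})" if cd: "c < d" "d - c < \<delta>" for c d
  proof -
    define F where "F = E \<inter> {c<..<d}"
    have Fm: "F \<in> lmeasurable" unfolding F_def by (intro fmeasurable_Int_fmeasurable[OF Em]) auto
    have "measure lebesgue F = 0"
    proof (rule ccontr)
      assume "measure lebesgue F \<noteq> 0"
      then have m: "measure lebesgue F > 0" (is "?m > 0") by (simp add: zero_less_measure_iff)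
      obtain n :: nat where n: "real n > 2 / ?m" using reals_Archimedean2 by blast
      define Q where "Q = (\<lambda>a b. 0 \<le> a \<and> b \<le> 1 \<and> {a..b} \<subseteq> {c<..<d} \<and> f b - f a > real n * (b - a))"
      have fine: "\<exists>a b. a < x \<and> x < b \<and> b - a < r \<and> Q a b" if x: "x \<in> F" and r: "r > 0" for x r
      proof -
        have "min r (min (x - c) (d - x)) > 0" using x r unfolding F_def by auto
        moreover have "x \<in> steep f (real n)" using x unfolding F_def E_def by blast
        ultimately obtain a b where ab: "0 \<le> a" "a < x" "x < b" "b \<le> 1"
          "b - a < min r (min (x - c) (d - x))" "f b - f a > real n * (b - a)"
          unfolding steep_def by blast
        then show ?thesis unfolding Q_def by (intro exI[of _ a] exI[of _ b]) auto
      qed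
      have m2: "?m / 2 > 0" using m by simp
      obtain C where C: "finite C" "pairwise disjnt C"
        "\<forall>K\<in>C. \<exists>a b. a < b \<and> K = {a..b} \<and> Q a b"
        "?m - ?m / 2 < measure lebesgue (F \<inter> (\<Union>K\<in>C. interior K))"
        by (rule Vitali_finite_intervals[OF Fm m2 fine]) blast
      have C': "\<forall>K\<in>C. \<exists>a b. a < b \<and> K = {a..b}" using C(3) by blast
      note L = sum_lengths_eq_measure[OF C(1,2) C']
      define l where "l = (\<Sum>K\<in>C. Sup K - Inf K)"
      have "measure lebesgue (F \<inter> (\<Union>K\<in>C. interior K)) \<le> measure lebesgue (\<Union>C)"
      proof (rule measure_mono_fmeasurable)
        show "F \<inter> (\<Union>K\<in>C. interior K) \<subseteq> \<Union>C" using interior_subset by fast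
        show "F \<inter> (\<Union>K\<in>C. interior K) \<in> sets lebesgue"
          using fmeasurableD[OF Fm] C(1) by (intro sets.Int sets.finite_UN) auto
      qed (rule L(2))
      then have l: "l > ?m / 2" unfolding l_def L(1) using C(4) by linarith
      have "l \<le> measure lebesgue {c<..<d}"
        unfolding l_def L(1)
      proof (rule measure_mono_fmeasurable)
        show "\<Union>C \<subseteq> {c<..<d}" using C(3) unfolding Q_def by blast
      qed (use L(2) in \<open>auto intro: fmeasurableD\<close>)
      then have l\<delta>: "l < \<delta>" using cd by simp
      have "(\<Sum>K\<in>C. norm (f (Sup K) - f (Inf K))) < 1"
      proof (rule ac[OF L(3)])
        show "\<Union>C \<subseteq> {0..1}" using C(3) unfolding Q_def by fastforce
      qed (use l\<delta> l_def in simp)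
      moreover have "real n * l \<le> (\<Sum>K\<in>C. norm (f (Sup K) - f (Inf K)))"
        unfolding l_def sum_distrib_left
      proof (rule sum_mono)
        fix K assume "K \<in> C"
        then show "real n * (Sup K - Inf K) \<le> norm (f (Sup K) - f (Inf K))"
          using C(3) unfolding Q_def by fastforce
      qed
      moreover have "real n * l \<ge> (2 / ?m) * (?m / 2)"
        using n l m by (intro mult_mono) auto
      ultimately show False using m by simp
    qed
    then show ?thesis using negligible_iff_measure0[OF Fm] F_def by simp
  qed
  \<comment> \<open>Rational end points keep the local null sets countable in number.\<close>
  let ?R = "{(c, d). c \<in> \<rat> \<and> d \<in> \<rat> \<and> c < d \<and> d - c < \<delta>}"
  have "negligible (\<Union>p\<in>?R. E \<inter> {fst p<..<snd p})"
  proof (rule negligible_countable_Union)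
    have "countable (\<rat> \<times> \<rat> :: (real \<times> real) set)" by (intro countable_SIGMA countable_rat)
    then have "countable ?R" by (rule countable_subset[rotated]) auto
    then show "countable ((\<lambda>p. E \<inter> {fst p<..<snd p}) ` ?R)" by simp
  qed (use loc in auto)
  moreover have "E \<subseteq> (\<Union>p\<in>?R. E \<inter> {fst p<..<snd p})"
  proof
    fix x assume x: "x \<in> E"
    obtain c where c: "c \<in> \<rat>" "x - \<delta> / 2 < c" "c < x" using Rats_dense_in_real[of "x - \<delta>/2" x] \<delta> by auto
    obtain d where d: "d \<in> \<rat>" "x < d" "d < x + \<delta> / 2" using Rats_dense_in_real[of x "x + \<delta>/2"] \<delta> by auto
    show "x \<in> (\<Union>p\<in>?R. E \<inter> {fst p<..<snd p})"
      using x c d by (intro UN_I[of "(c, d)"]) auto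
  qed
  ultimately show ?thesis unfolding E_def[symmetric] by (rule negligible_subset)
qed

lemma steep_antimono:
  assumes "u \<le> v" shows "steep f v \<subseteq> steep f u"
proof
  fix x assume x: "x \<in> steep f v"
  show "x \<in> steep f u"
    unfolding steep_def
  proof (intro CollectI allI impI)
    fix d :: real assume "d > 0"
    then obtain a b where ab: "0 \<le> a" "a < x" "x < b" "b \<le> 1" "b - a < d" "f b - f a > v * (b - a)"
      using x unfolding steep_def by blast
    moreover have "u * (b - a) \<le> v * (b - a)" using ab assms by (intro mult_right_mono) auto
    ultimately show "\<exists>a b. 0 \<le> a \<and> a < x \<and> x < b \<and> b \<le> 1 \<and> b - a < d \<and> f b - f a > u * (b - a)"
      by (intro exI[of _ a] exI[of _ b] conjI) linarith+
  qed
qed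

text \<open>The supremum \<open>L\<close> of the slopes for which \<open>x\<close> is steep is the derivative. It is finite because \<open>x\<close> is not steep for
  all slopes in either direction. On short intervals around \<open>x\<close> the difference quotients are at most about \<open>L\<close> by the
  choice of \<open>L\<close>, and at least about \<open>L\<close> since otherwise \<open>x\<close> would be steep in two opposed ways.\<close>

lemma differentiable_if_not_steep:
  fixes f :: "real \<Rightarrow> real"
  assumes cont: "continuous_on {0..1} f" and x: "x \<in> {0<..<1}"
    and up: "x \<notin> (\<Inter>n::nat. steep f (real n))"
    and down: "x \<notin> (\<Inter>n::nat. steep (\<lambda>x. - f x) (real n))"
    and opp: "\<And>u v. u \<in> \<rat> \<Longrightarrow> v \<in> \<rat> \<Longrightarrow> u < v \<Longrightarrow> x \<notin> steep f v \<inter> steep (\<lambda>x. - f x) (- u)"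
  shows "f differentiable (at x)"
proof -
  define T where "T = {v. x \<in> steep f v}"
  have steep_mono: "x \<in> steep f u" if "x \<in> steep f v" "u \<le> v" for u v
    using steep_antimono[OF that(2)] that(1) by blast
  obtain n1 :: nat where n1: "x \<notin> steep f (real n1)" using up by blast
  obtain n2 :: nat where n2: "x \<notin> steep (\<lambda>x. - f x) (real n2)" using down by blast
  have bdd: "bdd_above T"
    unfolding T_def bdd_above_def using n1 steep_mono by (metis mem_Collect_eq nle_le)
  \<comment> \<open>A point not steep for \<open>n2\<close> in the descending direction is steep for every slope below \<open>- n2\<close>.\<close>
  have ne: "- real n2 - 1 \<in> T"
    unfolding T_def steep_def
  proof (intro CollectI allI impI)
    fix d :: real assume d: "d > 0"
    obtain d1 where d1: "d1 > 0" and
      n2': "\<And>a b. 0 \<le> a \<Longrightarrow> a < x \<Longrightarrow> x < b \<Longrightarrow> b \<le> 1 \<Longrightarrow> b - a < d1 \<Longrightarrow> \<not> - f b - - f a > real n2 * (b - a)"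
      using n2 unfolding steep_def by blast
    define r where "r = min (min d d1) (min x (1 - x)) / 3"
    have r: "r > 0" "r \<le> d / 3" "r \<le> d1 / 3" "r \<le> x" "r \<le> 1 - x" using d d1 x unfolding r_def by auto
    have "\<not> - f (x + r) - - f (x - r) > real n2 * ((x + r) - (x - r))" using r d1 by (intro n2') auto
    moreover have "(- real n2 - 1) * ((x + r) - (x - r)) = - (real n2 * ((x + r) - (x - r))) - 2 * r"
      by (simp add: algebra_simps)
    ultimately have "f (x + r) - f (x - r) > (- real n2 - 1) * ((x + r) - (x - r))" using r by linarith
    then show "\<exists>a b. 0 \<le> a \<and> a < x \<and> x < b \<and> b \<le> 1 \<and> b - a < d \<and> f b - f a > (- real n2 - 1) * (b - a)"
      using r d by (intro exI[of _ "x - r"] exI[of _ "x + r"]) auto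
  qed
  define L where "L = Sup T"
  have two_sided: "\<exists>d>0. \<forall>a b. 0 \<le> a \<longrightarrow> a < x \<longrightarrow> x < b \<longrightarrow> b \<le> 1 \<longrightarrow> b - a < d \<longrightarrow>
      \<bar>f b - f a - L * (b - a)\<bar> \<le> e * (b - a)" if e: "e > 0" for e
  proof -
    have "x \<notin> steep f (L + e)"
    proof
      assume "x \<in> steep f (L + e)"
      then have "L + e \<le> L" unfolding L_def by (intro cSup_upper bdd) (auto simp: T_def)
      then show False using e by simp
    qed
    then obtain d1 where d1: "d1 > 0" "\<And>a b. 0 \<le> a \<Longrightarrow> a < x \<Longrightarrow> x < b \<Longrightarrow> b \<le> 1 \<Longrightarrow> b - a < d1 \<Longrightarrow>
        \<not> f b - f a > (L + e) * (b - a)"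
      unfolding steep_def by blast
    obtain t where t: "t \<in> T" "L - e / 2 < t"
      using less_cSup_iff[of T "L - e/2"] bdd ne e unfolding L_def by force
    obtain v where v: "v \<in> \<rat>" "L - e / 2 < v" "v < t" using Rats_dense_in_real[OF t(2)] by auto
    obtain u where u: "u \<in> \<rat>" "L - e < u" "u < L - e / 2"
      using Rats_dense_in_real[of "L - e" "L - e / 2"] e by auto
    have "x \<in> steep f v" using t v steep_mono[of t v] unfolding T_def by simp
    moreover have "u < v" using u v by linarith
    ultimately have "x \<notin> steep (\<lambda>x. - f x) (- u)" using opp[OF u(1) v(1)] by blast
    then obtain d2 where d2: "d2 > 0" "\<And>a b. 0 \<le> a \<Longrightarrow> a < x \<Longrightarrow> x < b \<Longrightarrow> b \<le> 1 \<Longrightarrow> b - a < d2 \<Longrightarrow>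
        \<not> - f b - - f a > - u * (b - a)"
      unfolding steep_def by blast
    show ?thesis
    proof (intro exI conjI allI impI)
      show "min d1 d2 > 0" using d1 d2 by simp
      fix a b assume ab: "0 \<le> a" "a < x" "x < b" "b \<le> 1" "b - a < min d1 d2"
      have "f b - f a \<le> (L + e) * (b - a)" using d1(2)[of a b] ab by simp
      moreover have "f b - f a \<ge> u * (b - a)" using d2(2)[of a b] ab by simp
      moreover have "u * (b - a) \<ge> (L - e) * (b - a)" using u ab by (intro mult_right_mono) auto
      ultimately show "\<bar>f b - f a - L * (b - a)\<bar> \<le> e * (b - a)" by (simp add: algebra_simps abs_le_iff)
    qed
  qed
  have "(f has_derivative (\<lambda>h. h * L)) (at x)"
    unfolding has_derivative_at_alt
  proof (intro conjI allI impI)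
    show "bounded_linear (\<lambda>h. h * L)" by (rule bounded_linear_mult_left)
    fix e :: real assume e: "e > 0"
    obtain d where d: "d > 0" and D: "\<And>a b. 0 \<le> a \<Longrightarrow> a < x \<Longrightarrow> x < b \<Longrightarrow> b \<le> 1 \<Longrightarrow> b - a < d \<Longrightarrow>
      \<bar>f b - f a - L * (b - a)\<bar> \<le> e * (b - a)" using two_sided[OF e] by blast
    have cx: "(f \<longlongrightarrow> f x) (at x)"
    proof -
      have "isCont f x" using cont x by (intro continuous_on_interior[of "{0..1}"]) (auto simp: interior_atLeastAtMost_real)
      then show ?thesis by (simp add: isCont_def)
    qed
    then have cl: "(f \<longlongrightarrow> f x) (at_left x)" and cr: "(f \<longlongrightarrow> f x) (at_right x)"
      by (auto intro: tendsto_within_subset filterlim_at_split[THEN iffD1, THEN conjunct1] simp: filterlim_at_split)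
    \<comment> \<open>The estimate on intervals around \<open>x\<close> passes to intervals ending at \<open>x\<close> by continuity of \<open>f\<close>.\<close>
    show "\<exists>d>0. \<forall>y. norm (y - x) < d \<longrightarrow> norm (f y - f x - (y - x) * L) \<le> e * norm (y - x)"
    proof (intro exI conjI allI impI)
      let ?d = "min (d / 2) (min x (1 - x))"
      show "?d > 0" using d x by auto
      fix y assume y: "norm (y - x) < ?d"
      consider "y = x" | "x < y" | "y < x" by linarith
      then show "norm (f y - f x - (y - x) * L) \<le> e * norm (y - x)"
      proof cases
        case 2
        have "\<bar>f y - f x - L * (y - x)\<bar> \<le> e * (y - x)"
        proof (rule tendsto_le[OF trivial_limit_at_left_real])
          show "((\<lambda>a. e * (y - a)) \<longlongrightarrow> e * (y - x)) (at_left x)" by (intro tendsto_intros)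
          show "((\<lambda>a. \<bar>f y - f a - L * (y - a)\<bar>) \<longlongrightarrow> \<bar>f y - f x - L * (y - x)\<bar>) (at_left x)"
            by (intro tendsto_intros cl)
          have "\<forall>\<^sub>F a in at_left x. x - ?d < a \<and> a < x"
            using \<open>?d > 0\<close> by (intro eventually_at_leftI[of "x - ?d"]) auto
          then show "\<forall>\<^sub>F a in at_left x. \<bar>f y - f a - L * (y - a)\<bar> \<le> e * (y - a)"
            by (rule eventually_mono) (use y 2 in \<open>auto intro!: D\<close>)
        qed
        then show ?thesis using 2 by (simp add: mult.commute)
      next
        case 3
        have "\<bar>f x - f y - L * (x - y)\<bar> \<le> e * (x - y)"
        proof (rule tendsto_le[OF trivial_limit_at_right_real])
          show "((\<lambda>b. e * (b - y)) \<longlongrightarrow> e * (x - y)) (at_right x)" by (intro tendsto_intros)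
          show "((\<lambda>b. \<bar>f b - f y - L * (b - y)\<bar>) \<longlongrightarrow> \<bar>f x - f y - L * (x - y)\<bar>) (at_right x)"
            by (intro tendsto_intros cr)
          have "\<forall>\<^sub>F b in at_right x. x < b \<and> b < x + ?d"
            using \<open>?d > 0\<close> by (intro eventually_at_rightI[of x "x + ?d"]) auto
          then show "\<forall>\<^sub>F b in at_right x. \<bar>f b - f y - L * (b - y)\<bar> \<le> e * (b - y)"
            by (rule eventually_mono) (use y 3 in \<open>auto intro!: D\<close>)
        qed
        moreover have "\<bar>f y - f x - (y - x) * L\<bar> = \<bar>f x - f y - L * (x - y)\<bar>"
          by (simp add: algebra_simps abs_minus_commute)
        ultimately show ?thesis using 3 by simp
      qed simp
    qed
  qed
  then show ?thesis unfolding differentiable_def by blast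
qed

text \<open>Besides two sets of points with unbounded slopes, one null set is removed for each pair of rational slopes.\<close>

lemma ac01_real_differentiable_ae:
  fixes f :: "real \<Rightarrow> real"
  assumes f: "ac01 f"
  obtains S where "negligible S" "\<And>x. x \<in> {0<..<1} - S \<Longrightarrow> f differentiable (at x)"
proof -
  have mf: "ac01 (\<lambda>x. - f x)" using ac01_bounded_linear[OF f bounded_linear_minus[OF bounded_linear_ident]] .
  let ?R = "{(u::real, v). u \<in> \<rat> \<and> v \<in> \<rat> \<and> u < v}"
  let ?A = "(\<Union>p\<in>?R. steep f (snd p) \<inter> steep (\<lambda>x. - f x) (- fst p))"
  let ?S = "?A \<union> (\<Inter>n::nat. steep f (real n)) \<union> (\<Inter>n::nat. steep (\<lambda>x. - f x) (real n))"
  show thesis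
  proof (rule that[of ?S])
    have "negligible ?A"
    proof (rule negligible_countable_Union)
      have "countable (\<rat> \<times> \<rat> :: (real \<times> real) set)" by (intro countable_SIGMA countable_rat)
      then have "countable ?R" by (rule countable_subset[rotated]) auto
      then show "countable ((\<lambda>p. steep f (snd p) \<inter> steep (\<lambda>x. - f x) (- fst p)) ` ?R)" by simp
    qed (use steep_opposed_negligible[OF f] in auto)
    then show "negligible ?S"
      using steep_unbounded_negligible[OF f] steep_unbounded_negligible[OF mf] by (intro negligible_Un)
    fix x assume x: "x \<in> {0<..<1} - ?S"
    show "f differentiable (at x)"
    proof (rule differentiable_if_not_steep[OF ac01_continuous[OF f]])
      show "x \<notin> steep f v \<inter> steep (\<lambda>x. - f x) (- u)" if "u \<in> \<rat>" "v \<in> \<rat>" "u < v" for u v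
        using x that by force
    qed (use x in auto)
  qed
qed

text \<open>Lebesgue's theorem, coordinate by coordinate.\<close>

theorem ac01_differentiable_ae:
  fixes f :: "real \<Rightarrow> 'a::euclidean_space"
  assumes f: "ac01 f"
  obtains S where "negligible S" "\<And>x. x \<in> {0<..<1} - S \<Longrightarrow> f differentiable (at x)"
proof -
  have "\<exists>S. negligible S \<and> (\<forall>x\<in>{0<..<1} - S. (\<lambda>x. f x \<bullet> i) differentiable (at x))" for i
  proof -
    have "ac01 (\<lambda>x. f x \<bullet> i)" by (rule ac01_bounded_linear[OF f bounded_linear_inner_left])
    then show ?thesis using ac01_real_differentiable_ae by metis
  qed
  then obtain S where S: "\<And>i. negligible (S i)"
    "\<And>i x. x \<in> {0<..<1} - S i \<Longrightarrow> (\<lambda>x. f x \<bullet> i) differentiable (at x)" by metis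
  show thesis
  proof (rule that[of "\<Union>i\<in>Basis. S i"])
    show "negligible (\<Union>i\<in>Basis. S i)" using S(1) by (intro negligible_Union) auto
    fix x assume "x \<in> {0<..<1} - (\<Union>i\<in>Basis. S i)"
    then show "f differentiable (at x)"
      using S(2) by (subst differentiable_componentwise_within) auto
  qed
qed

section \<open>The fundamental theorem of calculus\<close>

text \<open>The gauge is the usual one at points outside \<open>S\<close>, where a tag controls the increment of \<open>f\<close> over its interval.
  At the points of \<open>S\<close> the gauge is an open neighbourhood of \<open>S\<close> of small measure: the intervals tagged there have
  small total length, so by absolute continuity the increments of \<open>f\<close> over them are negligible.\<close>

theorem ac01_fundamental_theorem:
  fixes f g :: "real \<Rightarrow> 'a::banach"
  assumes f: "ac01 f" and S: "negligible S"
    and der: "\<And>x. x \<in> {0..1} - S \<Longrightarrow> (f has_vector_derivative g x) (at x within {0..1})"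
  shows "(g has_integral (f 1 - f 0)) {0..1}"
proof -
  \<comment> \<open>The value \<open>0\<close> on \<open>S\<close> keeps the tags in \<open>S\<close> out of the Riemann sums.\<close>
  define g' where "g' = (\<lambda>x. if x \<in> S then 0 else g x)"
  have "(g' has_integral (f 1 - f 0)) {0..1}"
    unfolding has_integral_factor_content_real
  proof (intro allI impI)
    fix e :: real assume e: "e > 0"
    have e2: "e / 2 > 0" using e by simp
    obtain \<delta> where \<delta>: "\<delta> > 0" and ac: "\<And>I (a::real \<times> real set \<Rightarrow> real) b. finite I \<Longrightarrow>
        (\<And>i. i \<in> I \<Longrightarrow> 0 \<le> a i \<and> a i \<le> b i \<and> b i \<le> 1) \<Longrightarrow>
        disjoint_family_on (\<lambda>i. {a i<..<b i}) I \<Longrightarrow> (\<Sum>i\<in>I. b i - a i) < \<delta> \<Longrightarrow>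
        (\<Sum>i\<in>I. norm (f (b i) - f (a i))) < e / 2"
      by (rule ac01_finite[OF f e2]) blast
    obtain T where T: "open T" "S \<subseteq> T" "(T - S) \<in> lmeasurable" "emeasure lebesgue (T - S) < ennreal \<delta>"
      using sets_lebesgue_outer_open[OF negligible_imp_sets[OF S] \<delta>] by blast
    have Sn: "S \<in> null_sets lebesgue" using S by (simp add: negligible_iff_null_sets)
    have T_eq: "T = (T - S) \<union> S" using T(2) by blast
    have Tm: "T \<in> lmeasurable"
      using fmeasurable.Un[OF T(3) negligible_imp_measurable[OF S]] T_eq by simp
    have mT: "measure lebesgue T < \<delta>"
    proof -
      have "measure lebesgue T = measure lebesgue (T - S)"
        using measure_Un_null_set[OF fmeasurableD[OF T(3)] Sn] T_eq by simp
      then show ?thesis using T(3,4) \<delta> by (simp add: emeasure_eq_measure2 ennreal_less_iff)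
    qed
    have "\<exists>d>0. x \<in> {0..1} - S \<longrightarrow> (\<forall>y\<in>{0..1}. norm (y - x) < d \<longrightarrow>
        norm (f y - f x - (y - x) *\<^sub>R g x) \<le> (e / 2) * norm (y - x))" for x
    proof (cases "x \<in> {0..1} - S")
      case True
      then show ?thesis
        using der[OF True] e2 unfolding has_vector_derivative_def has_derivative_within_alt by blast
    qed (auto intro: exI[of _ 1])
    then obtain d where d: "\<And>x. d x > 0"
      "\<And>x y. x \<in> {0..1} - S \<Longrightarrow> y \<in> {0..1} \<Longrightarrow> norm (y - x) < d x \<Longrightarrow>
        norm (f y - f x - (y - x) *\<^sub>R g x) \<le> (e / 2) * norm (y - x)" by metis
    define \<gamma> where "\<gamma> = (\<lambda>x. if x \<in> S then T else ball x (d x))"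
    show "\<exists>\<gamma>. gauge \<gamma> \<and> (\<forall>p. p tagged_division_of {0..1} \<and> \<gamma> fine p \<longrightarrow>
        norm ((\<Sum>(x, k)\<in>p. measure lborel k *\<^sub>R g' x) - (f 1 - f 0)) \<le> e * measure lborel {0..1::real})"
    proof (intro exI[of _ \<gamma>] conjI allI impI)
      show "gauge \<gamma>" unfolding gauge_def \<gamma>_def using T d(1) by auto
      fix p assume "p tagged_division_of {0..1} \<and> \<gamma> fine p"
      then have p: "p tagged_division_of {0..1}" and fine: "\<gamma> fine p" by auto
      have finp: "finite p" using p by blast
      have K: "\<exists>a b. a \<le> b \<and> snd i = {a..b} \<and> 0 \<le> a \<and> b \<le> 1 \<and> a \<le> fst i \<and> fst i \<le> b" if i: "i \<in> p" for i
      proof -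
        obtain x k where xk: "i = (x, k)" by (cases i)
        then have xkp: "(x, k) \<in> p" using i by simp
        obtain a b where ab: "k = cbox a b" using tagged_division_ofD(4)[OF p xkp] by blast
        have "x \<in> k" "k \<subseteq> {0..1}" using tagged_division_ofD(2,3)[OF p xkp] by auto
        then show ?thesis using ab xk by (intro exI[of _ a] exI[of _ b]) auto
      qed
      define a where "a = (\<lambda>i::real \<times> real set. Inf (snd i))"
      define b where "b = (\<lambda>i::real \<times> real set. Sup (snd i))"
      have ab: "snd i = {a i..b i} \<and> a i \<le> b i \<and> 0 \<le> a i \<and> b i \<le> 1 \<and> a i \<le> fst i \<and> fst i \<le> b i"
        if "i \<in> p" for i
        using K[OF that] unfolding a_def b_def by fastforce
      have disj: "disjoint_family_on (\<lambda>i. {a i<..<b i}) p"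
        unfolding disjoint_family_on_def
      proof (intro ballI impI)
        fix i j assume ij: "i \<in> p" "j \<in> p" "i \<noteq> j"
        have "interior (snd i) \<inter> interior (snd j) = {}"
          using tagged_division_ofD(5)[OF p, of "fst i" "snd i" "fst j" "snd j"] ij by simp
        then show "{a i<..<b i} \<inter> {a j<..<b j} = {}"
          using ab[OF ij(1)] ab[OF ij(2)] interior_atLeastAtMost_real by metis
      qed
      have cont: "measure lborel (snd i) = b i - a i" if "i \<in> p" for i
        using ab[OF that] by (metis measure_lborel_Icc)
      have tele: "(\<Sum>i\<in>p. f (b i) - f (a i)) = f 1 - f 0"
        using additive_tagged_division_1[OF zero_le_one p, of f]
        by (simp add: a_def b_def case_prod_beta)
      have total: "(\<Sum>i\<in>p. b i - a i) = 1"
        using additive_tagged_division_1[OF zero_le_one p, of "\<lambda>x. x"]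
        by (simp add: a_def b_def case_prod_beta)
      define p1 where "p1 = {i \<in> p. fst i \<notin> S}"
      define p2 where "p2 = {i \<in> p. fst i \<in> S}"
      have pu: "p = p1 \<union> p2" "p1 \<inter> p2 = {}" "finite p1" "finite p2" "p1 \<subseteq> p" "p2 \<subseteq> p"
        using finp unfolding p1_def p2_def by auto
      let ?t = "\<lambda>i. norm (measure lborel (snd i) *\<^sub>R g' (fst i) - (f (b i) - f (a i)))"
      have "(\<Sum>(x, k)\<in>p. measure lborel k *\<^sub>R g' x) - (f 1 - f 0)
          = (\<Sum>i\<in>p. measure lborel (snd i) *\<^sub>R g' (fst i) - (f (b i) - f (a i)))"
        unfolding tele[symmetric] by (simp add: case_prod_beta sum_subtractf)
      then have "norm ((\<Sum>(x, k)\<in>p. measure lborel k *\<^sub>R g' x) - (f 1 - f 0)) \<le> sum ?t p"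
        by (simp add: norm_sum)
      also have "\<dots> = sum ?t p1 + sum ?t p2" 
        by (subst pu(1), rule sum.union_disjoint) (rule pu)+
      also have "sum ?t p1 \<le> (\<Sum>i\<in>p1. e / 2 * (b i - a i))"
      proof (rule sum_mono)
        fix i assume i: "i \<in> p1"
        then have ip: "i \<in> p" and nS: "fst i \<notin> S" unfolding p1_def by auto
        define x where "x = fst i"
        have AB: "0 \<le> a i" "a i \<le> x" "x \<le> b i" "b i \<le> 1" using ab[OF ip] unfolding x_def by auto
        have "snd i \<subseteq> \<gamma> x" using fineD[OF fine, of "fst i" "snd i"] ip unfolding x_def by simp
        then have "{a i..b i} \<subseteq> ball x (d x)" using ab[OF ip] nS unfolding \<gamma>_def x_def by auto
        moreover have "a i \<in> {a i..b i}" "b i \<in> {a i..b i}" using AB by auto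
        ultimately have "a i \<in> ball x (d x)" "b i \<in> ball x (d x)" by blast+
        then have near: "norm (a i - x) < d x" "norm (b i - x) < d x"
          by (simp_all add: dist_norm norm_minus_commute)
        have xm: "x \<in> {0..1} - S" using AB nS unfolding x_def by auto
        have A: "norm (f (a i) - f x - (a i - x) *\<^sub>R g x) \<le> e / 2 * (x - a i)"
          using d(2)[OF xm _ near(1)] AB by auto
        have B: "norm (f (b i) - f x - (b i - x) *\<^sub>R g x) \<le> e / 2 * (b i - x)"
          using d(2)[OF xm _ near(2)] AB by auto
        have "measure lborel (snd i) *\<^sub>R g' (fst i) - (f (b i) - f (a i))
           = (f (a i) - f x - (a i - x) *\<^sub>R g x) - (f (b i) - f x - (b i - x) *\<^sub>R g x)"
          unfolding cont[OF ip] using nS unfolding g'_def x_def by (simp add: algebra_simps)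
        then have "?t i \<le> e / 2 * (x - a i) + e / 2 * (b i - x)"
          by (simp only: norm_triangle_le_diff[OF add_mono[OF A B]])
        also have "e / 2 * (x - a i) + e / 2 * (b i - x) = e / 2 * (b i - a i)"
          by (simp flip: distrib_left)
        finally show "?t i \<le> e / 2 * (b i - a i)" .
      qed
      also have "(\<Sum>i\<in>p1. e / 2 * (b i - a i)) \<le> (\<Sum>i\<in>p. e / 2 * (b i - a i))"
        using pu finp ab e by (intro sum_mono2) auto
      also have "\<dots> = e / 2" using total by (simp only: sum_distrib_left[symmetric])
      also have "sum ?t p2 \<le> e / 2"
      proof -
        have "sum ?t p2 = (\<Sum>i\<in>p2. norm (f (b i) - f (a i)))"
          by (rule sum.cong) (auto simp: p2_def g'_def norm_minus_commute)
        also have "\<dots> < e / 2"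
        proof (rule ac[OF pu(4)])
          show "0 \<le> a i \<and> a i \<le> b i \<and> b i \<le> 1" if "i \<in> p2" for i
            using ab[of i] that pu(6) by auto
          show d2: "disjoint_family_on (\<lambda>i. {a i<..<b i}) p2"
            using disj pu(6) by (rule disjoint_family_on_mono[rotated])
          have "(\<Sum>i\<in>p2. b i - a i) = (\<Sum>i\<in>p2. measure lebesgue {a i<..<b i})"
            using ab pu(6) by (intro sum.cong) (auto simp: subset_iff)
          also have "\<dots> = measure lebesgue (\<Union>i\<in>p2. {a i<..<b i})"
          proof (rule measure_finite_Union[symmetric, OF pu(4) _ d2])
            show "emeasure lebesgue {a i<..<b i} \<noteq> \<infinity>" if "i \<in> p2" for i
            proof -
              have "a i \<le> b i" using ab[of i] that pu(6) by blast
              then show ?thesis by simp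
            qed
          qed auto
          also have "\<dots> \<le> measure lebesgue T"
          proof (rule measure_mono_fmeasurable[OF _ _ Tm])
            show "(\<Union>i\<in>p2. {a i<..<b i}) \<subseteq> T"
            proof
              fix y assume "y \<in> (\<Union>i\<in>p2. {a i<..<b i})"
              then obtain i where i: "i \<in> p2" "y \<in> {a i<..<b i}" by blast
              have ip: "i \<in> p" "fst i \<in> S" using i unfolding p2_def by auto
              have "snd i \<subseteq> \<gamma> (fst i)" using fineD[OF fine, of "fst i" "snd i"] ip by simp
              then have "snd i \<subseteq> T" using ip unfolding \<gamma>_def by simp
              moreover have "y \<in> {a i..b i}" using i(2) by simp
              then have "y \<in> snd i" using ab[OF ip(1)] by blast
              ultimately show "y \<in> T" by blast
            qed
            show "(\<Union>i\<in>p2. {a i<..<b i}) \<in> sets lebesgue" using pu(4) by (intro sets.finite_UN) auto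
          qed
          also have "\<dots> < \<delta>" by (rule mT)
          finally show "(\<Sum>i\<in>p2. b i - a i) < \<delta>" .
        qed
        finally show ?thesis by simp
      qed
      finally show "norm ((\<Sum>(x, k)\<in>p. measure lborel k *\<^sub>R g' x) - (f 1 - f 0)) \<le> e * measure lborel {0..1::real}"
        by simp
    qed
  qed
  then show ?thesis
    by (rule has_integral_spike[OF S, rotated]) (auto simp: g'_def)
qed

section \<open>Fourier series with absolutely summable coefficients\<close>

definition fourier_coeff :: "(real \<Rightarrow> complex) \<Rightarrow> int \<Rightarrow> complex" where
  "fourier_coeff f p = integral {0..1} (\<lambda>x. f x * exp (- freq p * of_real x))"

lemma norm_exp_freq [simp]:
  "norm (exp (freq p * of_real x)) = 1" "norm (exp (- freq p * of_real x)) = 1"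
  "norm (exp (- (freq p * of_real x))) = 1"
  by (simp_all add: norm_exp_eq_Re freq_def)

lemma Re_freq [simp]: "Re (freq p) = 0" by (simp add: freq_def)
lemma freq_add: "freq (p + q) = freq p + freq q" by (simp add: freq_def algebra_simps)
lemma freq_minus: "freq (- p) = - freq p" by (simp add: freq_def)
lemma freq_0 [simp]: "freq 0 = 0" by (simp add: freq_def)
lemma freq_eq_0_iff [simp]: "freq p = 0 \<longleftrightarrow> p = 0" by (simp add: freq_def)

lemma exp_freq_1 [simp]: "exp (freq p) = 1"
  unfolding exp_eq_1 by (auto simp: freq_def intro: exI[of _ p])

lemma integral_exp_freq:
  "integral {0..1} (\<lambda>x. exp (freq p * of_real x)) = (if p = 0 then 1 else 0)"
proof (cases "p = 0")
  case False
  have "((\<lambda>x. exp (freq p * of_real x)) has_integral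
      (exp (freq p * of_real 1) / freq p - exp (freq p * of_real 0) / freq p)) {0..1}"
  proof (rule fundamental_theorem_of_calculus)
    fix x :: real
    have "((\<lambda>z. exp (freq p * z) / freq p) has_field_derivative exp (freq p * of_real x)) (at (of_real x))"
      using False by (auto intro!: derivative_eq_intros)
    then show "((\<lambda>x. exp (freq p * of_real x) / freq p) has_vector_derivative exp (freq p * of_real x)) (at x within {0..1})"
      by (rule has_vector_derivative_real_field)
  qed simp
  then show ?thesis using False by (simp add: integral_unique)
qed simp

text \<open>The form that makes orthogonality to all exponentials pass to the whole algebra by induction.\<close>

inductive trig_poly :: "(real \<Rightarrow> complex) \<Rightarrow> bool" where
  exp_term: "trig_poly (\<lambda>x. c * exp (freq p * of_real x))"
| add: "trig_poly f \<Longrightarrow> trig_poly g \<Longrightarrow> trig_poly (\<lambda>x. f x + g x)"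

lemma trig_poly_const: "trig_poly (\<lambda>x. c)"
  using trig_poly.exp_term[of c 0] by simp

lemma trig_poly_continuous: "trig_poly f \<Longrightarrow> continuous_on S f"
  by (induction rule: trig_poly.induct) (intro continuous_intros | assumption)+

lemma trig_poly_mult_exp:
  "trig_poly g \<Longrightarrow> trig_poly (\<lambda>x. (c * exp (freq p * of_real x)) * g x)"
proof (induction rule: trig_poly.induct)
  case (exp_term d q)
  have "exp (freq (p + q) * of_real x) = exp (freq p * of_real x) * exp (freq q * of_real x)" for x :: real
    by (simp only: freq_add distrib_right exp_add)
  then have "(\<lambda>x. (c * exp (freq p * of_real x)) * (d * exp (freq q * of_real x)))
      = (\<lambda>x. (c * d) * exp (freq (p + q) * of_real x))"
    by (simp add: mult_ac)
  then show ?case using trig_poly.exp_term by simp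
next
  case (add f g)
  then show ?case by (simp add: distrib_left trig_poly.add)
qed

lemma trig_poly_mult:
  assumes f: "trig_poly f" and g: "trig_poly g" shows "trig_poly (\<lambda>x. f x * g x)"
  using f
proof (induction rule: trig_poly.induct)
  case (exp_term c p)
  then show ?case by (rule trig_poly_mult_exp[OF g])
next
  case (add f1 f2)
  then show ?case by (simp add: distrib_right trig_poly.add)
qed

text \<open>A real linear functional of \<open>z\<close> is a combination of \<open>z\<close> and its conjugate, and on the unit circle these are the
  exponentials of frequency \<open>1\<close> and \<open>-1\<close>.\<close>

lemma trig_poly_real_polynomial:
  fixes r :: "complex \<Rightarrow> real"
  assumes "real_polynomial_function r"
  shows "trig_poly (\<lambda>x. of_real (r (exp (freq 1 * of_real x))))"
  using assms
proof (induction rule: real_polynomial_function.induct)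
  case (linear h)
  interpret h: bounded_linear h by fact
  have h: "h z = Re z * h 1 + Im z * h \<i>" for z
  proof -
    have "z = Re z *\<^sub>R 1 + Im z *\<^sub>R \<i>" by (simp add: complex_eq_iff)
    then have "h z = h (Re z *\<^sub>R 1 + Im z *\<^sub>R \<i>)" by simp
    also have "\<dots> = Re z * h 1 + Im z * h \<i>" by (simp only: h.add h.scaleR real_scaleR_def)
    finally show ?thesis .
  qed
  have eq: "complex_of_real (h (exp (freq 1 * of_real x)))
      = ((of_real (h 1) - \<i> * of_real (h \<i>)) / 2) * exp (freq 1 * of_real x)
        + ((of_real (h 1) + \<i> * of_real (h \<i>)) / 2) * exp (freq (-1) * of_real x)" for x
  proof -
    define z where "z = exp (freq 1 * of_real x)"
    have "exp (freq (-1) * of_real x) = cnj z"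
      unfolding z_def by (simp add: exp_cnj freq_def)
    then show ?thesis unfolding z_def[symmetric] h[of z]
      by (simp add: complex_eq_iff field_simps)
  qed
  show ?case unfolding eq by (intro trig_poly.intros)
next
  case (const c)
  then show ?case by (rule trig_poly_const)
next
  case (add f g)
  then show ?case by (simp add: trig_poly.add)
next
  case (mult f g)
  then show ?case by (simp add: trig_poly_mult)
qed

text \<open>Stone--Weierstrass approximation needs a function on a compact set in the plane. Its continuity at \<open>1\<close>, where the
  angle jumps, is part of the correspondence between homotopies of loops and homotopies of circle maps, here
  applied to the constant homotopy.\<close>

lemma circle_function:
  fixes f :: "real \<Rightarrow> complex"
  assumes "continuous_on {0..1} f" "f 0 = f 1"
  obtains F where "continuous_on (sphere 0 1) F" "\<And>x. x \<in> {0..1} \<Longrightarrow> F (exp (freq 1 * of_real x)) = f x"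
proof -
  have "homotopic_loops UNIV f f"
    using assms by (simp add: homotopic_loops_refl path_def pathfinish_def pathstart_def)
  from homotopic_loops_imp_homotopic_circlemaps[OF this]
  have c: "continuous_on (sphere 0 1) (f \<circ> (\<lambda>z. Arg2pi z / (2 * pi)))"
    using homotopic_with_imp_continuous by blast
  show thesis
  proof (rule that[OF c])
    fix x :: real assume x: "x \<in> {0..1}"
    show "(f \<circ> (\<lambda>z. Arg2pi z / (2 * pi))) (exp (freq 1 * of_real x)) = f x"
    proof (cases "x = 1")
      case True
      then show ?thesis using assms(2) Arg2pi_of_real[of 1] by simp
    next
      case False
      have "Arg2pi (exp (freq 1 * of_real x)) = 2 * pi * x"
        by (rule Arg2pi_unique[of 1]) (use x False in \<open>auto simp: freq_def mult_ac\<close>)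
      then show ?thesis by simp
    qed
  qed
qed

text \<open>A function with vanishing coefficients is orthogonal to all trigonometric polynomials, which approximate its
  conjugate uniformly; hence its square integral is smaller than any positive number.\<close>

lemma fourier_coeff_unique:
  fixes f :: "real \<Rightarrow> complex"
  assumes c: "continuous_on {0..1} f" and per: "f 0 = f 1"
    and zero: "\<And>p. fourier_coeff f p = 0" and x: "x \<in> {0..1}"
  shows "f x = 0"
proof -
  have orth: "integral {0..1} (\<lambda>x. f x * h x) = 0" if "trig_poly h" for h
    using that
  proof (induction rule: trig_poly.induct)
    case (exp_term d p)
    have "integral {0..1} (\<lambda>x. f x * (d * exp (freq p * of_real x))) = d * fourier_coeff f (- p)"
      unfolding fourier_coeff_def by (simp add: freq_minus mult_ac flip: integral_mult_right)
    then show ?case by (simp add: zero)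
  next
    case (add g h)
    have "integral {0..1} (\<lambda>x. f x * (g x + h x))
        = integral {0..1} (\<lambda>x. f x * g x) + integral {0..1} (\<lambda>x. f x * h x)"
      unfolding distrib_left
      by (intro integral_add integrable_continuous_real continuous_intros c trig_poly_continuous add.hyps)
    then show ?case using add.IH by simp
  qed
  define I where "I = integral {0..1} (\<lambda>x. (norm (f x))\<^sup>2)"
  define M where "M = integral {0..1} (\<lambda>x. norm (f x))"
  have le: "I \<le> e * M" if e: "e > 0" for e
  proof -
    have cc: "continuous_on {0..1} (\<lambda>x. cnj (f x))" by (intro continuous_intros c)
    obtain F where F: "continuous_on (sphere 0 1) F"
      "\<And>x. x \<in> {0..1} \<Longrightarrow> F (exp (freq 1 * of_real x)) = cnj (f x)"
      by (rule circle_function[OF cc]) (use per in auto)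
    obtain g where g: "polynomial_function g" "\<And>z. z \<in> sphere 0 1 \<Longrightarrow> norm (F z - g z) < e"
      using Stone_Weierstrass_polynomial_function[OF compact_sphere F(1) e] by blast
    define h where "h = (\<lambda>x::real. g (exp (freq 1 * of_real x)))"
    have "trig_poly (\<lambda>x. of_real ((Re \<circ> g) (exp (freq 1 * of_real x)))
        + \<i> * of_real ((Im \<circ> g) (exp (freq 1 * of_real x))))"
      using g(1) unfolding polynomial_function_def
      by (intro trig_poly.add trig_poly_mult[OF trig_poly_const] trig_poly_real_polynomial)
        (use bounded_linear_Re bounded_linear_Im in blast)+
    moreover have "(\<lambda>x. of_real ((Re \<circ> g) (exp (freq 1 * of_real x)))
        + \<i> * of_real ((Im \<circ> g) (exp (freq 1 * of_real x)))) = h"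
      unfolding h_def by (simp add: fun_eq_iff complex_eq_iff)
    ultimately have h: "trig_poly h" by simp
    have close: "norm (cnj (f x) - h x) \<le> e" if "x \<in> {0..1}" for x
    proof -
      have "exp (freq 1 * of_real x) \<in> sphere 0 1"
        by (simp only: mem_sphere dist_0_norm norm_exp_freq)
      from g(2)[OF this] show ?thesis using F(2)[OF that] unfolding h_def by simp
    qed
    have int: "(\<lambda>x. f x * (cnj (f x) - h x)) integrable_on {0..1}"
      by (intro integrable_continuous_real continuous_intros c trig_poly_continuous h)
    have "complex_of_real I = integral {0..1} (\<lambda>x. complex_of_real ((norm (f x))\<^sup>2))"
      unfolding I_def
      by (intro integral_linear[symmetric, unfolded o_def] bounded_linear_of_real
          integrable_continuous_real continuous_intros c)
    also have "\<dots> = integral {0..1} (\<lambda>x. f x * cnj (f x))"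
      by (simp only: complex_norm_square)
    also have "\<dots> = integral {0..1} (\<lambda>x. f x * (cnj (f x) - h x) + f x * h x)"
      by (simp add: algebra_simps)
    also have "\<dots> = integral {0..1} (\<lambda>x. f x * (cnj (f x) - h x)) + integral {0..1} (\<lambda>x. f x * h x)"
      by (intro integral_add int integrable_continuous_real continuous_intros c trig_poly_continuous h)
    also have "\<dots> = integral {0..1} (\<lambda>x. f x * (cnj (f x) - h x))" using orth[OF h] by simp
    finally have "norm (complex_of_real I) = norm (integral {0..1} (\<lambda>x. f x * (cnj (f x) - h x)))" by simp
    also have "\<dots> \<le> integral {0..1} (\<lambda>x. e * norm (f x))"
    proof (rule integral_norm_bound_integral[OF int])
      show "(\<lambda>x. e * norm (f x)) integrable_on {0..1}"
        by (intro integrable_continuous_real continuous_intros c)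
      show "norm (f x * (cnj (f x) - h x)) \<le> e * norm (f x)" if "x \<in> {0..1}" for x
        using mult_left_mono[OF close[OF that], of "norm (f x)"] by (simp add: norm_mult mult.commute)
    qed
    also have "\<dots> = e * M" unfolding M_def by simp
    finally show ?thesis by simp
  qed
  have "I \<le> 0"
  proof (rule ccontr)
    assume "\<not> I \<le> 0"
    then have I: "I > 0" by simp
    have "M \<ge> 0" unfolding M_def by (intro integral_nonneg integrable_continuous_real continuous_intros c) auto
    then have "I \<le> I / (2 * (M + 1)) * M" using I by (intro le) auto
    also have "\<dots> = I / 2 * (M / (M + 1))" by simp
    also have "\<dots> \<le> I / 2 * 1" using I \<open>M \<ge> 0\<close> by (intro mult_left_mono) auto
    finally show False using I by simp
  qed
  moreover have "I \<ge> 0"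
    unfolding I_def by (intro integral_nonneg integrable_continuous_real continuous_intros c) auto
  ultimately have "I = 0" by simp
  then have "\<forall>x\<in>{0..1}. (norm (f x))\<^sup>2 = 0"
    unfolding I_def by (subst (asm) integral_eq_0_iff) (auto intro!: continuous_intros c)
  then show ?thesis using x by simp
qed

text \<open>The bound on finite sums makes the Fourier series converge absolutely and uniformly. Its sum has the same
  coefficients as \<open>f\<close> and therefore equals \<open>f\<close>, so what is left after removing the frequencies in \<open>A\<close> is bounded
  by the sum of the remaining coefficients. To use the Weierstrass test, the terms of frequency \<open>n\<close> and \<open>- n\<close> are
  grouped together.\<close>

theorem fourier_series_error:
  fixes f :: "real \<Rightarrow> complex"
  assumes c: "continuous_on {0..1} f" and per: "f 0 = f 1"
    and A: "finite A"
    and bound: "\<And>F. finite F \<Longrightarrow> F \<inter> A = {} \<Longrightarrow> (\<Sum>p\<in>F. norm (fourier_coeff f p)) \<le> B"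
    and x: "x \<in> {0..1}"
  shows "norm (f x - (\<Sum>p\<in>A. fourier_coeff f p * exp (freq p * of_real x))) \<le> B"
proof -
  define e where "e = (\<lambda>p x. fourier_coeff f p * exp (freq p * complex_of_real x))"
  define W where "W = (\<lambda>N::nat. {p::int. \<bar>p\<bar> < int N})"
  have finW: "finite (W N)" for N
    by (rule finite_subset[of _ "{- int N..int N}"]) (auto simp: W_def)
  define t where "t = (\<lambda>n x. \<Sum>p\<in>{int n, - int n}. e p x)"
  define m where "m = (\<lambda>n::nat. \<Sum>p\<in>{int n, - int n}. norm (fourier_coeff f p))"
  have regroup: "(\<Sum>n<N. \<Sum>p\<in>{int n, - int n}. g p) = sum g (W N)"
    for N and g :: "int \<Rightarrow> 'b::comm_monoid_add"
  proof (induction N)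
    case (Suc N)
    have "W (Suc N) = W N \<union> {int N, - int N}" by (auto simp: W_def)
    moreover have "W N \<inter> {int N, - int N} = {}" by (auto simp: W_def)
    ultimately have "sum g (W (Suc N)) = sum g (W N) + sum g {int N, - int N}"
      using finW by (simp only: sum.union_disjoint finite.intros)
    then show ?case using Suc by simp
  qed (simp add: W_def)
  have summ: "summable m"
  proof (rule summableI_nonneg_bounded)
    show "0 \<le> m n" for n unfolding m_def by (intro sum_nonneg) auto
    show "sum m {..<N} \<le> B + (\<Sum>p\<in>A. norm (fourier_coeff f p))" for N
    proof -
      have "sum m {..<N} = (\<Sum>p\<in>W N. norm (fourier_coeff f p))" unfolding m_def by (rule regroup)
      also have "\<dots> = (\<Sum>p\<in>W N - A. norm (fourier_coeff f p)) + (\<Sum>p\<in>W N \<inter> A. norm (fourier_coeff f p))"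
        using finW by (metis add.commute sum.Int_Diff)
      also have "\<dots> \<le> B + (\<Sum>p\<in>A. norm (fourier_coeff f p))"
        using finW A by (intro add_mono bound sum_mono2) auto
      finally show ?thesis .
    qed
  qed
  define S where "S = (\<lambda>N x. \<Sum>p\<in>W N. e p x)"
  define T where "T = (\<lambda>x. \<Sum>n. t n x)"
  have uni: "uniform_limit {0..1} S T sequentially"
  proof -
    have "uniform_limit {0..1} (\<lambda>n x. \<Sum>i<n. t i x) (\<lambda>x. suminf (\<lambda>i. t i x)) sequentially"
    proof (rule Weierstrass_m_test[OF _ summ])
      fix n and x :: real
      have "norm (t n x) \<le> (\<Sum>p\<in>{int n, - int n}. norm (e p x))" unfolding t_def by (rule norm_sum)
      then show "norm (t n x) \<le> m n" unfolding m_def e_def by (simp only: norm_mult norm_exp_freq mult_1_right)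
    qed
    then show ?thesis unfolding t_def S_def T_def regroup .
  qed
  have ce: "continuous_on X (e p)" for X p unfolding e_def by (intro continuous_intros)
  have cS: "continuous_on X (S N)" for X N unfolding S_def by (intro continuous_intros ce)
  have cT: "continuous_on {0..1} T"
    by (rule uniform_limit_theorem[OF _ uni]) (auto intro!: always_eventually cS)
  have coeff_T: "fourier_coeff T q = fourier_coeff f q" for q
  proof -
    have ucl: "uniform_limit {0..1} (\<lambda>N x. S N x * exp (- freq q * of_real x)) (\<lambda>x. T x * exp (- freq q * of_real x)) sequentially"
    proof (rule uniform_lim_mult[OF uni uniform_limit_const])
      show "bounded (T ` {0..1})" by (intro compact_imp_bounded compact_continuous_image cT) auto
      show "bounded ((\<lambda>x. exp (- freq q * complex_of_real x)) ` {0..1})" 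
      proof (rule boundedI)
        fix y assume "y \<in> (\<lambda>x. exp (- freq q * complex_of_real x)) ` {0..1}"
        then obtain x :: real where y: "y = exp (- freq q * complex_of_real x)" by blast
        show "norm y \<le> 1" unfolding y by (simp only: norm_exp_freq)
      qed
    qed
    have cont: "continuous_on {0..1} (\<lambda>x. S N x * exp (- freq q * of_real x))" for N
      by (intro continuous_intros cS)
    obtain I J where IJ: "\<And>n. ((\<lambda>x. S n x * exp (- freq q * of_real x)) has_integral I n) {0..1}"
       "((\<lambda>x. T x * exp (- freq q * of_real x)) has_integral J) {0..1}" "I \<longlonglongrightarrow> J"
      using uniform_limit_integral[OF ucl cont] by auto
    have "I N = fourier_coeff f q" if N: "N > nat \<bar>q\<bar>" for N
    proof -
      have "I N = integral {0..1} (\<lambda>x. S N x * exp (- freq q * of_real x))" by (rule integral_unique[OF IJ(1), symmetric])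
      also have "\<dots> = integral {0..1} (\<lambda>x. \<Sum>p\<in>W N. fourier_coeff f p * exp (freq (p - q) * of_real x))"
      proof -
        have "exp (freq p * of_real x) * exp (- freq q * of_real x) = exp (freq (p - q) * of_real x)"
          for p and x :: real
          by (simp add: freq_def ring_distribs flip: exp_add)
        then show ?thesis unfolding S_def e_def sum_distrib_right mult.assoc by simp
      qed
      also have "\<dots> = (\<Sum>p\<in>W N. fourier_coeff f p * integral {0..1} (\<lambda>x. exp (freq (p - q) * of_real x)))"
        using finW by (subst integral_sum) (auto intro!: integrable_continuous_real continuous_intros)
      also have "\<dots> = (\<Sum>p\<in>W N. if p = q then fourier_coeff f q else 0)"
        unfolding integral_exp_freq by (intro sum.cong) auto
      also have "\<dots> = fourier_coeff f q" using finW N by (simp add: W_def)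
      finally show ?thesis .
    qed
    then have "\<forall>\<^sub>F N in sequentially. I N = fourier_coeff f q"
      using eventually_gt_at_top[of "nat \<bar>q\<bar>"] by (rule eventually_mono[rotated]) auto
    then have "I \<longlonglongrightarrow> fourier_coeff f q" by (rule tendsto_eventually)
    then have "J = fourier_coeff f q" using IJ(3) LIMSEQ_unique by blast
    then show ?thesis using IJ(2) unfolding fourier_coeff_def by (simp add: integral_unique)
  qed
  have TS: "(\<lambda>N. S N y) \<longlonglongrightarrow> T y" if "y \<in> {0..1}" for y
    using uni that by (rule tendsto_uniform_limitI)
  have "T 0 = T 1"
  proof -
    have "S N 0 = S N 1" for N unfolding S_def e_def by simp
    then have "(\<lambda>N. S N 0) \<longlonglongrightarrow> T 1" using TS[of 1] by simp
    then show ?thesis using TS[of 0] LIMSEQ_unique by auto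
  qed
  have "f x - T x = 0"
  proof (rule fourier_coeff_unique[of "\<lambda>x. f x - T x"])
    show "continuous_on {0..1} (\<lambda>x. f x - T x)" by (intro continuous_intros c cT)
    show "f 0 - T 0 = f 1 - T 1" using per \<open>T 0 = T 1\<close> by simp
    show "fourier_coeff (\<lambda>x. f x - T x) p = 0" for p
    proof -
      have "fourier_coeff (\<lambda>x. f x - T x) p = fourier_coeff f p - fourier_coeff T p"
        unfolding fourier_coeff_def left_diff_distrib
        by (intro integral_diff integrable_continuous_real continuous_intros c cT)
      then show ?thesis using coeff_T by simp
    qed
  qed (rule x)
  then have lim: "(\<lambda>N. norm (S N x - (\<Sum>p\<in>A. e p x))) \<longlonglongrightarrow> norm (f x - (\<Sum>p\<in>A. e p x))"
    using TS[OF x] by (intro tendsto_intros) simp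
  obtain N0 where N0: "A \<subseteq> W N0"
  proof
    show "A \<subseteq> W (Suc (nat (\<Sum>a\<in>A. \<bar>a\<bar>)))"
    proof
      fix a assume "a \<in> A"
      then have "\<bar>a\<bar> \<le> (\<Sum>a\<in>A. \<bar>a\<bar>)" using A by (intro member_le_sum) auto
      then show "a \<in> W (Suc (nat (\<Sum>a\<in>A. \<bar>a\<bar>)))" unfolding W_def by auto
    qed
  qed
  have "norm (f x - (\<Sum>p\<in>A. e p x)) \<le> B"
  proof (rule LIMSEQ_le_const2[OF lim], intro exI[of _ N0] allI impI)
    fix N assume "N0 \<le> N"
    then have AW: "A \<subseteq> W N" using N0 unfolding W_def by force
    have "S N x - (\<Sum>p\<in>A. e p x) = (\<Sum>p\<in>W N - A. e p x)"
      unfolding S_def using sum_diff[OF finW AW, of "\<lambda>p. e p x"] by simp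
    also have "norm \<dots> \<le> (\<Sum>p\<in>W N - A. norm (fourier_coeff f p))"
      by (rule sum_norm_le) (simp add: e_def norm_mult)
    also have "\<dots> \<le> B" using finW by (intro bound) auto
    finally show "norm (S N x - (\<Sum>p\<in>A. e p x)) \<le> B" .
  qed
  then show ?thesis unfolding e_def .
qed

section \<open>Sums over the nonresonant frequencies\<close>

lemma power_diff_ge:
  fixes x y :: real
  assumes "0 \<le> y" "y \<le> x" "1 \<le> n"
  shows "(x - y) * x ^ (n - 1) \<le> x ^ n - y ^ n"
proof -
  obtain m where n: "n = Suc m" using assms(3) by (cases n) auto
  have "y * y ^ m \<le> y * x ^ m" using assms by (intro mult_left_mono power_mono) auto
  then show ?thesis unfolding n by (simp add: algebra_simps)
qed

lemma power_diff_abs_ge: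
  fixes x y :: real
  assumes "0 \<le> x" "0 \<le> y" "1 \<le> n"
  shows "\<bar>x - y\<bar> * max x y ^ (n - 1) \<le> \<bar>x ^ n - y ^ n\<bar>"
proof (cases "y \<le> x")
  case True
  have "(x - y) * x ^ (n - 1) \<le> x ^ n - y ^ n" using assms True by (intro power_diff_ge)
  moreover have "max x y = x" using True by simp
  ultimately show ?thesis using True by simp
next
  case False
  have "(y - x) * y ^ (n - 1) \<le> y ^ n - x ^ n" using assms False by (intro power_diff_ge) auto
  moreover have "max x y = y" using False by simp
  ultimately show ?thesis using False by simp
qed

lemma partial_fraction:
  fixes x y :: real
  assumes "x > 0" "y > 0"
  shows "1 / (x * (y + x)) = (inverse x - inverse (y + x)) / y"
proof -
  have "y + x \<noteq> 0" using assms by simp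
  then show ?thesis using assms by (simp add: divide_simps)
qed

text \<open>Below \<open>K\<close> the sum is harmonic up to the factor \<open>1 / K\<close>. Above \<open>K\<close> a partial fraction decomposition makes it
  telescope into the difference of two pieces of the harmonic series of the same length, at most the first \<open>K\<close>
  terms.\<close>

lemma resonance_sum_nat:
  fixes K :: nat
  assumes K: "1 \<le> K" and A: "finite A" "K \<notin> A"
  shows "(\<Sum>a\<in>A. 1 / (\<bar>real K - real a\<bar> * max (real K) (real a))) \<le> 2 * harm K / K"
proof -
  define g where "g = (\<lambda>a::nat. 1 / (\<bar>real K - real a\<bar> * max (real K) (real a)))"
  have gpos: "g a \<ge> 0" for a unfolding g_def by simp
  obtain R where R: "\<And>a. a \<in> A \<Longrightarrow> a \<le> K + R"
    using finite_nat_set_iff_bounded_le[of A] A(1) by (metis le_add2 order_trans)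
  have "A \<subseteq> {..<K} \<union> {K + 1..K + R}"
  proof
    fix a assume a: "a \<in> A"
    then have "a \<noteq> K" using A(2) by blast
    then show "a \<in> {..<K} \<union> {K + 1..K + R}" using R[OF a] by auto
  qed
  then have "sum g A \<le> sum g ({..<K} \<union> {K + 1..K + R})" using gpos by (intro sum_mono2) auto
  also have "\<dots> = sum g {..<K} + sum g {K + 1..K + R}" by (intro sum.union_disjoint) auto
  also have "sum g {..<K} = harm K / K"
  proof -
    have "sum g {..<K} = (\<Sum>r\<in>{1..K}. g (K - r))"
      by (rule sum.reindex_bij_witness[of _ "\<lambda>r. K - r" "\<lambda>a. K - a"]) auto
    also have "\<dots> = (\<Sum>r\<in>{1..K}. inverse (real r) / K)"
      by (intro sum.cong) (auto simp: g_def of_nat_diff divide_simps max_def)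
    also have "\<dots> = harm K / K" by (simp add: harm_def sum_divide_distrib)
    finally show ?thesis .
  qed
  also have "sum g {K + 1..K + R} = (harm R - (harm (K + R) - harm K)) / K"
  proof -
    have "sum g {K + 1..K + R} = (\<Sum>r\<in>{1..R}. g (K + r))"
      by (rule sum.reindex_bij_witness[of _ "\<lambda>r. K + r" "\<lambda>a. a - K"]) auto
    also have "\<dots> = (\<Sum>r\<in>{1..R}. (inverse (real r) - inverse (real (K + r))) / K)"
    proof (rule sum.cong)
      fix r assume "r \<in> {1..R}"
      then have r: "real r > 0" by simp
      have "g (K + r) = 1 / (real r * (real K + real r))" by (simp add: g_def)
      also have "\<dots> = (inverse (real r) - inverse (real (K + r))) / K"
        using partial_fraction[OF r, of "real K"] K by simp
      finally show "g (K + r) = (inverse (real r) - inverse (real (K + r))) / K" .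
    qed simp
    also have "\<dots> = (harm R - (\<Sum>r\<in>{1..R}. inverse (real (K + r)))) / K"
      by (simp add: harm_def sum_subtractf flip: sum_divide_distrib)
    also have "(\<Sum>r\<in>{1..R}. inverse (real (K + r))) = harm (K + R) - harm K"
      by (induction R) (simp_all add: harm_Suc)
    finally show ?thesis .
  qed
  also have "harm K / K + (harm R - (harm (K + R) - harm K)) / K \<le> 2 * harm K / K"
  proof -
    have "harm R \<le> (harm (K + R) :: real)" by (rule harm_mono) simp
    then show ?thesis using K by (simp add: field_simps)
  qed
  finally show ?thesis unfolding g_def .
qed

text \<open>The difference of the \<open>n\<close>-th powers exceeds the difference of the bases by a factor of the order of the
  \<open>(n - 1)\<close>-st power of the larger base. Dividing by the \<open>\<nu>\<close>-th power still leaves one power of the larger base, which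
  is what the preceding lemma needs; the others are at least powers of \<open>K\<close>.\<close>

lemma resonance_sum:
  fixes K :: nat and F :: "int set"
  assumes n: "\<nu> + 2 \<le> n" and K: "1 \<le> K" and F: "finite F" "\<And>p. p \<in> F \<Longrightarrow> \<bar>p\<bar> \<noteq> int K"
  shows "(\<Sum>p\<in>F. real_of_int \<bar>p\<bar> ^ \<nu> / \<bar>real K ^ n - real_of_int \<bar>p\<bar> ^ n\<bar>)
      \<le> 4 * (ln K + 1) / real K ^ (n - 1 - \<nu>)"
proof -
  define g where "g = (\<lambda>a::nat. 1 / (\<bar>real K - real a\<bar> * max (real K) (real a)))"
  have nat_bound: "sum g A \<le> 2 * harm K / K" if "finite A" "K \<notin> A" for A
    using resonance_sum_nat[OF K that] unfolding g_def .
  have term_bound: "real_of_int \<bar>p\<bar> ^ \<nu> / \<bar>real K ^ n - real_of_int \<bar>p\<bar> ^ n\<bar>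
      \<le> g (nat \<bar>p\<bar>) / real K ^ (n - 2 - \<nu>)" if p: "p \<in> F" for p
  proof -
    define x where "x = real_of_int \<bar>p\<bar>"
    define M where "M = max (real K) x"
    have x: "0 \<le> x" "x \<noteq> real K" unfolding x_def using F(2)[OF p]
      by (simp, metis of_int_eq_iff of_int_of_nat_eq)
    have M: "x \<le> M" "real K \<le> M" "0 < M" unfolding M_def using K by auto
    have exps: "n - 1 = \<nu> + (1 + (n - 2 - \<nu>))" using n by simp
    have "\<bar>real K - x\<bar> * (x ^ \<nu> * (M * real K ^ (n - 2 - \<nu>))) \<le> \<bar>real K - x\<bar> * (M ^ \<nu> * (M * M ^ (n - 2 - \<nu>)))"
      using x M by (intro mult_left_mono mult_mono power_mono) auto
    also have "\<dots> = \<bar>real K - x\<bar> * M ^ (n - 1)" unfolding exps by (simp add: power_add)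
    also have "\<dots> \<le> \<bar>real K ^ n - x ^ n\<bar>" unfolding M_def using x n by (intro power_diff_abs_ge) auto
    finally have main: "x ^ \<nu> * (\<bar>real K - x\<bar> * M * real K ^ (n - 2 - \<nu>)) \<le> \<bar>real K ^ n - x ^ n\<bar>"
      by (simp add: mult_ac)
    have pos: "\<bar>real K - x\<bar> * M * real K ^ (n - 2 - \<nu>) > 0" using x M K by (intro mult_pos_pos) auto
    have neq: "\<bar>real K ^ n - x ^ n\<bar> > 0"
      using x n power_eq_imp_eq_base[of "real K" n x] by fastforce
    have "x ^ \<nu> / \<bar>real K ^ n - x ^ n\<bar> \<le> 1 / (\<bar>real K - x\<bar> * M * real K ^ (n - 2 - \<nu>))"
      using main pos neq by (simp add: divide_simps)
    also have "\<dots> = g (nat \<bar>p\<bar>) / real K ^ (n - 2 - \<nu>)"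
      unfolding g_def M_def x_def by simp
    finally show ?thesis unfolding x_def .
  qed
  have notin: "K \<noteq> nat \<bar>p\<bar>" if "p \<in> F" for p using F(2)[OF that] by linarith
  have split: "F = {p \<in> F. 0 \<le> p} \<union> {p \<in> F. p < 0}" by auto
  have half1: "(\<Sum>p | p \<in> F \<and> 0 \<le> p. g (nat \<bar>p\<bar>)) \<le> 2 * harm K / K"
  proof -
    have inj: "inj_on (\<lambda>p. nat \<bar>p\<bar>) {p \<in> F. 0 \<le> p}" by (auto simp: inj_on_def)
    have "(\<Sum>p | p \<in> F \<and> 0 \<le> p. g (nat \<bar>p\<bar>)) = sum g ((\<lambda>p. nat \<bar>p\<bar>) ` {p \<in> F. 0 \<le> p})"
      by (simp only: sum.reindex[OF inj] o_def)
    also have "\<dots> \<le> 2 * harm K / K" 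
    proof (rule nat_bound)
      show "K \<notin> (\<lambda>p. nat \<bar>p\<bar>) ` {p \<in> F. 0 \<le> p}" using notin by blast
    qed (use F(1) in simp)
    finally show ?thesis .
  qed
  have half2: "(\<Sum>p | p \<in> F \<and> p < 0. g (nat \<bar>p\<bar>)) \<le> 2 * harm K / K"
  proof -
    have inj: "inj_on (\<lambda>p. nat \<bar>p\<bar>) {p \<in> F. p < 0}" by (auto simp: inj_on_def)
    have "(\<Sum>p | p \<in> F \<and> p < 0. g (nat \<bar>p\<bar>)) = sum g ((\<lambda>p. nat \<bar>p\<bar>) ` {p \<in> F. p < 0})"
      by (simp only: sum.reindex[OF inj] o_def)
    also have "\<dots> \<le> 2 * harm K / K" 
    proof (rule nat_bound)
      show "K \<notin> (\<lambda>p. nat \<bar>p\<bar>) ` {p \<in> F. p < 0}" using notin by blast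
    qed (use F(1) in simp)
    finally show ?thesis .
  qed
  have "(\<Sum>p\<in>F. real_of_int \<bar>p\<bar> ^ \<nu> / \<bar>real K ^ n - real_of_int \<bar>p\<bar> ^ n\<bar>)
      \<le> (\<Sum>p\<in>F. g (nat \<bar>p\<bar>) / real K ^ (n - 2 - \<nu>))"
    by (intro sum_mono term_bound)
  also have "\<dots> = (\<Sum>p\<in>F. g (nat \<bar>p\<bar>)) / real K ^ (n - 2 - \<nu>)" by (simp add: sum_divide_distrib)
  also have "(\<Sum>p\<in>F. g (nat \<bar>p\<bar>)) = (\<Sum>p | p \<in> F \<and> 0 \<le> p. g (nat \<bar>p\<bar>)) + (\<Sum>p | p \<in> F \<and> p < 0. g (nat \<bar>p\<bar>))"
    by (subst split, rule sum.union_disjoint) (use F in auto)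
  also have "(\<dots>) / real K ^ (n - 2 - \<nu>) \<le> (2 * harm K / K + 2 * harm K / K) / real K ^ (n - 2 - \<nu>)"
    using half1 half2 by (intro divide_right_mono add_mono) auto
  also have "\<dots> = 4 * harm K / real K ^ (n - 1 - \<nu>)"
  proof -
    have "n - 1 - \<nu> = Suc (n - 2 - \<nu>)" using n by simp
    then show ?thesis by simp
  qed
  also have "\<dots> \<le> 4 * (ln K + 1) / real K ^ (n - 1 - \<nu>)"
    using euler_mascheroni_sequence_decreasing[of 1 K] K
    by (intro divide_right_mono mult_left_mono) (auto simp: harm_def)
  finally show ?thesis .
qed

section \<open>The domain and the eigenspaces of the operator\<close>

lemma abs_continuous_on_unit_eq_ac01: "abs_continuous_on_unit f \<longleftrightarrow> ac01 f"
  unfolding abs_continuous_on_unit_def ac01_def ..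

text \<open>The lower derivatives of a function in the domain have continuous derivatives; this lets all derivatives below
  the \<open>n\<close>-th be treated alike.\<close>

lemma ac01_C1:
  fixes f g :: "real \<Rightarrow> 'a::euclidean_space"
  assumes der: "\<And>x. x \<in> {0..1} \<Longrightarrow> (f has_vector_derivative g x) (at x within {0..1})"
    and g: "continuous_on {0..1} g"
  shows "ac01 f"
proof -
  have "compact (g ` {0..1})" by (intro compact_continuous_image g) simp
  then obtain K where K: "K \<ge> 0" "\<And>x. x \<in> {0..1} \<Longrightarrow> norm (g x) \<le> K"
    using compact_imp_bounded bounded_pos by (metis imageI less_imp_le)
  show ?thesis
  proof (rule ac01_Lipschitz)
    fix a b :: real assume ab: "0 \<le> a" "a \<le> b" "b \<le> 1"
    have "(g has_integral (f b - f a)) {a..b}"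
      using ab by (intro fundamental_theorem_of_calculus has_vector_derivative_within_subset[OF der]) auto
    then show "norm (f b - f a) \<le> K * (b - a)"
      using has_integral_bound_real[of K "{}" g "f b - f a" a b] K ab by auto
  qed
qed

text \<open>Integration by parts: the fundamental theorem is applied to the product of \<open>f\<close> with the exponential, whose
  boundary values cancel by periodicity.\<close>

lemma fourier_coeff_derivative:
  fixes f g :: "real \<Rightarrow> complex"
  assumes f: "ac01 f" and S: "negligible S"
    and der: "\<And>x. x \<in> {0..1} - S \<Longrightarrow> (f has_vector_derivative g x) (at x within {0..1})"
    and per: "f 0 = f 1"
  shows "fourier_coeff g p = freq p * fourier_coeff f p"
proof -
  let ?e = "\<lambda>x::real. exp (- freq p * of_real x)"
  have de: "(?e has_vector_derivative (- freq p * ?e x)) (at x within T)" for x T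
  proof -
    have "((\<lambda>z. exp (- freq p * z)) has_field_derivative - freq p * ?e x) (at (of_real x))"
      by (auto intro!: derivative_eq_intros)
    then show ?thesis by (rule has_vector_derivative_real_field)
  qed
  have ac: "ac01 (\<lambda>x. f x * ?e x)"
  proof (rule ac01_times_Lipschitz[OF f])
    fix a b :: real assume ab: "0 \<le> a" "a \<le> b" "b \<le> 1"
    have "((\<lambda>x. - freq p * ?e x) has_integral (?e b - ?e a)) {a..b}"
      using ab by (intro fundamental_theorem_of_calculus de) auto
    moreover have "norm (- freq p * ?e x) \<le> norm (freq p)" for x
      by (simp only: norm_mult norm_exp_freq norm_minus_cancel mult_1_right order_refl)
    ultimately show "norm (?e b - ?e a) \<le> norm (freq p) * (b - a)"
      using has_integral_bound_real[of "norm (freq p)" "{}" "\<lambda>x. - freq p * ?e x" "?e b - ?e a" a b] ab by auto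
  next
    fix x :: real show "norm (?e x) \<le> 1" by (simp only: norm_exp_freq order_refl)
  qed
  have "((\<lambda>x. f x * (- freq p * ?e x) + g x * ?e x) has_integral (f 1 * ?e 1 - f 0 * ?e 0)) {0..1}"
  proof (rule ac01_fundamental_theorem[OF ac S])
    fix x :: real assume x: "x \<in> {0..1} - S"
    show "((\<lambda>x. f x * ?e x) has_vector_derivative f x * (- freq p * ?e x) + g x * ?e x) (at x within {0..1})"
      by (rule has_vector_derivative_mult[OF der[OF x] de])
  qed
  moreover have "?e 1 = 1" using exp_freq_1[of "- p"] by (simp add: freq_minus)
  ultimately have 1: "((\<lambda>x. f x * (- freq p * ?e x) + g x * ?e x) has_integral 0) {0..1}"
    using per by simp
  have 2: "((\<lambda>x. f x * ?e x) has_integral fourier_coeff f p) {0..1}"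
    unfolding fourier_coeff_def
    by (intro integrable_integral integrable_continuous_real continuous_intros ac01_continuous[OF f])
  have "((\<lambda>x. (f x * (- freq p * ?e x) + g x * ?e x) + freq p * (f x * ?e x))
      has_integral (0 + freq p * fourier_coeff f p)) {0..1}"
    by (intro has_integral_add 1 has_integral_mult_right 2)
  then have "((\<lambda>x. g x * ?e x) has_integral freq p * fourier_coeff f p) {0..1}"
    by (simp add: algebra_simps)
  then show ?thesis unfolding fourier_coeff_def by (rule integral_unique)
qed

lemma smult_bounded_linear: "bounded_linear (\<lambda>v::complex^'m. c *s v)"
  by (intro linear_conv_bounded_linear[THEN iffD1] linearI) (simp_all add: vec_eq_iff algebra_simps)

lemma deriv01_lincomb_at:
  assumes "deriv01 \<nu> y differentiable (at x within {0..1})" "deriv01 \<nu> z differentiable (at x within {0..1})"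
    and x: "x \<in> {0..1}"
    and IH: "\<And>t. t \<in> {0..1} \<Longrightarrow> deriv01 \<nu> (\<lambda>x. a *s y x + b *s z x) t = a *s deriv01 \<nu> y t + b *s deriv01 \<nu> z t"
  shows "(deriv01 \<nu> (\<lambda>x. a *s y x + b *s z x) has_vector_derivative
      (a *s deriv01 (Suc \<nu>) y x + b *s deriv01 (Suc \<nu>) z x)) (at x within {0..1})"
    "deriv01 (Suc \<nu>) (\<lambda>x. a *s y x + b *s z x) x = a *s deriv01 (Suc \<nu>) y x + b *s deriv01 (Suc \<nu>) z x"
proof -
  have "(deriv01 \<nu> y has_vector_derivative deriv01 (Suc \<nu>) y x) (at x within {0..1})"
    "(deriv01 \<nu> z has_vector_derivative deriv01 (Suc \<nu>) z x) (at x within {0..1})"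
    using assms(1,2) by (simp_all add: vector_derivative_works)
  then have "((\<lambda>t. a *s deriv01 \<nu> y t + b *s deriv01 \<nu> z t) has_vector_derivative
      (a *s deriv01 (Suc \<nu>) y x + b *s deriv01 (Suc \<nu>) z x)) (at x within {0..1})"
    by (intro has_vector_derivative_add bounded_linear.has_vector_derivative[OF smult_bounded_linear])
  then show 1: "(deriv01 \<nu> (\<lambda>x. a *s y x + b *s z x) has_vector_derivative
      (a *s deriv01 (Suc \<nu>) y x + b *s deriv01 (Suc \<nu>) z x)) (at x within {0..1})"
    by (rule has_vector_derivative_transform[OF x, rotated]) (rule IH)
  show "deriv01 (Suc \<nu>) (\<lambda>x. a *s y x + b *s z x) x = a *s deriv01 (Suc \<nu>) y x + b *s deriv01 (Suc \<nu>) z x"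
    using vector_derivative_within_cbox[of 0 1] 1 x by auto
qed

lemma matrix_vector_smult_complex:
  fixes A :: "complex^'m^'m" shows "A *v (c *s v) = c *s (A *v v)"
  by (simp add: vec_eq_iff matrix_vector_mult_def sum_distrib_left mult_ac)

lemma AE_lebesgue_on_negligible:
  assumes "AE x in lebesgue_on {0..1::real}. Q x"
  obtains T where "negligible T" "\<And>x. x \<in> {0..1} - T \<Longrightarrow> Q x"
proof -
  have "AE x in lebesgue. x \<in> {0..1} \<longrightarrow> Q x"
    using assms by (subst (asm) AE_restrict_space_iff) auto
  then obtain T where T: "T \<in> null_sets lebesgue" "{x. \<not> (x \<in> {0..1} \<longrightarrow> Q x)} \<subseteq> T"
    by (auto simp: eventually_ae_filter)
  then show thesis by (intro that[of T]) (auto simp: negligible_iff_null_sets)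
qed

text \<open>For an eigenfunction the differential expression is almost everywhere a multiple of a continuous function, so it
  meets the integrability condition in \<open>op_domain\<close>.\<close>

lemma square_integrable_if_AE_eq_continuous:
  fixes f g :: "real \<Rightarrow> complex^'m"
  assumes g: "continuous_on {0..1} g" and eq: "AE x in lebesgue_on {0..1}. f x = g x"
  shows "square_integrable f"
proof -
  obtain T where neg: "negligible T" and fg: "\<And>x. x \<in> {0..1} - T \<Longrightarrow> f x = g x"
    using eq by (auto elim: AE_lebesgue_on_negligible)
  have fm: "f \<in> borel_measurable (lebesgue_on {0..1})"
  proof (rule absolutely_integrable_measurable[THEN iffD1, THEN conjunct1])
    have "g absolutely_integrable_on {0..1}" by (rule absolutely_integrable_continuous_real[OF g])
    then show "f absolutely_integrable_on {0..1}" by (rule absolutely_integrable_spike[OF _ neg fg])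
  qed simp
  show ?thesis unfolding square_integrable_def
  proof
    show "f \<in> borel_measurable (lebesgue_on {0..1})" by (rule fm)
    have "(\<lambda>x. (norm (g x))\<^sup>2) absolutely_integrable_on {0..1}"
      by (intro absolutely_integrable_continuous_real continuous_intros g)
    then show "(\<lambda>x. (norm (f x))\<^sup>2) absolutely_integrable_on {0..1}"
      by (rule absolutely_integrable_spike[OF _ neg]) (use fg in auto)
  qed
qed

lemma AE_lebesgue_onI:
  assumes "negligible T" "\<And>x. x \<in> {0..1::real} - T \<Longrightarrow> Q x"
  shows "AE x in lebesgue_on {0..1}. Q x"
proof -
  have "AE x in lebesgue. x \<in> {0..1} \<longrightarrow> Q x"
    using assms by (intro AE_I'[of T]) (auto simp: negligible_iff_null_sets)
  then show ?thesis by (subst AE_restrict_space_iff) auto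
qed

locale domain_function =
  fixes n :: nat and P :: "nat \<Rightarrow> real \<Rightarrow> complex^'m^'m" and y :: "real \<Rightarrow> complex^'m"
  assumes n2: "2 \<le> n" and dom: "y \<in> op_domain n P"
begin

lemma vanishes: "x \<notin> {0..1} \<Longrightarrow> y x = 0" using dom by (auto simp: op_domain_def)

lemma periodic: "\<nu> < n \<Longrightarrow> deriv01 \<nu> y 0 = deriv01 \<nu> y 1"
  using dom by (auto simp: op_domain_def)

lemma has_derivative_lower:
  assumes "\<nu> < n - 1" "x \<in> {0..1}"
  shows "(deriv01 \<nu> y has_vector_derivative deriv01 (Suc \<nu>) y x) (at x within {0..1})"
  using dom assms unfolding op_domain_def
  by (auto simp: differentiable_on_def vector_derivative_works[symmetric])

lemma continuous_deriv:
  assumes "\<nu> < n" shows "continuous_on {0..1} (deriv01 \<nu> y)"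
proof (cases "\<nu> = n - 1")
  case True
  then show ?thesis
    using dom ac01_continuous unfolding op_domain_def abs_continuous_on_unit_eq_ac01 by blast
next
  case False
  then show ?thesis
    using dom assms unfolding op_domain_def by (auto intro!: differentiable_imp_continuous_on)
qed

lemma ac_deriv:
  assumes "\<nu> < n" shows "ac01 (deriv01 \<nu> y)"
proof (cases "\<nu> = n - 1")
  case True
  then show ?thesis using dom unfolding op_domain_def abs_continuous_on_unit_eq_ac01 by blast
next
  case False
  then show ?thesis using assms by (intro ac01_C1[OF has_derivative_lower continuous_deriv]) auto
qed

text \<open>Only the derivative of order \<open>n - 1\<close>, which is merely absolutely continuous, requires Lebesgue's theorem. The end points
  join the exceptional set, since that theorem speaks of interior points.\<close>

lemma has_derivative_ae:
  obtains S where "negligible S"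
    "\<And>\<nu> x. \<nu> < n \<Longrightarrow> x \<in> {0..1} - S \<Longrightarrow>
      (deriv01 \<nu> y has_vector_derivative deriv01 (Suc \<nu>) y x) (at x within {0..1})"
proof -
  have "ac01 (deriv01 (n - 1) y)" using n2 by (intro ac_deriv) auto
  then obtain S where S: "negligible S"
    "\<And>x. x \<in> {0<..<1} - S \<Longrightarrow> deriv01 (n - 1) y differentiable (at x)"
    by (rule ac01_differentiable_ae) blast
  show thesis
  proof (rule that[of "S \<union> {0, 1}"])
    show "negligible (S \<union> {0, 1})" using S(1) by (intro negligible_Un) auto
    fix \<nu> x assume \<nu>: "\<nu> < n" and x: "x \<in> {0..1} - (S \<union> {0, 1})"
    show "(deriv01 \<nu> y has_vector_derivative deriv01 (Suc \<nu>) y x) (at x within {0..1})"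
    proof (cases "\<nu> = n - 1")
      case True
      have "deriv01 (n - 1) y differentiable (at x within {0..1})"
      proof (rule differentiable_at_withinI, rule S(2))
        show "x \<in> {0<..<1} - S" using x by simp
      qed
      then show ?thesis unfolding True by (simp add: vector_derivative_works)
    next
      case False
      then show ?thesis using \<nu> x by (intro has_derivative_lower) auto
    qed
  qed
qed

lemma fourier_coeff_deriv:
  assumes "\<nu> \<le> n"
  shows "fourier_coeff (\<lambda>x. deriv01 \<nu> y x $ i) p = freq p ^ \<nu> * fourier_coeff (\<lambda>x. y x $ i) p"
  using assms
proof (induction \<nu>)
  case (Suc \<nu>)
  obtain S where S: "negligible S" "\<And>\<nu> x. \<nu> < n \<Longrightarrow> x \<in> {0..1} - S \<Longrightarrow>
      (deriv01 \<nu> y has_vector_derivative deriv01 (Suc \<nu>) y x) (at x within {0..1})"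
    by (rule has_derivative_ae) blast
  have "fourier_coeff (\<lambda>x. deriv01 (Suc \<nu>) y x $ i) p = freq p * fourier_coeff (\<lambda>x. deriv01 \<nu> y x $ i) p"
  proof (rule fourier_coeff_derivative[OF _ S(1)])
    show "ac01 (\<lambda>x. deriv01 \<nu> y x $ i)"
      using Suc.prems by (intro ac01_bounded_linear[OF ac_deriv bounded_linear_vec_nth]) auto
    show "((\<lambda>x. deriv01 \<nu> y x $ i) has_vector_derivative deriv01 (Suc \<nu>) y x $ i) (at x within {0..1})"
      if "x \<in> {0..1} - S" for x
      using Suc.prems S(2)[OF _ that]
      by (intro bounded_linear.has_vector_derivative[OF bounded_linear_vec_nth]) auto
    show "deriv01 \<nu> y 0 $ i = deriv01 \<nu> y 1 $ i" using periodic[of \<nu>] Suc.prems by simp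
  qed
  then show ?case using Suc by simp
qed simp

end

text \<open>Where a derivative does not exist, \<open>deriv01\<close> has an arbitrary value, on which linearity can fail. For the highest
  order this happens on a null set only, which the eigenvalue equation ignores.\<close>

lemma eigenspace_lincomb:
  assumes n2: "2 \<le> n" and y: "y \<in> eigenspace n P l" and z: "z \<in> eigenspace n P l"
  shows "(\<lambda>x. a *s y x + b *s z x) \<in> eigenspace n P l"
proof -
  let ?f = "\<lambda>x. a *s y x + b *s z x"
  interpret y: domain_function n P y using n2 y by unfold_locales (auto simp: eigenspace_def)
  interpret z: domain_function n P z using n2 z by unfold_locales (auto simp: eigenspace_def)
  have lower: "deriv01 \<nu> ?f x = a *s deriv01 \<nu> y x + b *s deriv01 \<nu> z x"
    if "\<nu> < n" "x \<in> {0..1}" for \<nu> x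
    using that
  proof (induction \<nu> arbitrary: x)
    case (Suc \<nu>)
    have "\<nu> < n - 1" using Suc.prems by simp
    then show ?case
      using y.has_derivative_lower[of \<nu> x] z.has_derivative_lower[of \<nu> x] Suc.prems
      by (intro deriv01_lincomb_at(2)[of \<nu> y x z a b]) (auto intro: differentiableI_vector Suc.IH)
  qed simp
  obtain S where S: "negligible S" "\<And>\<nu> x. \<nu> < n \<Longrightarrow> x \<in> {0..1} - S \<Longrightarrow>
      (deriv01 \<nu> y has_vector_derivative deriv01 (Suc \<nu>) y x) (at x within {0..1})"
    by (rule y.has_derivative_ae) blast
  obtain S' where S': "negligible S'" "\<And>\<nu> x. \<nu> < n \<Longrightarrow> x \<in> {0..1} - S' \<Longrightarrow>
      (deriv01 \<nu> z has_vector_derivative deriv01 (Suc \<nu>) z x) (at x within {0..1})"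
    by (rule z.has_derivative_ae) blast
  have top: "deriv01 n ?f x = a *s deriv01 n y x + b *s deriv01 n z x"
    if x: "x \<in> {0..1} - (S \<union> S')" for x
  proof -
    have n: "n = Suc (n - 1)" "n - 1 < n" using n2 by auto
    have "deriv01 (n - 1) y differentiable at x within {0..1}" "deriv01 (n - 1) z differentiable at x within {0..1}"
      using S(2)[OF n(2), of x] S'(2)[OF n(2), of x] x by (auto intro: differentiableI_vector)
    then have "deriv01 (Suc (n - 1)) ?f x = a *s deriv01 (Suc (n - 1)) y x + b *s deriv01 (Suc (n - 1)) z x"
      using x n by (intro deriv01_lincomb_at(2) lower) auto
    then show ?thesis using n(1) by simp
  qed
  have expr: "diff_expr n P ?f x = a *s diff_expr n P y x + b *s diff_expr n P z x"
    if x: "x \<in> {0..1} - (S \<union> S')" for x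
  proof -
    have "(\<Sum>\<nu>=2..n. P \<nu> x *v deriv01 (n - \<nu>) ?f x)
        = (\<Sum>\<nu>=2..n. a *s (P \<nu> x *v deriv01 (n - \<nu>) y x) + b *s (P \<nu> x *v deriv01 (n - \<nu>) z x))"
      using x n2 by (intro sum.cong) (auto simp: lower matrix_vector_right_distrib matrix_vector_smult_complex)
    also have "\<dots> = a *s (\<Sum>\<nu>=2..n. P \<nu> x *v deriv01 (n - \<nu>) y x)
        + b *s (\<Sum>\<nu>=2..n. P \<nu> x *v deriv01 (n - \<nu>) z x)"
      by (simp add: sum.distrib linear_sum[OF bounded_linear.linear[OF smult_bounded_linear]])
    finally show ?thesis
      unfolding diff_expr_def top[OF x] by (simp add: vector_add_ldistrib algebra_simps)
  qed
  obtain T where T: "negligible T" "\<And>x. x \<in> {0..1} - T \<Longrightarrow> diff_expr n P y x = l *s y x"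
    using y unfolding eigenspace_def by (auto elim: AE_lebesgue_on_negligible)
  obtain T' where T': "negligible T'" "\<And>x. x \<in> {0..1} - T' \<Longrightarrow> diff_expr n P z x = l *s z x"
    using z unfolding eigenspace_def by (auto elim: AE_lebesgue_on_negligible)
  have eq: "AE x in lebesgue_on {0..1}. diff_expr n P ?f x = l *s ?f x"
  proof (rule AE_lebesgue_onI)
    show "negligible ((S \<union> S') \<union> (T \<union> T'))" using S S' T T' by (intro negligible_Un) auto
    fix x assume x: "x \<in> {0..1} - ((S \<union> S') \<union> (T \<union> T'))"
    show "diff_expr n P ?f x = l *s ?f x"
      using x expr[of x] T(2)[of x] T'(2)[of x]
      by (simp add: vector_add_ldistrib vector_smult_assoc mult.commute)
  qed
  have cont: "continuous_on {0..1} (\<lambda>x. c *s g x)" if "continuous_on {0..1} g" for c and g :: "real \<Rightarrow> complex^'a"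
    using linear_continuous_on_compose[OF that bounded_linear.linear[OF smult_bounded_linear]] .
  have c0: "continuous_on {0..1} y" "continuous_on {0..1} z"
    using y.continuous_deriv[of 0] z.continuous_deriv[of 0] n2 by simp_all
  show ?thesis
    unfolding eigenspace_def op_domain_def
  proof (intro CollectI conjI allI impI)
    show "?f x = 0" if "x \<notin> {0..1}" for x using y.vanishes[OF that] z.vanishes[OF that] by simp
    show "deriv01 \<nu> ?f differentiable_on {0..1}" if "\<nu> < n - 1" for \<nu>
      unfolding differentiable_on_def
    proof
      fix x :: real assume x: "x \<in> {0..1}"
      have "(deriv01 \<nu> ?f has_vector_derivative a *s deriv01 (Suc \<nu>) y x + b *s deriv01 (Suc \<nu>) z x)
          (at x within {0..1})"
        using that y.has_derivative_lower[OF that x] z.has_derivative_lower[OF that x] x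
        by (intro deriv01_lincomb_at(1) lower) (auto intro: differentiableI_vector)
      then show "deriv01 \<nu> ?f differentiable at x within {0..1}" by (rule differentiableI_vector)
    qed
    show "abs_continuous_on_unit (deriv01 (n - 1) ?f)"
    proof -
      have "ac01 (\<lambda>x. a *s deriv01 (n - 1) y x + b *s deriv01 (n - 1) z x)"
        using n2 by (intro ac01_add ac01_bounded_linear[OF _ smult_bounded_linear] y.ac_deriv z.ac_deriv) auto
      moreover have "ac01 (deriv01 (n - 1) ?f)
          \<longleftrightarrow> ac01 (\<lambda>x. a *s deriv01 (n - 1) y x + b *s deriv01 (n - 1) z x)"
        by (rule ac01_cong) (use lower n2 in auto)
      ultimately show ?thesis unfolding abs_continuous_on_unit_eq_ac01 by simp
    qed
    show "square_integrable (diff_expr n P ?f)"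
      by (rule square_integrable_if_AE_eq_continuous[OF _ eq]) (intro cont continuous_on_add c0)
    show "deriv01 \<nu> ?f 1 = deriv01 \<nu> ?f 0" if "\<nu> < n" for \<nu>
      using lower[OF that, of 0] lower[OF that, of 1] y.periodic[OF that] z.periodic[OF that] by simp
  qed (rule eq)
qed

section \<open>Fourier coefficients of eigenfunctions\<close>

definition fourier_vec :: "(real \<Rightarrow> complex^'m) \<Rightarrow> int \<Rightarrow> complex^'m" where
  "fourier_vec y p = (\<chi> i. fourier_coeff (\<lambda>x. y x $ i) p)"

lemma integrable_times_continuous:
  fixes h f :: "real \<Rightarrow> complex"
  assumes h: "h absolutely_integrable_on {0..1}" and f: "continuous_on {0..1} f"
  shows "(\<lambda>x. h x * f x) absolutely_integrable_on {0..1}"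
proof -
  have "(\<lambda>x. f x * h x) absolutely_integrable_on {0..1}"
  proof (rule absolutely_integrable_bounded_measurable_product[where h = "(*)", OF _ _ _ _ h])
    show "bilinear ((*) :: complex \<Rightarrow> complex \<Rightarrow> complex)"
      by (rule bilinear_times)
    show "f \<in> borel_measurable (lebesgue_on {0..1})"
      using f by (intro continuous_imp_measurable_on_sets_lebesgue) auto
    show "bounded (f ` {0..1})" by (intro compact_imp_bounded compact_continuous_image f) simp
  qed simp
  then show ?thesis by (simp add: mult.commute)
qed

lemma integral_times_continuous_bound:
  fixes h f :: "real \<Rightarrow> complex"
  assumes h: "h absolutely_integrable_on {0..1}" and f: "continuous_on {0..1} f"
    and B: "\<And>x. x \<in> {0..1} \<Longrightarrow> norm (f x) \<le> B"
  shows "norm (integral {0..1} (\<lambda>x. h x * f x)) \<le> B * integral {0..1} (\<lambda>x. norm (h x))"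
proof -
  have "norm (integral {0..1} (\<lambda>x. h x * f x)) \<le> integral {0..1} (\<lambda>x. B * norm (h x))"
  proof (rule integral_norm_bound_integral)
    show "(\<lambda>x. h x * f x) integrable_on {0..1}"
      using integrable_times_continuous[OF h f] absolutely_integrable_on_def by blast
    show "(\<lambda>x. B * norm (h x)) integrable_on {0..1}"
      using h by (intro integrable_on_mult_right) (simp add: absolutely_integrable_on_def)
    show "norm (h x * f x) \<le> B * norm (h x)" if "x \<in> {0..1}" for x
      using mult_right_mono[OF B[OF that], of "norm (h x)"] by (simp add: norm_mult mult.commute)
  qed
  then show ?thesis by simp
qed

lemma fourier_coeff_product_bound:
  fixes h f :: "real \<Rightarrow> complex"
  assumes h: "h absolutely_integrable_on {0..1}" and f: "continuous_on {0..1} f"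
    and B: "\<And>x. x \<in> {0..1} \<Longrightarrow> norm (f x) \<le> B"
  shows "norm (fourier_coeff (\<lambda>x. h x * f x) p) \<le> B * integral {0..1} (\<lambda>x. norm (h x))"
  unfolding fourier_coeff_def mult.assoc
proof (rule integral_times_continuous_bound[OF h])
  show "continuous_on {0..1} (\<lambda>x. f x * exp (- freq p * complex_of_real x))"
    by (intro continuous_intros f)
  show "norm (f x * exp (- freq p * complex_of_real x)) \<le> B" if "x \<in> {0..1}" for x
    using B[OF that] by (simp only: norm_mult norm_exp_freq mult_1_right)
qed

lemma norm_le_sum_components: "norm (v :: complex^'m) \<le> (\<Sum>i\<in>UNIV. norm (v $ i))"
  unfolding norm_vec_def by (rule L2_set_le_sum) auto

lemma norm_freq: "norm (freq p) = 2 * pi * \<bar>real_of_int p\<bar>"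
  by (simp add: freq_def norm_mult)

lemma freq_minus_even_power: "even r \<Longrightarrow> freq (- p) ^ r = freq p ^ r"
  by (simp add: freq_minus)

locale summable_operator =
  fixes n :: nat and P :: "nat \<Rightarrow> real \<Rightarrow> complex^'m^'m"
  assumes n2: "2 \<le> n" and n_even: "even n"
    and summable_P: "\<And>\<nu> i j. 2 \<le> \<nu> \<Longrightarrow> \<nu> \<le> n \<Longrightarrow>
          (\<lambda>x. P \<nu> x $ i $ j) absolutely_integrable_on {0..1}"
begin

text \<open>The functions \<open>P \<nu>\<close> enter the error estimates only through this number.\<close>

definition total_mass :: real where
  "total_mass = (\<Sum>\<nu>=2..n. \<Sum>i\<in>UNIV. \<Sum>j\<in>UNIV. integral {0..1} (\<lambda>x. norm (P \<nu> x $ i $ j)))"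

lemma mass_nonneg: "0 \<le> integral {0..1} (\<lambda>x. norm (P \<nu> x $ i $ j))"
  by (cases "(\<lambda>x. norm (P \<nu> x $ i $ j)) integrable_on {0..1}")
    (auto intro: integral_nonneg simp: not_integrable_integral)

lemma total_mass_nonneg: "0 \<le> total_mass"
  unfolding total_mass_def by (intro sum_nonneg mass_nonneg)

lemma row_mass_le: "(\<Sum>\<nu>=2..n. \<Sum>j\<in>UNIV. integral {0..1} (\<lambda>x. norm (P \<nu> x $ i $ j))) \<le> total_mass"
  unfolding total_mass_def
proof (rule sum_mono)
  fix \<nu>
  show "(\<Sum>j\<in>UNIV. integral {0..1} (\<lambda>x. norm (P \<nu> x $ i $ j)))
      \<le> (\<Sum>i\<in>UNIV. \<Sum>j\<in>UNIV. integral {0..1} (\<lambda>x. norm (P \<nu> x $ i $ j)))"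
    by (rule member_le_sum[of i UNIV "\<lambda>i. \<Sum>j\<in>UNIV. integral {0..1} (\<lambda>x. norm (P \<nu> x $ i $ j))"])
      (auto intro: sum_nonneg mass_nonneg)
qed

lemma domain_function: "y \<in> eigenspace n P l \<Longrightarrow> domain_function n P y"
  using n2 by unfold_locales (auto simp: eigenspace_def)

lemma component_continuous:
  "y \<in> eigenspace n P l \<Longrightarrow> \<nu> < n \<Longrightarrow> continuous_on {0..1} (\<lambda>x. deriv01 \<nu> y x $ i)"
  using domain_function.continuous_deriv[OF domain_function, of y l \<nu>]
  by (auto intro: continuous_on_component)

text \<open>The unperturbed operator multiplies the coefficient of frequency \<open>p\<close> by \<open>freq p ^ n\<close>, so the differential equation
  turns into a relation between coefficients in which \<open>l - freq p ^ n\<close> measures the distance from resonance.\<close>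

theorem eigenfunction_fourier_coeff:
  assumes y: "y \<in> eigenspace n P l"
  shows "(l - freq p ^ n) * fourier_vec y p $ i
    = (\<Sum>\<nu>=2..n. \<Sum>j\<in>UNIV. fourier_coeff (\<lambda>x. P \<nu> x $ i $ j * deriv01 (n - \<nu>) y x $ j) p)"
proof -
  interpret y: domain_function n P y by (rule domain_function[OF y])
  let ?e = "\<lambda>x::real. exp (- freq p * of_real x)"
  let ?q = "\<lambda>\<nu> j x. P \<nu> x $ i $ j * deriv01 (n - \<nu>) y x $ j"
  obtain T where T: "negligible T" "\<And>x. x \<in> {0..1} - T \<Longrightarrow> diff_expr n P y x = l *s y x"
    using y unfolding eigenspace_def by (auto elim: AE_lebesgue_on_negligible)
  have pt: "deriv01 n y x $ i = l * y x $ i - (\<Sum>\<nu>=2..n. \<Sum>j\<in>UNIV. ?q \<nu> j x)"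
    if "x \<in> {0..1} - T" for x
  proof -
    have "(diff_expr n P y x) $ i = (l *s y x) $ i" using T(2)[OF that] by simp
    then show ?thesis
      unfolding diff_expr_def by (simp add: matrix_vector_mult_def algebra_simps)
  qed
  have int_q: "(\<lambda>x. ?q \<nu> j x * ?e x) integrable_on {0..1}" if "\<nu> \<in> {2..n}" for \<nu> j
  proof -
    have "(\<lambda>x. P \<nu> x $ i $ j * (deriv01 (n - \<nu>) y x $ j * ?e x)) absolutely_integrable_on {0..1}"
      using that by (intro integrable_times_continuous summable_P continuous_intros
          component_continuous[OF y]) auto
    then show ?thesis by (simp add: absolutely_integrable_on_def mult.assoc)
  qed
  have int_y: "(\<lambda>x. l * y x $ i * ?e x) integrable_on {0..1}"
  proof -
    have cy: "continuous_on {0..1} (\<lambda>x. y x $ i)" using component_continuous[OF y, of 0 i] n2 by simp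
    have ce: "continuous_on {0..1} ?e" by (intro continuous_intros)
    show ?thesis
      by (intro integrable_continuous_real continuous_on_mult continuous_on_const cy ce)
  qed
  have "freq p ^ n * fourier_vec y p $ i = fourier_coeff (\<lambda>x. deriv01 n y x $ i) p"
    using y.fourier_coeff_deriv[of n i p] by (simp add: fourier_vec_def)
  also have "\<dots> = integral {0..1} (\<lambda>x. l * y x $ i * ?e x - (\<Sum>\<nu>=2..n. \<Sum>j\<in>UNIV. ?q \<nu> j x * ?e x))"
    unfolding fourier_coeff_def
  proof (rule integral_spike[OF T(1)])
    fix x :: real assume "x \<in> {0..1} - T"
    from pt[OF this]
    show "l * y x $ i * ?e x - (\<Sum>\<nu>=2..n. \<Sum>j\<in>UNIV. ?q \<nu> j x * ?e x) = deriv01 n y x $ i * ?e x"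
      by (simp only: left_diff_distrib sum_distrib_right)
  qed
  also have "\<dots> = integral {0..1} (\<lambda>x. l * y x $ i * ?e x)
      - integral {0..1} (\<lambda>x. \<Sum>\<nu>=2..n. \<Sum>j\<in>UNIV. ?q \<nu> j x * ?e x)"
    by (intro integral_diff int_y integrable_sum int_q) auto
  also have "integral {0..1} (\<lambda>x. l * y x $ i * ?e x) = l * fourier_vec y p $ i"
    by (simp add: fourier_vec_def fourier_coeff_def mult.assoc)
  also have "integral {0..1} (\<lambda>x. \<Sum>\<nu>=2..n. \<Sum>j\<in>UNIV. ?q \<nu> j x * ?e x)
      = (\<Sum>\<nu>=2..n. integral {0..1} (\<lambda>x. \<Sum>j\<in>UNIV. ?q \<nu> j x * ?e x))"
    by (intro integral_sum integrable_sum int_q) auto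
  also have "\<dots> = (\<Sum>\<nu>=2..n. \<Sum>j\<in>UNIV. fourier_coeff (?q \<nu> j) p)"
    unfolding fourier_coeff_def by (intro sum.cong refl integral_sum int_q) auto
  finally show ?thesis by (simp add: algebra_simps)
qed

lemma coefficient_bound:
  assumes y: "y \<in> eigenspace n P l" and \<kappa>: "1 \<le> \<kappa>" and A: "0 \<le> A"
    and bound: "\<And>\<nu> x. \<nu> \<le> n - 2 \<Longrightarrow> x \<in> {0..1} \<Longrightarrow> norm (deriv01 \<nu> y x) \<le> A * \<kappa> ^ \<nu>"
  shows "norm (l - freq p ^ n) * norm (fourier_vec y p $ i) \<le> total_mass * A * \<kappa> ^ (n - 2)"
proof -
  have "norm (l - freq p ^ n) * norm (fourier_vec y p $ i)
      = norm (\<Sum>\<nu>=2..n. \<Sum>j\<in>UNIV. fourier_coeff (\<lambda>x. P \<nu> x $ i $ j * deriv01 (n - \<nu>) y x $ j) p)"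
    unfolding eigenfunction_fourier_coeff[OF y, symmetric] by (simp add: norm_mult)
  also have "\<dots> \<le> (\<Sum>\<nu>=2..n. \<Sum>j\<in>UNIV. (A * \<kappa> ^ (n - 2)) * integral {0..1} (\<lambda>x. norm (P \<nu> x $ i $ j)))"
  proof (intro sum_norm_le fourier_coeff_product_bound)
    fix \<nu> j assume \<nu>: "\<nu> \<in> {2..n}"
    show "(\<lambda>x. P \<nu> x $ i $ j) absolutely_integrable_on {0..1}" using \<nu> by (intro summable_P) auto
    show "continuous_on {0..1} (\<lambda>x. deriv01 (n - \<nu>) y x $ j)"
      using \<nu> by (intro component_continuous[OF y]) auto
    fix x :: real assume x: "x \<in> {0..1}"
    have "norm (deriv01 (n - \<nu>) y x $ j) \<le> norm (deriv01 (n - \<nu>) y x)" by (rule Finite_Cartesian_Product.norm_nth_le)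
    also have "\<dots> \<le> A * \<kappa> ^ (n - \<nu>)" using \<nu> x by (intro bound) auto
    also have "\<dots> \<le> A * \<kappa> ^ (n - 2)" using \<nu> \<kappa> A by (intro mult_left_mono power_increasing) auto
    finally show "norm (deriv01 (n - \<nu>) y x $ j) \<le> A * \<kappa> ^ (n - 2)" .
  qed
  also have "\<dots> = (A * \<kappa> ^ (n - 2)) * (\<Sum>\<nu>=2..n. \<Sum>j\<in>UNIV. integral {0..1} (\<lambda>x. norm (P \<nu> x $ i $ j)))"
    by (simp add: sum_distrib_left)
  also have "\<dots> \<le> (A * \<kappa> ^ (n - 2)) * total_mass"
    using row_mass_le A \<kappa> by (intro mult_left_mono) auto
  finally show ?thesis by (simp add: mult_ac)
qed

text \<open>Distinct values of \<open>|p|\<^sup>n\<close> and \<open>|k|\<^sup>n\<close> differ by at least \<open>|k|\<^sup>n\<^sup>-\<^sup>1\<close>, while \<open>l\<close> is displaced from \<open>freq k ^ n\<close> by \<open>c |k|\<^sup>n\<^sup>-\<^sup>2\<close>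
  only.\<close>

lemma spectral_gap:
  assumes l: "norm (l - freq k ^ n) \<le> c * real_of_int \<bar>k\<bar> ^ (n - 2)" and k: "1 \<le> \<bar>k\<bar>" "2 * c \<le> real_of_int \<bar>k\<bar>"
    and p: "\<bar>p\<bar> \<noteq> \<bar>k\<bar>"
  shows "\<bar>real_of_int \<bar>k\<bar> ^ n - real_of_int \<bar>p\<bar> ^ n\<bar> / 2 \<le> norm (l - freq p ^ n)"
    and "0 < \<bar>real_of_int \<bar>k\<bar> ^ n - real_of_int \<bar>p\<bar> ^ n\<bar>"
proof -
  define \<kappa> where "\<kappa> = real_of_int \<bar>k\<bar>"
  define r where "r = real_of_int \<bar>p\<bar>"
  define D where "D = \<bar>\<kappa> ^ n - r ^ n\<bar>"
  have \<kappa>1: "1 \<le> \<kappa>" using k unfolding \<kappa>_def by linarith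
  have one: "1 \<le> \<bar>\<kappa> - r\<bar>" using p unfolding \<kappa>_def r_def by linarith
  have pw: "\<kappa> ^ (n - 1) \<le> D"
  proof -
    have "1 * \<kappa> ^ (n - 1) \<le> \<bar>\<kappa> - r\<bar> * max \<kappa> r ^ (n - 1)"
      using one \<kappa>1 by (intro mult_mono power_mono) auto
    also have "\<dots> \<le> D" unfolding D_def
      using n2 by (intro power_diff_abs_ge) (auto simp: \<kappa>_def r_def)
    finally show ?thesis by simp
  qed
  have even_pow: "real_of_int q ^ n = real_of_int \<bar>q\<bar> ^ n" for q
    using n_even by (simp add: power_even_abs)
  have "freq k ^ n - freq p ^ n = (2 * complex_of_real pi * \<i>) ^ n * of_real (\<kappa> ^ n - r ^ n)"
    unfolding \<kappa>_def r_def even_pow[symmetric] freq_def by (simp add: power_mult_distrib algebra_simps)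
  then have "norm (freq k ^ n - freq p ^ n) = (2 * pi) ^ n * D"
    unfolding D_def by (simp only: norm_mult norm_power norm_of_real) simp
  moreover have "1 * D \<le> (2 * pi) ^ n * D"
    using pi_gt3 by (intro mult_right_mono one_le_power) (auto simp: D_def)
  moreover have "norm (l - freq k ^ n) \<le> D / 2"
  proof -
    have "norm (l - freq k ^ n) \<le> c * \<kappa> ^ (n - 2)" using l unfolding \<kappa>_def .
    also have "\<dots> \<le> (\<kappa> / 2) * \<kappa> ^ (n - 2)" using k \<kappa>1 by (intro mult_right_mono) (auto simp: \<kappa>_def)
    also have "\<dots> = \<kappa> ^ (n - 1) / 2"
    proof -
      have "n - 1 = Suc (n - 2)" using n2 by simp
      then show ?thesis by simp
    qed
    finally show ?thesis using pw by simp
  qed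
  moreover have "norm (freq k ^ n - freq p ^ n) \<le> norm (l - freq k ^ n) + norm (l - freq p ^ n)"
    using norm_triangle_ineq4[of "l - freq p ^ n" "l - freq k ^ n"] by simp
  ultimately show "\<bar>real_of_int \<bar>k\<bar> ^ n - real_of_int \<bar>p\<bar> ^ n\<bar> / 2 \<le> norm (l - freq p ^ n)"
    unfolding D_def \<kappa>_def r_def by linarith
  have "0 < \<kappa> ^ (n - 1)" using \<kappa>1 by simp
  then show "0 < \<bar>real_of_int \<bar>k\<bar> ^ n - real_of_int \<bar>p\<bar> ^ n\<bar>"
    using pw unfolding D_def \<kappa>_def r_def by linarith
qed

text \<open>If \<open>A\<close> measures the size of the derivatives of \<open>y\<close> in their natural scale, then by \<open>coefficient_bound\<close> and
  \<open>spectral_gap\<close> every nonresonant coefficient is at most a multiple of \<open>A\<close> divided by the gap, and \<open>resonance_sum\<close>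
  adds them up. The error is proportional to \<open>A\<close> but carries an extra factor \<open>ln k / k\<close>; this gain is what
  \<open>derivative_bound\<close> turns into a bound for \<open>A\<close> itself.\<close>

lemma resonant_approximation:
  assumes y: "y \<in> eigenspace n P l"
    and l: "norm (l - freq k ^ n) \<le> c * real_of_int \<bar>k\<bar> ^ (n - 2)" and k: "1 \<le> \<bar>k\<bar>" "2 * c \<le> real_of_int \<bar>k\<bar>"
    and A: "0 \<le> A"
    and bound: "\<And>\<nu> x. \<nu> \<le> n - 2 \<Longrightarrow> x \<in> {0..1} \<Longrightarrow> norm (deriv01 \<nu> y x) \<le> A * real_of_int \<bar>k\<bar> ^ \<nu>"
    and \<nu>: "\<nu> \<le> n - 2" and x: "x \<in> {0..1}"
  shows "norm (deriv01 \<nu> y x $ i - (\<Sum>p\<in>{k, - k}. freq p ^ \<nu> * fourier_vec y p $ i * exp (freq p * of_real x)))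
    \<le> 8 * (2 * pi) ^ n * total_mass * A * ((ln (real_of_int \<bar>k\<bar>) + 1) / real_of_int \<bar>k\<bar>) * real_of_int \<bar>k\<bar> ^ \<nu>"
proof -
  interpret y: domain_function n P y by (rule domain_function[OF y])
  define \<kappa> where "\<kappa> = real_of_int \<bar>k\<bar>"
  define K where "K = nat \<bar>k\<bar>"
  have K: "real K = \<kappa>" "1 \<le> K" "int K = \<bar>k\<bar>" using k unfolding K_def \<kappa>_def by auto
  have \<kappa>1: "1 \<le> \<kappa>" using K by linarith
  define B where "B = 8 * (2 * pi) ^ n * total_mass * A * ((ln \<kappa> + 1) / \<kappa>) * \<kappa> ^ \<nu>"
  have fc: "fourier_coeff (\<lambda>x. deriv01 \<nu> y x $ i) p = freq p ^ \<nu> * fourier_vec y p $ i" for p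
    using y.fourier_coeff_deriv[of \<nu> i p] \<nu> by (simp add: fourier_vec_def)
  have "norm (deriv01 \<nu> y x $ i
      - (\<Sum>p\<in>{k, - k}. fourier_coeff (\<lambda>x. deriv01 \<nu> y x $ i) p * exp (freq p * of_real x))) \<le> B"
  proof (rule fourier_series_error[OF _ _ _ _ x])
    show "continuous_on {0..1} (\<lambda>x. deriv01 \<nu> y x $ i)"
      using \<nu> n2 by (intro component_continuous[OF y]) auto
    show "deriv01 \<nu> y 0 $ i = deriv01 \<nu> y 1 $ i" using y.periodic[of \<nu>] \<nu> n2 by simp
    fix F :: "int set" assume F: "finite F" "F \<inter> {k, - k} = {}"
    have ne: "\<bar>p\<bar> \<noteq> \<bar>k\<bar>" if "p \<in> F" for p using F(2) that by (auto simp: abs_eq_iff)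
    let ?w = "2 * total_mass * A * \<kappa> ^ (n - 2)"
    have w0: "0 \<le> ?w" using total_mass_nonneg A \<kappa>1 by simp
    have each: "norm (fourier_coeff (\<lambda>x. deriv01 \<nu> y x $ i) p)
        \<le> ((2 * pi) ^ n * ?w) * (real_of_int \<bar>p\<bar> ^ \<nu> / \<bar>\<kappa> ^ n - real_of_int \<bar>p\<bar> ^ n\<bar>)" if p: "p \<in> F" for p
    proof -
      define D where "D = \<bar>\<kappa> ^ n - real_of_int \<bar>p\<bar> ^ n\<bar>"
      have D: "D > 0" "D / 2 \<le> norm (l - freq p ^ n)"
        using spectral_gap[OF l k ne[OF p]] unfolding D_def \<kappa>_def by auto
      have "D / 2 * norm (fourier_vec y p $ i) \<le> norm (l - freq p ^ n) * norm (fourier_vec y p $ i)"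
        using D by (intro mult_right_mono) auto
      also have "\<dots> \<le> total_mass * A * \<kappa> ^ (n - 2)"
        by (rule coefficient_bound[OF y \<kappa>1 A]) (use bound in \<open>simp add: \<kappa>_def\<close>)
      finally have c1: "norm (fourier_vec y p $ i) \<le> ?w / D" using D(1) by (simp add: field_simps)
      have "norm (fourier_coeff (\<lambda>x. deriv01 \<nu> y x $ i) p)
          = (2 * pi) ^ \<nu> * real_of_int \<bar>p\<bar> ^ \<nu> * norm (fourier_vec y p $ i)"
        unfolding fc by (simp add: norm_mult norm_power norm_freq power_mult_distrib)
      also have "\<dots> \<le> (2 * pi) ^ n * real_of_int \<bar>p\<bar> ^ \<nu> * (?w / D)"
      proof (intro mult_mono c1)
        show "(2 * pi) ^ \<nu> \<le> (2 * pi) ^ n" using \<nu> pi_gt3 by (intro power_increasing) auto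
      qed auto
      finally show ?thesis unfolding D_def by (simp add: mult_ac)
    qed
    have "(\<Sum>p\<in>F. norm (fourier_coeff (\<lambda>x. deriv01 \<nu> y x $ i) p))
        \<le> (\<Sum>p\<in>F. ((2 * pi) ^ n * ?w) * (real_of_int \<bar>p\<bar> ^ \<nu> / \<bar>\<kappa> ^ n - real_of_int \<bar>p\<bar> ^ n\<bar>))"
      by (intro sum_mono each)
    also have "\<dots> = ((2 * pi) ^ n * ?w) * (\<Sum>p\<in>F. real_of_int \<bar>p\<bar> ^ \<nu> / \<bar>real K ^ n - real_of_int \<bar>p\<bar> ^ n\<bar>)"
      unfolding K(1) by (simp only: sum_distrib_left)
    also have "\<dots> \<le> ((2 * pi) ^ n * ?w) * (4 * (ln (real K) + 1) / real K ^ (n - 1 - \<nu>))"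
    proof (rule mult_left_mono[OF resonance_sum])
      show "0 \<le> (2 * pi) ^ n * ?w" by (rule mult_nonneg_nonneg[OF _ w0]) simp
      show "\<nu> + 2 \<le> n" using \<nu> n2 by simp
    qed (use K F ne in auto)
    also have "\<dots> = B"
    proof -
      have "n - 1 - \<nu> = Suc (n - 2 - \<nu>)" using \<nu> n2 by simp
      then have p1: "\<kappa> ^ (n - 1 - \<nu>) = \<kappa> * \<kappa> ^ (n - 2 - \<nu>)" by (simp only: power_Suc)
      have p2: "\<kappa> ^ (n - 2) = \<kappa> ^ \<nu> * \<kappa> ^ (n - 2 - \<nu>)" using \<nu> by (metis le_add_diff_inverse power_add)
      have "\<kappa> ^ (n - 2) / \<kappa> ^ (n - 1 - \<nu>) = \<kappa> ^ \<nu> / \<kappa>"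
        unfolding p1 p2 using \<kappa>1 by simp
      then have "\<kappa> ^ (n - 2) * (1 / \<kappa> ^ (n - 1 - \<nu>)) = \<kappa> ^ \<nu> / \<kappa>" by simp
      then have e: "\<kappa> ^ (n - 2) * (X / \<kappa> ^ (n - 1 - \<nu>)) = X * (\<kappa> ^ \<nu> / \<kappa>)" for X
        by (metis mult.left_commute times_divide_eq_right mult_1_right)
      have "((2 * pi) ^ n * ?w) * (4 * (ln \<kappa> + 1) / \<kappa> ^ (n - 1 - \<nu>))
          = ((2 * pi) ^ n * (2 * total_mass * A)) * (\<kappa> ^ (n - 2) * ((4 * (ln \<kappa> + 1)) / \<kappa> ^ (n - 1 - \<nu>)))"
        by simp
      also have "\<dots> = B" unfolding e B_def by simp
      finally show ?thesis unfolding K(1) .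
    qed
    finally show "(\<Sum>p\<in>F. norm (fourier_coeff (\<lambda>x. deriv01 \<nu> y x $ i) p)) \<le> B" .
  qed simp
  then show ?thesis unfolding B_def \<kappa>_def fc .
qed

end

section \<open>A priori bounds for normalized eigenfunctions\<close>

lemma log_ratio_bounds:
  assumes "3 \<le> \<bar>k\<bar>"
  shows "(ln (real_of_int \<bar>k\<bar>) + 1) / real_of_int \<bar>k\<bar> \<le> 2 * log_ratio k" "0 < log_ratio k"
proof -
  have k: "real_of_int \<bar>k\<bar> \<ge> 3" using assms by linarith
  have "exp 1 \<le> real_of_int \<bar>k\<bar>" using exp_le k by linarith
  then have "1 \<le> ln (real_of_int \<bar>k\<bar>)" using k by (subst ln_ge_iff) auto
  then show "(ln (real_of_int \<bar>k\<bar>) + 1) / real_of_int \<bar>k\<bar> \<le> 2 * log_ratio k" "0 < log_ratio k"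
    using k unfolding log_ratio_def by (auto simp: divide_simps)
qed

lemma log_ratio_small:
  assumes "\<eta> > 0"
  obtains K where "\<And>k. K \<le> \<bar>k\<bar> \<Longrightarrow> log_ratio k \<le> \<eta>"
proof -
  have "\<forall>\<^sub>F x::real in at_top. ln x / x < \<eta>"
    using ln_x_over_x_tendsto_0 assms by (rule order_tendstoD(2))
  then obtain X where X: "\<And>x::real. X \<le> x \<Longrightarrow> ln x / x < \<eta>" by (auto simp: eventually_at_top_linorder)
  show thesis
  proof (rule that[of "\<lceil>X\<rceil>"])
    fix k :: int assume "\<lceil>X\<rceil> \<le> \<bar>k\<bar>"
    then have "X \<le> real_of_int \<bar>k\<bar>" by linarith
    then show "log_ratio k \<le> \<eta>" using X unfolding log_ratio_def by fastforce
  qed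
qed

lemma L2_norm_1_integral:
  assumes y: "continuous_on {0..1} y" and "L2_norm y = 1"
  shows "integral {0..1} (\<lambda>x. (norm (y x))\<^sup>2) = 1" "integral {0..1} (\<lambda>x. norm (y x)) \<le> 1"
proof -
  show 1: "integral {0..1} (\<lambda>x. (norm (y x))\<^sup>2) = 1" using assms(2) unfolding L2_norm_def by simp
  have "integral {0..1} (\<lambda>x. norm (y x)) \<le> integral {0..1} (\<lambda>x. (1 + (norm (y x))\<^sup>2) / 2)"
  proof (rule integral_le)
    fix x
    have "0 \<le> (norm (y x) - 1)\<^sup>2" by simp
    then show "norm (y x) \<le> (1 + (norm (y x))\<^sup>2) / 2" by (simp add: power2_eq_square algebra_simps)
  qed (intro integrable_continuous_real continuous_intros y | simp)+
  also have "\<dots> = (integral {0..1} (\<lambda>x::real. 1::real) + integral {0..1} (\<lambda>x. (norm (y x))\<^sup>2)) / 2"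
    unfolding integral_divide
    by (subst integral_add) (intro integrable_continuous_real continuous_intros y | simp)+
  also have "\<dots> = 1" using 1 by simp
  finally show "integral {0..1} (\<lambda>x. norm (y x)) \<le> 1" .
qed

lemma fourier_vec_le_1:
  assumes y: "continuous_on {0..1} y" and "L2_norm y = 1"
  shows "norm (fourier_vec y p $ i) \<le> 1"
proof -
  have ci: "continuous_on {0..1} (\<lambda>x. y x $ i)" by (intro continuous_on_component y)
  have "norm (fourier_vec y p $ i) \<le> integral {0..1} (\<lambda>x. norm (y x))"
    unfolding fourier_vec_def fourier_coeff_def vec_lambda_beta
  proof (rule integral_norm_bound_integral)
    have "continuous_on {0..1} (\<lambda>x::real. exp (- freq p * complex_of_real x))" by (intro continuous_intros)
    then show "(\<lambda>x. y x $ i * exp (- freq p * complex_of_real x)) integrable_on {0..1}"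
      by (intro integrable_continuous_real continuous_on_mult ci)
    show "norm (y x $ i * exp (- freq p * complex_of_real x)) \<le> norm (y x)" for x
      using Finite_Cartesian_Product.norm_nth_le[of "y x" i] by (simp only: norm_mult norm_exp_freq mult_1_right)
  qed (intro integrable_continuous_real continuous_intros y)
  then show ?thesis using L2_norm_1_integral(2)[OF assms] by linarith
qed

lemma fourier_coeff_shift:
  "fourier_coeff (\<lambda>x. h x * exp (freq q * of_real x)) p = fourier_coeff h (p - q)"
proof -
  have "h x * exp (freq q * of_real x) * exp (- freq p * of_real x) = h x * exp (- freq (p - q) * of_real x)"
    for x :: real
    by (simp add: freq_def ring_distribs flip: exp_add)
  then show ?thesis unfolding fourier_coeff_def by (simp only:)
qed

lemma fourier_coeff_cmult: "fourier_coeff (\<lambda>x. c * h x) p = c * fourier_coeff h p"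
  unfolding fourier_coeff_def by (simp add: mult.assoc)

lemma fourier_coeff_add:
  assumes "f absolutely_integrable_on {0..1}" "g absolutely_integrable_on {0..1}"
  shows "fourier_coeff (\<lambda>x. f x + g x) p = fourier_coeff f p + fourier_coeff g p"
proof -
  have ce: "continuous_on {0..1} (\<lambda>x::real. exp (- freq p * complex_of_real x))" by (intro continuous_intros)
  show ?thesis
    unfolding fourier_coeff_def distrib_right
    using integrable_times_continuous[OF assms(1) ce] integrable_times_continuous[OF assms(2) ce]
    by (intro integral_add) (auto simp: absolutely_integrable_on_def)
qed

context summable_operator
begin

text \<open>Let \<open>A\<close> be the largest of the quotients \<open>|y\<^sup>(\<^sup>\<nu>\<^sup>)(x)| / |k|\<^sup>\<nu>\<close>. Up to an error of at most \<open>A / 2\<close>, each quotient comes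
  from the two resonant coefficients, which are at most \<open>1\<close> since \<open>y\<close> is normalized. So \<open>A\<close> is at most a constant plus
  \<open>A / 2\<close>, and can be absorbed.\<close>

lemma derivative_bound:
  fixes y :: "real \<Rightarrow> complex^'m"
  assumes y: "y \<in> eigenspace n P l" "L2_norm y = 1"
    and l: "norm (l - freq k ^ n) \<le> c * real_of_int \<bar>k\<bar> ^ (n - 2)" and k: "1 \<le> \<bar>k\<bar>" "2 * c \<le> real_of_int \<bar>k\<bar>"
    and small: "real CARD('m) * (8 * (2 * pi) ^ n * total_mass * ((ln (real_of_int \<bar>k\<bar>) + 1) / real_of_int \<bar>k\<bar>)) \<le> 1 / 2"
    and \<nu>: "\<nu> \<le> n - 2" and x: "x \<in> {0..1}"
  shows "norm (deriv01 \<nu> y x) \<le> 4 * real CARD('m) * (2 * pi) ^ n * real_of_int \<bar>k\<bar> ^ \<nu>"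
proof -
  interpret y: domain_function n P y by (rule domain_function[OF y(1)])
  define \<kappa> where "\<kappa> = real_of_int \<bar>k\<bar>"
  have \<kappa>1: "1 \<le> \<kappa>" using k unfolding \<kappa>_def by linarith
  define t where "t = (\<lambda>\<nu> x. norm (deriv01 \<nu> y x) / \<kappa> ^ \<nu>)"
  define T where "T = (\<Union>\<nu>\<in>{..n - 2}. t \<nu> ` {0..1})"
  define A where "A = Sup T"
  have "compact T"
    unfolding T_def
  proof (intro compact_UN compact_continuous_image)
    fix \<nu> assume "\<nu> \<in> {..n - 2}"
    then show "continuous_on {0..1} (t \<nu>)"
      unfolding t_def using \<kappa>1 n2 by (intro continuous_intros y.continuous_deriv) auto
  qed auto
  then have bdd: "bdd_above T" by (intro bounded_imp_bdd_above compact_imp_bounded)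
  have le_A: "t \<nu> x \<le> A" if "\<nu> \<le> n - 2" "x \<in> {0..1}" for \<nu> x
  proof -
    have "t \<nu> x \<in> T" unfolding T_def using that by (intro UN_I[of \<nu>] imageI) auto
    then show ?thesis unfolding A_def by (rule cSup_upper[OF _ bdd])
  qed
  have A0: "0 \<le> A" 
  proof -
    have "0 \<le> t \<nu> x" unfolding t_def using \<kappa>1 by simp
    then show ?thesis using le_A[OF \<nu> x] by linarith
  qed
  have bound: "norm (deriv01 \<nu> y x) \<le> A * \<kappa> ^ \<nu>" if "\<nu> \<le> n - 2" "x \<in> {0..1}" for \<nu> x
    using le_A[OF that] \<kappa>1 unfolding t_def by (simp add: field_simps)
  define D where "D = 8 * (2 * pi) ^ n * total_mass * ((ln \<kappa> + 1) / \<kappa>)"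
  \<comment> \<open>The error in \<open>resonant_approximation\<close> is \<open>D A\<close>, and \<open>D\<close> times the number of components is at most \<open>1 / 2\<close>.\<close>
  have improved: "t \<nu> x \<le> 2 * real CARD('m) * (2 * pi) ^ n + A / 2" if \<nu>x: "\<nu> \<le> n - 2" "x \<in> {0..1}" for \<nu> x
  proof -
    have comp: "norm (deriv01 \<nu> y x $ i) \<le> 2 * (2 * pi) ^ n * \<kappa> ^ \<nu> + D * A * \<kappa> ^ \<nu>" for i
    proof -
      let ?M = "\<Sum>p\<in>{k, - k}. freq p ^ \<nu> * fourier_vec y p $ i * exp (freq p * complex_of_real x)"
      have "norm (deriv01 \<nu> y x $ i - ?M)
          \<le> 8 * (2 * pi) ^ n * total_mass * A * ((ln \<kappa> + 1) / \<kappa>) * \<kappa> ^ \<nu>"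
        unfolding \<kappa>_def using bound unfolding \<kappa>_def
        by (intro resonant_approximation[OF y(1) l k A0] \<nu>x) auto
      also have "\<dots> = D * A * \<kappa> ^ \<nu>" unfolding D_def by simp
      finally have 1: "norm (deriv01 \<nu> y x $ i - ?M) \<le> D * A * \<kappa> ^ \<nu>" .
      have "norm ?M \<le> real (card {k, - k}) * ((2 * pi) ^ n * \<kappa> ^ \<nu>)"
      proof (rule sum_norm_bound)
        fix p assume p: "p \<in> {k, - k}"
        have "norm (freq p ^ \<nu> * fourier_vec y p $ i * exp (freq p * complex_of_real x))
            = (2 * pi) ^ \<nu> * \<kappa> ^ \<nu> * norm (fourier_vec y p $ i)"
          using p by (auto simp: norm_mult norm_power norm_freq power_mult_distrib \<kappa>_def)
        also have "\<dots> \<le> ((2 * pi) ^ n * \<kappa> ^ \<nu>) * 1"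
        proof (intro mult_mono)
          show "(2 * pi) ^ \<nu> \<le> (2 * pi) ^ n" using \<nu>x pi_gt3 by (intro power_increasing) auto
          show "norm (fourier_vec y p $ i) \<le> 1"
            using y.continuous_deriv[of 0] n2 by (intro fourier_vec_le_1 y(2)) auto
        qed (use \<kappa>1 in auto)
        finally show "norm (freq p ^ \<nu> * fourier_vec y p $ i * exp (freq p * complex_of_real x))
            \<le> (2 * pi) ^ n * \<kappa> ^ \<nu>" by simp
      qed
      also have "\<dots> \<le> 2 * ((2 * pi) ^ n * \<kappa> ^ \<nu>)"
        using \<kappa>1 card_insert_le_m1[of 2 "{- k}" k] by (intro mult_right_mono) auto
      finally have "norm ?M \<le> 2 * (2 * pi) ^ n * \<kappa> ^ \<nu>" by simp
      then show ?thesis using 1 norm_triangle_sub[of "deriv01 \<nu> y x $ i" ?M] by linarith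
    qed
    have "norm (deriv01 \<nu> y x) \<le> (\<Sum>i\<in>UNIV. norm (deriv01 \<nu> y x $ i))" by (rule norm_le_sum_components)
    also have "\<dots> \<le> real CARD('m) * (2 * (2 * pi) ^ n * \<kappa> ^ \<nu> + D * A * \<kappa> ^ \<nu>)"
      by (rule sum_bounded_above) (rule comp)
    also have "\<dots> = (2 * real CARD('m) * (2 * pi) ^ n + (real CARD('m) * D) * A) * \<kappa> ^ \<nu>"
      by (simp add: algebra_simps)
    also have "\<dots> \<le> (2 * real CARD('m) * (2 * pi) ^ n + 1 / 2 * A) * \<kappa> ^ \<nu>"
      using small A0 \<kappa>1 unfolding D_def \<kappa>_def[symmetric]
      by (intro mult_right_mono add_left_mono) auto
    finally show ?thesis unfolding t_def using \<kappa>1 by (simp add: field_simps)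
  qed
  have "A \<le> 2 * real CARD('m) * (2 * pi) ^ n + A / 2"
    unfolding A_def
  proof (rule cSup_least)
    show "T \<noteq> {}" unfolding T_def by auto
    show "z \<le> 2 * real CARD('m) * (2 * pi) ^ n + Sup T / 2" if "z \<in> T" for z
      using that improved unfolding T_def A_def by auto
  qed
  then have "A \<le> 4 * real CARD('m) * (2 * pi) ^ n" by simp
  then have "A * \<kappa> ^ \<nu> \<le> 4 * real CARD('m) * (2 * pi) ^ n * \<kappa> ^ \<nu>" using \<kappa>1 by (intro mult_right_mono) auto
  then show ?thesis using bound[OF \<nu> x] unfolding \<kappa>_def by linarith
qed

end

section \<open>The resonant system\<close>

lemma cdot_add: "cdot (a + b) w = cdot a w + cdot b w"
  by (simp add: cdot_def sum.distrib distrib_right)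

lemma cdot_scale: "cdot (c *s a) w = c * cdot a w"
  by (simp add: cdot_def sum_distrib_left mult.assoc)

lemma cdot_sum: "cdot (\<Sum>q\<in>A. f q) w = (\<Sum>q\<in>A. cdot (f q) w)"
proof (induction A rule: infinite_finite_induct)
  case (insert x A)
  then show ?case by (simp add: cdot_add)
qed (simp_all add: cdot_def)

lemma cdot_scale_right: "cdot a (c *s w) = cnj c * cdot a w"
  by (simp add: cdot_def sum_distrib_left mult_ac)

lemma cdot_adjoint: "cdot (A *v a) w = cdot a (adjoint_matrix A *v w)"
proof -
  have "cdot (A *v a) w = (\<Sum>i\<in>UNIV. \<Sum>j\<in>UNIV. A $ i $ j * a $ j * cnj (w $ i))"
    by (simp add: cdot_def matrix_vector_mult_def sum_distrib_right)
  also have "\<dots> = (\<Sum>j\<in>UNIV. \<Sum>i\<in>UNIV. A $ i $ j * a $ j * cnj (w $ i))" by (rule sum.swap)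
  also have "\<dots> = cdot a (adjoint_matrix A *v w)"
    by (simp add: cdot_def matrix_vector_mult_def adjoint_matrix_def sum_distrib_left mult_ac)
  finally show ?thesis .
qed

lemma norm_cdot_le: "norm (cdot a w) \<le> (\<Sum>i\<in>UNIV. norm (a $ i) * norm (w $ i))"
  unfolding cdot_def by (rule sum_norm_le) (simp add: norm_mult)

text \<open>Eigenvectors of \<open>C\<close> and of its adjoint for different eigenvalues are orthogonal, so the matrix with rows \<open>w\<close>
  (conjugated) is a left inverse of the matrix with columns \<open>v\<close>, hence also a right inverse.\<close>

lemma biorthogonal_expansion:
  fixes C :: "complex^'m^'m" and v w :: "'m \<Rightarrow> complex^'m"
  assumes "inj \<mu>" and v: "\<And>j. C *v v j = \<mu> j *s v j"
    and w: "\<And>j. adjoint_matrix C *v w j = cnj (\<mu> j) *s w j" "\<And>j. cdot (w j) (v j) = 1"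
  shows "a = (\<Sum>q\<in>UNIV. cdot a (w q) *s v q)"
proof -
  have bi: "cdot (v q) (w s) = (if q = s then 1 else 0)" for q s
  proof (cases "q = s")
    case True
    have "cdot (v s) (w s) = cnj (cdot (w s) (v s))" by (simp add: cdot_def mult.commute)
    then show ?thesis using w(2) True by simp
  next
    case False
    have "\<mu> q * cdot (v q) (w s) = cdot (C *v v q) (w s)" by (simp add: v cdot_scale)
    also have "\<dots> = \<mu> s * cdot (v q) (w s)" by (simp add: cdot_adjoint w(1) cdot_scale_right)
    finally have "cdot (v q) (w s) = 0 \<or> \<mu> q = \<mu> s" by simp
    then show ?thesis using False \<open>inj \<mu>\<close> by (auto dest: injD)
  qed
  define V :: "complex^'m^'m" where "V = (\<chi> i j. v j $ i)"
  define W :: "complex^'m^'m" where "W = (\<chi> i j. cnj (w i $ j))"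
  have "W ** V = mat 1"
    unfolding vec_eq_iff
  proof (intro allI)
    fix s q
    have "(W ** V) $ s $ q = cdot (v q) (w s)"
      by (simp add: matrix_matrix_mult_def V_def W_def cdot_def mult.commute)
    then show "(W ** V) $ s $ q = mat 1 $ s $ q" by (simp add: bi mat_def)
  qed
  then have "V ** W = mat 1" by (simp add: matrix_left_right_inverse)
  then have "a = V *v (W *v a)" by (simp add: matrix_vector_mul_assoc)
  also have "\<dots> = (\<Sum>q\<in>UNIV. cdot a (w q) *s v q)"
    by (simp add: vec_eq_iff matrix_vector_mult_def V_def W_def cdot_def mult_ac)
  finally show ?thesis .
qed

definition fourier_matrix :: "(real \<Rightarrow> complex^'m^'m) \<Rightarrow> int \<Rightarrow> complex^'m^'m" where
  "fourier_matrix Q r = (\<chi> i j. fourier_coeff (\<lambda>x. Q x $ i $ j) r)"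

lemma cdot_fourier_matrix:
  assumes "\<And>i j. (\<lambda>x. Q x $ i $ j) absolutely_integrable_on {0..1}"
  shows "cdot (fourier_matrix Q r *v v q) (w s) = coeff_b Q v w s q r"
proof -
  let ?e = "\<lambda>x::real. exp (- freq r * of_real x)"
  have ce: "continuous_on {0..1} ?e" by (intro continuous_intros)
  have int: "(\<lambda>x. Q x $ i $ j * ?e x) integrable_on {0..1}" for i j
    using integrable_times_continuous[OF assms ce] by (auto simp: absolutely_integrable_on_def)
  have int': "(\<lambda>x. (v q $ j * cnj (w s $ i)) * (Q x $ i $ j * ?e x)) integrable_on {0..1}" for i j
    by (intro integrable_on_mult_right int)
  have "coeff_b Q v w s q r
      = integral {0..1} (\<lambda>x. \<Sum>i\<in>UNIV. \<Sum>j\<in>UNIV. (v q $ j * cnj (w s $ i)) * (Q x $ i $ j * ?e x))"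
    unfolding coeff_b_def cdot_def matrix_vector_mult_def
    by (simp add: sum_distrib_right sum_distrib_left mult_ac)
  also have "\<dots> = (\<Sum>i\<in>UNIV. integral {0..1} (\<lambda>x. \<Sum>j\<in>UNIV. (v q $ j * cnj (w s $ i)) * (Q x $ i $ j * ?e x)))"
    by (intro integral_sum integrable_sum int') auto
  also have "\<dots> = (\<Sum>i\<in>UNIV. \<Sum>j\<in>UNIV. integral {0..1} (\<lambda>x. (v q $ j * cnj (w s $ i)) * (Q x $ i $ j * ?e x)))"
    by (intro sum.cong refl integral_sum int') auto
  also have "\<dots> = (\<Sum>i\<in>UNIV. \<Sum>j\<in>UNIV. (v q $ j * cnj (w s $ i)) * fourier_coeff (\<lambda>x. Q x $ i $ j) r)"
    by (simp add: fourier_coeff_def)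
  also have "\<dots> = cdot (fourier_matrix Q r *v v q) (w s)"
    unfolding cdot_def matrix_vector_mult_def fourier_matrix_def
    by (simp add: sum_distrib_right sum_distrib_left mult_ac)
  finally show ?thesis by simp
qed

context summable_operator
begin

text \<open>In the equation for the coefficient at \<open>p\<close>, the terms with \<open>\<nu> \<ge> 3\<close> contain derivatives of order at most \<open>n - 3\<close> and
  lose a factor \<open>1 / |k|\<close>. In the term with \<open>\<nu> = 2\<close>, the derivative \<open>y\<^sup>(\<^sup>n\<^sup>-\<^sup>2\<^sup>)\<close> is replaced by its two resonant modes. The
  mode at \<open>p\<close> then meets the mean of \<open>P 2\<close>, the mode at \<open>- p\<close> its coefficient of frequency \<open>2 p\<close>.\<close>

lemma resonant_coefficients:
  fixes y :: "real \<Rightarrow> complex^'m"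
  assumes y: "y \<in> eigenspace n P l" "L2_norm y = 1"
    and l: "norm (l - freq k ^ n) \<le> c * real_of_int \<bar>k\<bar> ^ (n - 2)" and k: "1 \<le> \<bar>k\<bar>" "2 * c \<le> real_of_int \<bar>k\<bar>"
    and small: "real CARD('m) * (8 * (2 * pi) ^ n * total_mass * ((ln (real_of_int \<bar>k\<bar>) + 1) / real_of_int \<bar>k\<bar>)) \<le> 1 / 2"
    and p: "p \<in> {k, - k}"
  defines "A \<equiv> 4 * real CARD('m) * (2 * pi) ^ n"
  defines "L \<equiv> (ln (real_of_int \<bar>k\<bar>) + 1) / real_of_int \<bar>k\<bar>"
  shows "norm ((l - freq k ^ n) * fourier_vec y p $ i
      - freq k ^ (n - 2) * ((mean_matrix (P 2) *v fourier_vec y p) $ i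
          + (fourier_matrix (P 2) (2 * p) *v fourier_vec y (- p)) $ i))
    \<le> total_mass * (8 * (2 * pi) ^ n * total_mass * A + A) * L * real_of_int \<bar>k\<bar> ^ (n - 2)"
proof -
  define \<kappa> where "\<kappa> = real_of_int \<bar>k\<bar>"
  define D where "D = 8 * (2 * pi) ^ n * total_mass * A"
  have \<kappa>1: "1 \<le> \<kappa>" using k unfolding \<kappa>_def by linarith
  have A0: "0 \<le> A" unfolding A_def by simp
  have D0: "0 \<le> D" unfolding D_def using A0 total_mass_nonneg by simp
  have L\<kappa>: "1 / \<kappa> \<le> L" unfolding L_def \<kappa>_def[symmetric] using \<kappa>1 by (intro divide_right_mono) auto
  then have L0: "0 \<le> L" using \<kappa>1 by (smt (verit) divide_nonneg_nonneg)
  have db: "norm (deriv01 \<nu> y x) \<le> A * \<kappa> ^ \<nu>" if "\<nu> \<le> n - 2" "x \<in> {0..1}" for \<nu> x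
    unfolding A_def \<kappa>_def using derivative_bound[OF y l k small that] by simp
  have even2: "even (n - 2)" using n_even n2 by simp
  define f where "f = (\<lambda>\<nu> j. fourier_coeff (\<lambda>x. P \<nu> x $ i $ j * deriv01 (n - \<nu>) y x $ j) p)"
  define b where "b = (\<lambda>j. freq k ^ (n - 2) * (mean_matrix (P 2) $ i $ j * fourier_vec y p $ j
      + fourier_matrix (P 2) (2 * p) $ i $ j * fourier_vec y (- p) $ j))"
  \<comment> \<open>The main part of the double sum over \<open>\<nu>\<close> and \<open>j\<close> is confined to \<open>\<nu> = 2\<close>.\<close>
  define a where "a = (\<lambda>(\<nu>::nat) j. if \<nu> = 2 then b j else 0)"
  define m where "m = (\<lambda>\<nu> j. integral {0..1} (\<lambda>x. norm (P \<nu> x $ i $ j)))"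
  have each: "norm (f \<nu> j - a \<nu> j) \<le> ((D + A) * L * \<kappa> ^ (n - 2)) * m \<nu> j" if \<nu>: "\<nu> \<in> {2..n}" for \<nu> j
  proof (cases "\<nu> = 2")
    case True
    define h where "h = (\<lambda>x. P 2 x $ i $ j)"
    have h: "h absolutely_integrable_on {0..1}" unfolding h_def using n2 by (intro summable_P) auto
    define e where "e = (\<lambda>q (x::real). exp (freq q * complex_of_real x))"
    have ce: "continuous_on {0..1} (e q)" for q unfolding e_def by (intro continuous_intros)
    define Y where "Y = (\<lambda>x. deriv01 (n - 2) y x $ j)"
    have cY: "continuous_on {0..1} Y" unfolding Y_def using n2 by (intro component_continuous[OF y(1)]) auto
    define c1 where "c1 = freq k ^ (n - 2) * fourier_vec y p $ j"
    define c2 where "c2 = freq k ^ (n - 2) * fourier_vec y (- p) $ j"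
    define r where "r = (\<lambda>x. Y x - (c1 * e p x + c2 * e (- p) x))"
    have cr: "continuous_on {0..1} r" unfolding r_def by (intro continuous_intros cY ce)
    have r: "norm (r x) \<le> (D + A) * L * \<kappa> ^ (n - 2)" if x: "x \<in> {0..1}" for x
    proof -
      have "(\<Sum>q\<in>{k, - k}. freq q ^ (n - 2) * fourier_vec y q $ j * exp (freq q * complex_of_real x))
          = c1 * e p x + c2 * e (- p) x"
      proof -
        have "{k, - k} = {p, - p}" "p \<noteq> - p" using p k by auto
        moreover have "freq p ^ (n - 2) = freq k ^ (n - 2)" "freq (- p) ^ (n - 2) = freq k ^ (n - 2)"
          using p even2 by (auto simp: freq_minus_even_power)
        ultimately show ?thesis unfolding c1_def c2_def e_def by simp
      qed
      moreover have "norm (deriv01 (n - 2) y x $ j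
          - (\<Sum>q\<in>{k, - k}. freq q ^ (n - 2) * fourier_vec y q $ j * exp (freq q * complex_of_real x)))
          \<le> 8 * (2 * pi) ^ n * total_mass * A * ((ln (real_of_int \<bar>k\<bar>) + 1) / real_of_int \<bar>k\<bar>) * real_of_int \<bar>k\<bar> ^ (n - 2)"
        by (rule resonant_approximation[OF y(1) l k A0 _ _ x]) (use db in \<open>auto simp: \<kappa>_def\<close>)
      ultimately have "norm (r x) \<le> D * L * \<kappa> ^ (n - 2)"
        unfolding r_def Y_def D_def L_def \<kappa>_def by simp
      also have "\<dots> \<le> (D + A) * L * \<kappa> ^ (n - 2)"
        using A0 L0 \<kappa>1 by (intro mult_right_mono) auto
      finally show ?thesis .
    qed
    have fc: "f \<nu> j = fourier_coeff (\<lambda>x. h x * r x) p + b j"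
    proof -
      have ai: "(\<lambda>x. h x * g x) absolutely_integrable_on {0..1}" if "continuous_on {0..1} g" for g
        by (rule integrable_times_continuous[OF h that])
      have "f \<nu> j = fourier_coeff (\<lambda>x. h x * r x + (h x * (c1 * e p x) + h x * (c2 * e (- p) x))) p"
        unfolding f_def True r_def Y_def h_def by (simp add: algebra_simps)
      also have "\<dots> = fourier_coeff (\<lambda>x. h x * r x) p
          + (fourier_coeff (\<lambda>x. h x * (c1 * e p x)) p + fourier_coeff (\<lambda>x. h x * (c2 * e (- p) x)) p)"
        by (subst fourier_coeff_add, (intro ai cr set_integral_add(1) continuous_intros ce)+)
          (subst fourier_coeff_add, (intro ai continuous_intros ce refl)+)
      also have "fourier_coeff (\<lambda>x. h x * (c1 * e p x)) p = c1 * fourier_coeff h 0"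
        using fourier_coeff_cmult[of c1 "\<lambda>x. h x * e p x" p] fourier_coeff_shift[of h p p]
        by (simp add: e_def mult.left_commute)
      also have "fourier_coeff (\<lambda>x. h x * (c2 * e (- p) x)) p = c2 * fourier_coeff h (2 * p)"
        using fourier_coeff_cmult[of c2 "\<lambda>x. h x * e (- p) x" p] fourier_coeff_shift[of h "- p" p]
        by (simp add: e_def mult.left_commute)
      also have "c1 * fourier_coeff h 0 + c2 * fourier_coeff h (2 * p) = b j"
        unfolding b_def c1_def c2_def h_def mean_matrix_def fourier_matrix_def
        by (simp add: fourier_coeff_def algebra_simps)
      finally show ?thesis .
    qed
    have "norm (f \<nu> j - a \<nu> j) = norm (fourier_coeff (\<lambda>x. h x * r x) p)" using fc True by (simp add: a_def)
    also have "\<dots> \<le> ((D + A) * L * \<kappa> ^ (n - 2)) * integral {0..1} (\<lambda>x. norm (h x))"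
      by (rule fourier_coeff_product_bound[OF h cr r])
    finally show ?thesis unfolding m_def h_def True .
  next
    case False
    then have \<nu>3: "3 \<le> \<nu>" "\<nu> \<le> n" using \<nu> by auto
    have "norm (f \<nu> j) \<le> (A * \<kappa> ^ (n - 3)) * m \<nu> j"
      unfolding f_def m_def
    proof (rule fourier_coeff_product_bound)
      show "(\<lambda>x. P \<nu> x $ i $ j) absolutely_integrable_on {0..1}" using \<nu> by (intro summable_P) auto
      show "continuous_on {0..1} (\<lambda>x. deriv01 (n - \<nu>) y x $ j)"
        using \<nu> by (intro component_continuous[OF y(1)]) auto
      fix x :: real assume x: "x \<in> {0..1}"
      have "norm (deriv01 (n - \<nu>) y x $ j) \<le> norm (deriv01 (n - \<nu>) y x)"
        by (rule Finite_Cartesian_Product.norm_nth_le)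
      also have "\<dots> \<le> A * \<kappa> ^ (n - \<nu>)" using \<nu> x by (intro db) auto
      also have "\<dots> \<le> A * \<kappa> ^ (n - 3)" using \<nu>3 \<kappa>1 A0 by (intro mult_left_mono power_increasing) auto
      finally show "norm (deriv01 (n - \<nu>) y x $ j) \<le> A * \<kappa> ^ (n - 3)" .
    qed
    also have "\<dots> \<le> ((D + A) * L * \<kappa> ^ (n - 2)) * m \<nu> j"
    proof (rule mult_right_mono)
      have "n - 2 = Suc (n - 3)" using \<nu>3 by simp
      then have "\<kappa> ^ (n - 2) = \<kappa> * \<kappa> ^ (n - 3)" by (simp only: power_Suc)
      then have "\<kappa> ^ (n - 3) = (1 / \<kappa>) * \<kappa> ^ (n - 2)" using \<kappa>1 by simp
      also have "\<dots> \<le> L * \<kappa> ^ (n - 2)" using L\<kappa> \<kappa>1 by (intro mult_right_mono) auto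
      finally have "A * \<kappa> ^ (n - 3) \<le> A * (L * \<kappa> ^ (n - 2))" using A0 by (intro mult_left_mono)
      also have "\<dots> \<le> (D + A) * (L * \<kappa> ^ (n - 2))" using D0 L0 \<kappa>1 by (intro mult_right_mono) auto
      finally show "A * \<kappa> ^ (n - 3) \<le> (D + A) * L * \<kappa> ^ (n - 2)" by (simp add: mult.assoc)
      show "0 \<le> m \<nu> j" unfolding m_def by (rule mass_nonneg)
    qed
    finally show ?thesis unfolding a_def using False by simp
  qed
  have "freq p ^ n = freq k ^ n" using p n_even by (auto simp: freq_minus_even_power)
  then have lhs: "(l - freq k ^ n) * fourier_vec y p $ i = (\<Sum>\<nu>=2..n. \<Sum>j\<in>UNIV. f \<nu> j)"
    using eigenfunction_fourier_coeff[OF y(1), of p i] unfolding f_def by simp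
  have "(\<Sum>\<nu>=2..n. \<Sum>j\<in>UNIV. a \<nu> j) = (\<Sum>\<nu>\<in>{2..n}. if \<nu> = 2 then (\<Sum>j\<in>UNIV. b j) else 0)"
    unfolding a_def by (intro sum.cong) auto
  also have "\<dots> = (\<Sum>j\<in>UNIV. b j)" using n2 by simp
  also have "\<dots> = freq k ^ (n - 2) * ((mean_matrix (P 2) *v fourier_vec y p) $ i
          + (fourier_matrix (P 2) (2 * p) *v fourier_vec y (- p)) $ i)"
    unfolding b_def by (simp add: matrix_vector_mult_def sum.distrib sum_distrib_left distrib_left)
  finally have rhs: "freq k ^ (n - 2) * ((mean_matrix (P 2) *v fourier_vec y p) $ i
          + (fourier_matrix (P 2) (2 * p) *v fourier_vec y (- p)) $ i) = (\<Sum>\<nu>=2..n. \<Sum>j\<in>UNIV. a \<nu> j)"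
    by simp
  have "norm ((\<Sum>\<nu>=2..n. \<Sum>j\<in>UNIV. f \<nu> j) - (\<Sum>\<nu>=2..n. \<Sum>j\<in>UNIV. a \<nu> j))
      = norm (\<Sum>\<nu>=2..n. \<Sum>j\<in>UNIV. f \<nu> j - a \<nu> j)"
    by (simp add: sum_subtractf)
  also have "\<dots> \<le> (\<Sum>\<nu>=2..n. \<Sum>j\<in>UNIV. ((D + A) * L * \<kappa> ^ (n - 2)) * m \<nu> j)"
    by (intro sum_norm_le each)
  also have "\<dots> = ((D + A) * L * \<kappa> ^ (n - 2)) * (\<Sum>\<nu>=2..n. \<Sum>j\<in>UNIV. m \<nu> j)"
    by (simp add: sum_distrib_left)
  also have "\<dots> \<le> ((D + A) * L * \<kappa> ^ (n - 2)) * total_mass"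
    using row_mass_le D0 A0 L0 \<kappa>1 unfolding m_def by (intro mult_left_mono) auto
  finally show ?thesis unfolding lhs rhs D_def \<kappa>_def by (simp add: mult_ac)
qed

end

locale resonant_operator = summable_operator n P
  for n :: nat and P :: "nat \<Rightarrow> real \<Rightarrow> complex^'m^'m" +
  fixes \<mu> :: "'m \<Rightarrow> complex" and v w :: "'m \<Rightarrow> complex^'m"
  assumes inj_\<mu>: "inj \<mu>"
    and v: "\<And>j. mean_matrix (P 2) *v v j = \<mu> j *s v j" and norm_v: "\<And>j. norm (v j) = 1"
    and w: "\<And>j. adjoint_matrix (mean_matrix (P 2)) *v w j = cnj (\<mu> j) *s w j" "\<And>j. cdot (w j) (v j) = 1"
begin

text \<open>By biorthogonality this is the coefficient of \<open>y\<close> along \<open>exp_fun (v s) p\<close>.\<close>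

definition amplitude :: "(real \<Rightarrow> complex^'m) \<Rightarrow> int \<Rightarrow> 'm \<Rightarrow> complex" where
  "amplitude y p s = cdot (fourier_vec y p) (w s)"

lemma expansion: "a = (\<Sum>q\<in>UNIV. cdot a (w q) *s v q)"
  by (rule biorthogonal_expansion[OF inj_\<mu> v w])

lemma fourier_vec_expansion: "fourier_vec y p = (\<Sum>q\<in>UNIV. amplitude y p q *s v q)"
  unfolding amplitude_def by (rule expansion)

text \<open>Testing \<open>resonant_coefficients\<close> with \<open>w s\<close> moves \<open>mean_matrix (P 2)\<close> to the other side, where it acts as \<open>\<mu> s\<close> and
  completes \<open>freq k ^ n\<close> to \<open>mu_approx n \<mu> k s\<close>. Expanding the other mode in the basis \<open>v\<close> produces the coefficients
  \<open>coeff_b\<close>. The bounds on the amplitudes and on the remainder of \<open>y\<close> are included since all constants are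
  uniform in \<open>k\<close>, \<open>l\<close> and \<open>y\<close>.\<close>

theorem resonant_system:
  "\<exists>C K. 0 < C \<and> 3 \<le> K \<and> (\<forall>k l y. K \<le> \<bar>k\<bar> \<longrightarrow> norm (l - freq k ^ n) \<le> c * real_of_int \<bar>k\<bar> ^ (n - 2) \<longrightarrow>
     y \<in> eigenspace n P l \<longrightarrow> L2_norm y = 1 \<longrightarrow>
     (\<forall>p\<in>{k, - k}. \<forall>s. norm ((l - mu_approx n \<mu> k s) * amplitude y p s
         - freq k ^ (n - 2) * (\<Sum>q\<in>UNIV. coeff_b (P 2) v w s q (2 * p) * amplitude y (- p) q))
       \<le> C * real_of_int \<bar>k\<bar> ^ (n - 2) * log_ratio k) \<and>
     (\<forall>x\<in>{0..1}. norm (y x - (\<Sum>q\<in>UNIV. amplitude y k q *s exp_fun (v q) k x + amplitude y (- k) q *s exp_fun (v q) (- k) x))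
       \<le> C * log_ratio k) \<and>
     (\<forall>p\<in>{k, - k}. \<forall>s. norm (amplitude y p s) \<le> C))"
proof -
  define A where "A = 4 * real CARD('m) * (2 * pi) ^ n"
  define D where "D = 8 * (2 * pi) ^ n * total_mass * A"
  define W where "W = (\<Sum>s\<in>UNIV. \<Sum>i\<in>UNIV. norm (w s $ i))"
  have W: "(\<Sum>i\<in>UNIV. norm (w s $ i)) \<le> W" for s
    unfolding W_def by (rule member_le_sum[of s UNIV "\<lambda>s. \<Sum>i\<in>UNIV. norm (w s $ i)"]) (auto intro: sum_nonneg)
  have W0: "0 \<le> W" unfolding W_def by (intro sum_nonneg) auto
  have A0: "0 \<le> A" unfolding A_def by simp
  have D0: "0 \<le> D" unfolding D_def using A0 total_mass_nonneg by simp
  define C1 where "C1 = total_mass * (D + A) * 2 * W"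
  define C2 where "C2 = real CARD('m) * (D * 2)"
  have C12: "0 \<le> C1" "0 \<le> C2" unfolding C1_def C2_def using W0 A0 D0 total_mass_nonneg by auto
  define C where "C = C1 + C2 + W + 1"
  define M where "M = real CARD('m) * (8 * (2 * pi) ^ n * total_mass)"
  have M0: "0 \<le> M" unfolding M_def using total_mass_nonneg by simp
  have "1 / (4 * M + 4) > 0" using M0 by simp
  then obtain K1 where K1: "\<And>k. K1 \<le> \<bar>k\<bar> \<Longrightarrow> log_ratio k \<le> 1 / (4 * M + 4)" by (rule log_ratio_small) blast
  define K where "K = max 3 (max K1 \<lceil>2 * c\<rceil>)"
  show ?thesis
  proof (intro exI[of _ C] exI[of _ K] conjI allI impI)
    show "0 < C" unfolding C_def using C12 W0 by linarith
    show "3 \<le> K" unfolding K_def by simp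
    fix k l and y :: "real \<Rightarrow> complex^'m"
    assume kK: "K \<le> \<bar>k\<bar>" and l: "norm (l - freq k ^ n) \<le> c * real_of_int \<bar>k\<bar> ^ (n - 2)"
      and y: "y \<in> eigenspace n P l" "L2_norm y = 1"
    define \<kappa> where "\<kappa> = real_of_int \<bar>k\<bar>"
    define L where "L = (ln \<kappa> + 1) / \<kappa>"
    have k3: "3 \<le> \<bar>k\<bar>" using kK unfolding K_def by linarith
    have k: "1 \<le> \<bar>k\<bar>" "2 * c \<le> real_of_int \<bar>k\<bar>" using kK unfolding K_def by (linarith, linarith)
    have LR: "L \<le> 2 * log_ratio k" "0 < log_ratio k" unfolding L_def \<kappa>_def using log_ratio_bounds[OF k3] by auto
    have \<kappa>1: "1 \<le> \<kappa>" using k unfolding \<kappa>_def by linarith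
    have small: "real CARD('m) * (8 * (2 * pi) ^ n * total_mass * ((ln (real_of_int \<bar>k\<bar>) + 1) / real_of_int \<bar>k\<bar>)) \<le> 1 / 2"
    proof -
      have "M * L \<le> M * (2 * (1 / (4 * M + 4)))"
        using LR K1[of k] kK M0 unfolding K_def by (intro mult_left_mono) auto
      also have "\<dots> \<le> 1 / 2" using M0 by (simp add: field_simps)
      finally show ?thesis unfolding M_def L_def \<kappa>_def by (simp add: mult.assoc)
    qed
    interpret y: domain_function n P y by (rule domain_function[OF y(1)])
    have cy: "continuous_on {0..1} y" using y.continuous_deriv[of 0] n2 by simp
    show "\<forall>p\<in>{k, - k}. \<forall>s. norm (amplitude y p s) \<le> C"
    proof (intro ballI allI)
      fix p s
      have "norm (amplitude y p s) \<le> (\<Sum>i\<in>UNIV. norm (fourier_vec y p $ i) * norm (w s $ i))"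
        unfolding amplitude_def by (rule norm_cdot_le)
      also have "\<dots> \<le> (\<Sum>i\<in>UNIV. 1 * norm (w s $ i))"
        by (intro sum_mono mult_right_mono fourier_vec_le_1[OF cy y(2)]) auto
      also have "\<dots> \<le> C" using W[of s] C12 unfolding C_def by simp
      finally show "norm (amplitude y p s) \<le> C" .
    qed
    show "\<forall>x\<in>{0..1}. norm (y x - (\<Sum>q\<in>UNIV. amplitude y k q *s exp_fun (v q) k x
        + amplitude y (- k) q *s exp_fun (v q) (- k) x)) \<le> C * log_ratio k"
    proof
      fix x :: real assume x: "x \<in> {0..1}"
      have one: "(\<Sum>q\<in>UNIV. amplitude y p q *s exp_fun (v q) p x) = exp (freq p * of_real x) *s fourier_vec y p" for p
        unfolding fourier_vec_expansion[of y p] exp_fun_def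
        by (simp add: vec_eq_iff sum_distrib_left mult_ac)
      define V where "V = (\<Sum>q\<in>UNIV. amplitude y k q *s exp_fun (v q) k x + amplitude y (- k) q *s exp_fun (v q) (- k) x)"
      have V: "V $ i = (\<Sum>p\<in>{k, - k}. freq p ^ 0 * fourier_vec y p $ i * exp (freq p * of_real x))" for i
        unfolding V_def sum.distrib one using k by (simp add: mult.commute)
      have "norm ((y x - V) $ i) \<le> D * L" for i
      proof -
        have "norm (deriv01 0 y x $ i - (\<Sum>p\<in>{k, - k}. freq p ^ 0 * fourier_vec y p $ i * exp (freq p * of_real x)))
          \<le> 8 * (2 * pi) ^ n * total_mass * A * ((ln (real_of_int \<bar>k\<bar>) + 1) / real_of_int \<bar>k\<bar>) * real_of_int \<bar>k\<bar> ^ 0"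
          unfolding A_def
          by (rule resonant_approximation[OF y(1) l k _ _ _ x])
            (use derivative_bound[OF y l k small] in auto)
        then show ?thesis unfolding V[symmetric] D_def L_def \<kappa>_def by simp
      qed
      then have "norm (y x - V) \<le> real CARD('m) * (D * L)"
        using norm_le_sum_components[of "y x - V"] sum_bounded_above[of UNIV "\<lambda>i. norm ((y x - V) $ i)" "D * L"]
        by (auto intro: order_trans)
      also have "\<dots> \<le> real CARD('m) * (D * (2 * log_ratio k))" using LR D0 by (intro mult_left_mono) auto
      also have "\<dots> = C2 * log_ratio k" unfolding C2_def by simp
      also have "\<dots> \<le> C * log_ratio k" using LR C12 W0 unfolding C_def by (intro mult_right_mono) auto
      finally show "norm (y x - (\<Sum>q\<in>UNIV. amplitude y k q *s exp_fun (v q) k x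
        + amplitude y (- k) q *s exp_fun (v q) (- k) x)) \<le> C * log_ratio k" unfolding V_def .
    qed
    show "\<forall>p\<in>{k, - k}. \<forall>s. norm ((l - mu_approx n \<mu> k s) * amplitude y p s
         - freq k ^ (n - 2) * (\<Sum>q\<in>UNIV. coeff_b (P 2) v w s q (2 * p) * amplitude y (- p) q))
       \<le> C * real_of_int \<bar>k\<bar> ^ (n - 2) * log_ratio k"
    proof (intro ballI allI)
      fix p s assume p: "p \<in> {k, - k}"
      let ?F = "fourier_matrix (P 2) (2 * p)"
      define err where "err = (l - freq k ^ n) *s fourier_vec y p
        - freq k ^ (n - 2) *s (mean_matrix (P 2) *v fourier_vec y p + ?F *v fourier_vec y (- p))"
      have err: "norm (err $ i) \<le> total_mass * (D + A) * L * \<kappa> ^ (n - 2)" for i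
        using resonant_coefficients[OF y l k small p, of i]
        unfolding err_def D_def A_def L_def \<kappa>_def
        by (simp only: vector_minus_component vector_smult_component vector_add_component)
      have "(l - freq k ^ n) *s fourier_vec y p
          = err + freq k ^ (n - 2) *s (mean_matrix (P 2) *v fourier_vec y p + ?F *v fourier_vec y (- p))"
        unfolding err_def by simp
      then have "(l - freq k ^ n) * amplitude y p s
          = cdot err (w s) + freq k ^ (n - 2) * (cdot (mean_matrix (P 2) *v fourier_vec y p) (w s)
            + cdot (?F *v fourier_vec y (- p)) (w s))"
        unfolding amplitude_def by (metis cdot_add cdot_scale)
      also have "cdot (mean_matrix (P 2) *v fourier_vec y p) (w s) = \<mu> s * amplitude y p s"
        unfolding cdot_adjoint w(1) cdot_scale_right amplitude_def by simp
      also have "cdot (?F *v fourier_vec y (- p)) (w s)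
          = (\<Sum>q\<in>UNIV. coeff_b (P 2) v w s q (2 * p) * amplitude y (- p) q)"
      proof -
        have "?F *v fourier_vec y (- p) = (\<Sum>q\<in>UNIV. amplitude y (- p) q *s (?F *v v q))"
          unfolding fourier_vec_expansion[of y "- p"]
          by (simp add: linear_sum[OF matrix_vector_mul_linear] matrix_vector_smult_complex)
        then have "cdot (?F *v fourier_vec y (- p)) (w s) = (\<Sum>q\<in>UNIV. amplitude y (- p) q * cdot (?F *v v q) (w s))"
          by (simp add: cdot_sum cdot_scale)
        also have "\<dots> = (\<Sum>q\<in>UNIV. coeff_b (P 2) v w s q (2 * p) * amplitude y (- p) q)"
          using n2 by (subst cdot_fourier_matrix) (auto intro: summable_P simp: mult.commute)
        finally show ?thesis .
      qed
      finally have "(l - mu_approx n \<mu> k s) * amplitude y p s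
          - freq k ^ (n - 2) * (\<Sum>q\<in>UNIV. coeff_b (P 2) v w s q (2 * p) * amplitude y (- p) q) = cdot err (w s)"
        unfolding mu_approx_def by (simp add: algebra_simps)
      then have "norm ((l - mu_approx n \<mu> k s) * amplitude y p s
          - freq k ^ (n - 2) * (\<Sum>q\<in>UNIV. coeff_b (P 2) v w s q (2 * p) * amplitude y (- p) q)) = norm (cdot err (w s))"
        by simp
      also have "\<dots> \<le> (\<Sum>i\<in>UNIV. norm (err $ i) * norm (w s $ i))" by (rule norm_cdot_le)
      also have "\<dots> \<le> (\<Sum>i\<in>UNIV. (total_mass * (D + A) * L * \<kappa> ^ (n - 2)) * norm (w s $ i))"
        by (intro sum_mono mult_right_mono err) auto
      also have "\<dots> = (total_mass * (D + A) * L * \<kappa> ^ (n - 2)) * (\<Sum>i\<in>UNIV. norm (w s $ i))"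
        by (simp add: sum_distrib_left)
      also have "\<dots> \<le> (total_mass * (D + A) * (2 * log_ratio k) * \<kappa> ^ (n - 2)) * W"
        using W W0 A0 D0 total_mass_nonneg \<kappa>1 LR
        by (intro mult_mono mult_left_mono mult_right_mono mult_nonneg_nonneg sum_nonneg) auto
      also have "\<dots> = C1 * \<kappa> ^ (n - 2) * log_ratio k" unfolding C1_def by simp
      also have "\<dots> \<le> C * \<kappa> ^ (n - 2) * log_ratio k"
        using LR C12 W0 \<kappa>1 unfolding C_def by (intro mult_right_mono) auto
      finally show "norm ((l - mu_approx n \<mu> k s) * amplitude y p s
         - freq k ^ (n - 2) * (\<Sum>q\<in>UNIV. coeff_b (P 2) v w s q (2 * p) * amplitude y (- p) q))
       \<le> C * real_of_int \<bar>k\<bar> ^ (n - 2) * log_ratio k" unfolding \<kappa>_def .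
    qed
  qed
qed

end

section \<open>Perturbed two-by-two systems\<close>

text \<open>The number \<open>\<gamma>\<close> is the square root of the ratio of the larger to the smaller of the two moduli, and the modulus of \<open>q\<close>
  is their geometric mean.\<close>

lemma pair_geometric:
  fixes b1 b2 q :: complex
  assumes q: "q\<^sup>2 = b1 * b2" and b: "b1 \<noteq> 0" "b2 \<noteq> 0"
    and \<gamma>: "\<gamma> = max (sqrt (norm b1 / norm b2)) (sqrt (norm b2 / norm b1))"
  shows "norm q = \<gamma> * min (norm b1) (norm b2)" "max (norm b1) (norm b2) = \<gamma> * norm q" "1 \<le> \<gamma>"
proof -
  define m where "m = min (norm b1) (norm b2)"
  define M where "M = max (norm b1) (norm b2)"
  have mM: "0 < m" "m \<le> M" unfolding m_def M_def using b by auto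
  have "sqrt (norm b2 / norm b1) \<le> sqrt (norm b1 / norm b2)" if "norm b2 \<le> norm b1"
    using that b by (intro real_sqrt_le_mono frac_le) auto
  moreover have "sqrt (norm b1 / norm b2) \<le> sqrt (norm b2 / norm b1)" if "norm b1 \<le> norm b2"
    using that b by (intro real_sqrt_le_mono frac_le) auto
  ultimately have g: "\<gamma> = sqrt (M / m)" unfolding \<gamma> M_def m_def by (auto simp: max_def min_def)
  have "(norm q)\<^sup>2 = M * m" unfolding M_def m_def
    by (simp add: q norm_mult max_def min_def flip: norm_power)
  then have qn: "norm q = sqrt (M * m)" using real_sqrt_unique by fastforce
  have gm: "\<gamma> * sqrt m = sqrt M" unfolding g using mM by (simp add: real_sqrt_divide)
  show "norm q = \<gamma> * min (norm b1) (norm b2)"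
    unfolding m_def[symmetric] qn real_sqrt_mult gm[symmetric] using mM by simp
  have "\<gamma> * norm q = sqrt M * (\<gamma> * sqrt m)" unfolding qn real_sqrt_mult by (rule mult.left_commute)
  then have "\<gamma> * norm q = sqrt M * sqrt M" unfolding gm .
  then show "max (norm b1) (norm b2) = \<gamma> * norm q" using mM M_def by simp
  show "1 \<le> \<gamma>" unfolding g using mM by simp
qed

text \<open>Multiplying the first equation by \<open>x\<close> and inserting the second eliminates \<open>u2\<close>.\<close>

lemma near_square_root_aux:
  fixes x u1 u2 b1 b2 q d1 d2 :: complex
  assumes e1: "x * u1 = b1 * u2 + d1" and e2: "x * u2 = b2 * u1 + d2"
    and d: "norm d1 \<le> D" "norm d2 \<le> D" and q: "q\<^sup>2 = b1 * b2" and u1: "1 / 3 \<le> norm u1"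
  shows "norm (x - q) * norm (x + q) \<le> 3 * D * (norm b1 + norm x)"
proof -
  have "(x - q) * (x + q) * u1 = x * (x * u1) - q\<^sup>2 * u1" by (simp add: power2_eq_square algebra_simps)
  also have "\<dots> = b1 * (x * u2) + x * d1 - b1 * b2 * u1" unfolding e1 q by (simp add: algebra_simps)
  also have "\<dots> = b1 * d2 + x * d1" unfolding e2 by (simp add: algebra_simps)
  finally have "norm (x - q) * norm (x + q) * norm u1 = norm (b1 * d2 + x * d1)" by (metis norm_mult)
  also have "\<dots> \<le> norm b1 * D + norm x * D"
    using d by (intro norm_triangle_mono) (auto simp: norm_mult intro: mult_left_mono)
  finally have *: "norm (x - q) * norm (x + q) * norm u1 \<le> D * (norm b1 + norm x)" by (simp add: algebra_simps)
  have "norm (x - q) * norm (x + q) * (1 / 3) \<le> norm (x - q) * norm (x + q) * norm u1"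
    using u1 by (intro mult_left_mono) auto
  then show ?thesis using * by simp
qed

text \<open>The product \<open>(x - q) (x + q)\<close> is at most \<open>D\<close> times the larger of \<open>|b1|\<close>, \<open>|b2|\<close> plus \<open>|x|\<close>, up to a factor; this
  is at most \<open>\<gamma> D\<close> times \<open>|q| + |x|\<close>, by \<open>pair_geometric\<close>. As the larger of the two factors is itself comparable to \<open>|q| + |x|\<close>,
  it cancels, and the smaller one is at most of order \<open>\<gamma> D\<close>.\<close>

lemma near_square_root:
  fixes x u1 u2 b1 b2 q d1 d2 :: complex
  assumes e1: "x * u1 = b1 * u2 + d1" and e2: "x * u2 = b2 * u1 + d2"
    and d: "norm d1 \<le> D" "norm d2 \<le> D" and q: "q\<^sup>2 = b1 * b2" and b: "b1 \<noteq> 0" "b2 \<noteq> 0"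
    and u: "1 / 4 \<le> (norm u1)\<^sup>2 + (norm u2)\<^sup>2"
    and \<gamma>: "\<gamma> = max (sqrt (norm b1 / norm b2)) (sqrt (norm b2 / norm b1))"
  shows "norm (x - q) \<le> 6 * D * \<gamma> \<or> norm (x + q) \<le> 6 * D * \<gamma>"
proof -
  note g = pair_geometric[OF q b \<gamma>]
  have D0: "0 \<le> D" using d(1) norm_ge_zero order_trans by blast
  \<comment> \<open>Either amplitude may be the one that is bounded below; the equations are symmetric.\<close>
  have big: "1 / 3 \<le> norm u1 \<or> 1 / 3 \<le> norm u2"
  proof (rule ccontr)
    assume "\<not> ?thesis"
    then have "(norm u1)\<^sup>2 \<le> (1 / 3)\<^sup>2" "(norm u2)\<^sup>2 \<le> (1 / 3)\<^sup>2" by (auto intro!: power_mono)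
    then show False using u by (simp add: power2_eq_square)
  qed
  have "norm (x - q) * norm (x + q) \<le> 3 * D * (max (norm b1) (norm b2) + norm x)"
  proof (cases "1 / 3 \<le> norm u1")
    case True
    have "norm (x - q) * norm (x + q) \<le> 3 * D * (norm b1 + norm x)"
      by (rule near_square_root_aux[OF e1 e2 d q True])
    also have "\<dots> \<le> 3 * D * (max (norm b1) (norm b2) + norm x)" using D0 by (intro mult_left_mono) auto
    finally show ?thesis .
  next
    case False
    have "norm (x - q) * norm (x + q) \<le> 3 * D * (norm b2 + norm x)"
      using big False q by (intro near_square_root_aux[OF e2 e1 d(2,1)]) (auto simp: mult.commute)
    also have "\<dots> \<le> 3 * D * (max (norm b1) (norm b2) + norm x)" using D0 by (intro mult_left_mono) auto
    finally show ?thesis .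
  qed
  also have "\<dots> \<le> 3 * D * (\<gamma> * norm q + \<gamma> * norm x)"
    unfolding g(2) using D0 mult_right_mono[OF g(3), of "norm x"] by (intro mult_left_mono) auto
  finally have prod: "norm (x - q) * norm (x + q) \<le> 3 * D * \<gamma> * (norm q + norm x)" by (simp add: algebra_simps)
  define M where "M = max (norm (x - q)) (norm (x + q))"
  have tri: "2 * norm x \<le> norm (x - q) + norm (x + q)" "2 * norm q \<le> norm (x - q) + norm (x + q)"
    using norm_triangle_ineq[of "x - q" "x + q"] norm_triangle_ineq4[of "x + q" "x - q"]
    by (simp_all add: norm_mult flip: mult_2)
  have M: "norm q + norm x \<le> 2 * M" using tri unfolding M_def by linarith
  have "0 < norm q" using q b by auto
  then have M0: "0 < M" using tri unfolding M_def by linarith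
  have "norm (x - q) * norm (x + q) = min (norm (x - q)) (norm (x + q)) * M"
    unfolding M_def by (simp add: min_def max_def)
  then have "min (norm (x - q)) (norm (x + q)) * M \<le> 3 * D * \<gamma> * (2 * M)"
  proof -
    have "3 * D * \<gamma> * (norm q + norm x) \<le> 3 * D * \<gamma> * (2 * M)"
      using M D0 g(3) by (intro mult_left_mono) auto
    then show ?thesis using prod \<open>norm (x - q) * norm (x + q) = _\<close> by linarith
  qed
  then have "min (norm (x - q)) (norm (x + q)) * M \<le> (6 * D * \<gamma>) * M" by simp
  then have "min (norm (x - q)) (norm (x + q)) \<le> 6 * D * \<gamma>" using M0 mult_le_cancel_right_pos by blast
  then show ?thesis by linarith
qed

text \<open>With \<open>x\<close> replaced by \<open>q\<close>, the first equation reads \<open>b1 u2 = q u1 + e\<close> with a small \<open>e\<close>. It determines the ratio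
  \<open>u2 / u1\<close> up to the relative error \<open>e / (q u1)\<close>, so \<open>u1\<close> must be bounded away from \<open>0\<close>. This holds because \<open>b1\<close> is the
  larger coefficient: a small \<open>u1\<close> would make \<open>u2\<close> small as well.\<close>

lemma amplitude_ratio_aux:
  fixes x u1 u2 b1 b2 q d1 :: complex
  assumes e1: "x * u1 = b1 * u2 + d1" and d: "norm d1 \<le> G * d" and q: "q\<^sup>2 = b1 * b2" and b: "b1 \<noteq> 0" "b2 \<noteq> 0"
    and u: "1 / 4 \<le> (norm u1)\<^sup>2 + (norm u2)\<^sup>2" "norm u1 \<le> H"
    and \<gamma>: "\<gamma> = max (sqrt (norm b1 / norm b2)) (sqrt (norm b2 / norm b1))"
    and xq: "norm (x - q) \<le> G * \<gamma> * d" and pos: "0 \<le> G" "1 \<le> H" "0 \<le> d"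
    and le: "norm b2 \<le> norm b1" and small: "16 * G * H * d \<le> norm b2"
  shows "u1 \<noteq> 0 \<and> (\<exists>\<rho>. u2 = (q / b1) * u1 * (1 + \<rho>) \<and> norm \<rho> \<le> 16 * G * H * d / norm b2)"
proof -
  note g = pair_geometric[OF q b \<gamma>]
  have mn: "min (norm b1) (norm b2) = norm b2" using le by simp
  have mx: "max (norm b1) (norm b2) = norm b1" using le by simp
  have qb: "norm q = \<gamma> * norm b2" using g(1) mn by simp
  have b1q: "norm b1 = \<gamma> * norm q" using g(2) mx by simp
  have b2p: "0 < norm b2" using b by simp
  have q0: "q \<noteq> 0" using q b by auto
  define e where "e = (x - q) * u1 - d1"
  have e: "b1 * u2 = q * u1 + e" unfolding e_def using e1 by (simp add: algebra_simps)
  have ne: "norm e \<le> 2 * G * H * \<gamma> * d"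
  proof -
    have "norm e \<le> norm ((x - q) * u1) + norm d1" unfolding e_def by (rule norm_triangle_ineq4)
    also have "\<dots> \<le> (G * \<gamma> * d) * H + G * d"
      unfolding norm_mult using xq u(2) pos g(3) d by (intro add_mono mult_mono) auto
    also have "G * d \<le> (G * d) * (\<gamma> * H)" using mult_left_mono[of 1 "\<gamma> * H" "G * d"] pos g(3) mult_mono[of 1 \<gamma> 1 H] by simp
    finally show ?thesis by (simp add: algebra_simps)
  qed
  have u1: "1 / 8 \<le> norm u1"
  proof (rule ccontr)
    assume "\<not> 1 / 8 \<le> norm u1"
    then have lt: "norm u1 < 1 / 8" by simp
    have "norm b1 * norm u2 \<le> norm q * norm u1 + norm e" using e by (metis norm_mult norm_triangle_ineq)
    also have "norm q * norm u1 \<le> norm b1 * norm u1"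
      unfolding b1q using g(3) mult_right_mono[of 1 \<gamma> "norm q * norm u1"] by (simp add: mult.assoc)
    also have "norm e \<le> norm b1 * (1 / 8)"
    proof -
      have "norm e \<le> (2 * G * H * d) * \<gamma>" using ne by (simp add: mult_ac)
      also have "\<dots> \<le> (norm b2 / 8) * \<gamma>" using small g(3) by (intro mult_right_mono) auto
      also have "\<dots> = norm q / 8" using qb by simp
      also have "\<dots> \<le> norm b1 / 8" unfolding b1q using g(3) mult_right_mono[of 1 \<gamma> "norm q"] by simp
      finally show ?thesis by simp
    qed
    finally have "norm b1 * norm u2 \<le> norm b1 * (norm u1 + 1 / 8)" by (simp add: algebra_simps)
    then have "norm u2 \<le> norm u1 + 1 / 8" using b(1) by simp
    then have "norm u2 \<le> 1 / 4" using lt by simp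
    then have "(norm u2)\<^sup>2 \<le> (1 / 4)\<^sup>2" "(norm u1)\<^sup>2 \<le> (1 / 8)\<^sup>2" using lt by (auto intro!: power_mono)
    then show False using u(1) by (simp add: power2_eq_square)
  qed
  then have u10: "u1 \<noteq> 0" by auto
  define \<rho> where "\<rho> = e / (q * u1)"
  have "u2 = (q * u1 + e) / b1" using e b(1) by (simp add: field_simps)
  also have "\<dots> = (q / b1) * u1 * (1 + \<rho>)" unfolding \<rho>_def using u10 q0 b(1) by (simp add: field_simps)
  finally have "u2 = (q / b1) * u1 * (1 + \<rho>)" .
  moreover have "norm \<rho> \<le> 16 * G * H * d / norm b2"
  proof -
    have "norm \<rho> = norm e / (norm q * norm u1)" unfolding \<rho>_def by (simp add: norm_divide norm_mult)
    also have "\<dots> \<le> (2 * G * H * \<gamma> * d) / (norm q * (1 / 8))"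
      using ne u1 q0 pos g(3) by (intro frac_le mult_left_mono) auto
    also have "\<dots> = 16 * G * H * d / norm b2" unfolding qb using g(3) b2p by simp
    finally show ?thesis .
  qed
  ultimately show ?thesis using u10 by blast
qed

text \<open>If \<open>b2\<close> is the larger coefficient, the second equation controls the inverse ratio \<open>u1 / u2\<close>, and \<open>q / b2\<close> is the inverse of
  \<open>q / b1\<close>. The relative error doubles at most when it is inverted.\<close>

lemma amplitude_ratio:
  fixes x u1 u2 b1 b2 q d1 d2 :: complex
  assumes e1: "x * u1 = b1 * u2 + d1" and e2: "x * u2 = b2 * u1 + d2"
    and d: "norm d1 \<le> G * d" "norm d2 \<le> G * d" and q: "q\<^sup>2 = b1 * b2" and b: "b1 \<noteq> 0" "b2 \<noteq> 0"
    and u: "1 / 4 \<le> (norm u1)\<^sup>2 + (norm u2)\<^sup>2" "norm u1 \<le> H" "norm u2 \<le> H"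
    and \<gamma>: "\<gamma> = max (sqrt (norm b1 / norm b2)) (sqrt (norm b2 / norm b1))"
    and xq: "norm (x - q) \<le> G * \<gamma> * d" and pos: "0 \<le> G" "1 \<le> H" "0 \<le> d"
    and small: "32 * G * H * d \<le> norm b1" "32 * G * H * d \<le> norm b2"
  shows "u1 \<noteq> 0" "u2 \<noteq> 0"
    "norm ((u2 / u1) / (q / b1) - 1) \<le> 32 * G * H * d / min (norm b1) (norm b2)"
proof -
  have q0: "q \<noteq> 0" using q b by auto
  have GHd: "0 \<le> G * H * d" using pos by simp
  have "u1 \<noteq> 0 \<and> u2 \<noteq> 0 \<and> norm ((u2 / u1) / (q / b1) - 1) \<le> 32 * G * H * d / min (norm b1) (norm b2)"
  proof (cases "norm b2 \<le> norm b1")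
    case True
    have "16 * G * H * d \<le> norm b2" using small(2) GHd by simp
    from amplitude_ratio_aux[OF e1 d(1) q b u(1,2) \<gamma> xq pos True this]
    obtain \<rho> where u1: "u1 \<noteq> 0" and u2: "u2 = (q / b1) * u1 * (1 + \<rho>)" and \<rho>: "norm \<rho> \<le> 16 * G * H * d / norm b2"
      by blast
    have "16 * G * H * d / norm b2 \<le> 1 / 2" using small(2) b by (simp add: field_simps)
    then have "norm \<rho> < 1" using \<rho> by simp
    then have "1 + \<rho> \<noteq> 0" by (metis add.inverse_unique less_irrefl norm_minus_cancel norm_one)
    then have u20: "u2 \<noteq> 0" using u2 u1 q0 b by simp
    have "(u2 / u1) / (q / b1) - 1 = \<rho>" unfolding u2 using u1 q0 b by simp
    moreover have "16 * G * H * d / norm b2 \<le> 32 * G * H * d / min (norm b1) (norm b2)"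
      using True GHd b by (simp add: divide_right_mono)
    ultimately show ?thesis using u1 u20 \<rho> by simp
  next
    case False
    have q': "q\<^sup>2 = b2 * b1" using q by (simp add: mult.commute)
    have \<gamma>': "\<gamma> = max (sqrt (norm b2 / norm b1)) (sqrt (norm b1 / norm b2))" using \<gamma> by (simp add: max.commute)
    have u': "1 / 4 \<le> (norm u2)\<^sup>2 + (norm u1)\<^sup>2" using u(1) by simp
    have "16 * G * H * d \<le> norm b1" using small(1) GHd by simp
    from amplitude_ratio_aux[OF e2 d(2) q' b(2,1) u' u(3) \<gamma>' xq pos _ this] False
    obtain \<rho> where u2: "u2 \<noteq> 0" and u1: "u1 = (q / b2) * u2 * (1 + \<rho>)" and \<rho>: "norm \<rho> \<le> 16 * G * H * d / norm b1"
      by auto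
    have "16 * G * H * d / norm b1 \<le> 1 / 2" using small(1) b by (simp add: field_simps)
    then have \<rho>2: "norm \<rho> \<le> 1 / 2" using \<rho> by simp
    have h: "1 / 2 \<le> norm (1 + \<rho>)"
      using norm_triangle_ineq2[of 1 "- \<rho>"] \<rho>2 by simp
    then have nz: "1 + \<rho> \<noteq> 0" by (metis norm_zero not_one_le_zero divide_le_0_1_iff zero_less_numeral not_le)
    then have u10: "u1 \<noteq> 0" using u1 u2 q0 b by simp
    have "(u2 / u1) / (q / b1) = (b1 * b2 / q\<^sup>2) / (1 + \<rho>)"
      unfolding u1 using u2 q0 b nz by (simp add: power2_eq_square mult_ac)
    also have "\<dots> = 1 / (1 + \<rho>)" unfolding q using b by simp
    finally have "(u2 / u1) / (q / b1) - 1 = - \<rho> / (1 + \<rho>)" using nz by (simp add: field_simps)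
    then have "norm ((u2 / u1) / (q / b1) - 1) = norm \<rho> / norm (1 + \<rho>)" by (simp add: norm_divide)
    also have "\<dots> \<le> (16 * G * H * d / norm b1) / (1 / 2)" using \<rho> h GHd by (intro frac_le) auto
    also have "\<dots> = 32 * G * H * d / min (norm b1) (norm b2)" using False by simp
    finally show ?thesis using u10 u2 by simp
  qed
  then show "u1 \<noteq> 0" "u2 \<noteq> 0" "norm ((u2 / u1) / (q / b1) - 1) \<le> 32 * G * H * d / min (norm b1) (norm b2)"
    by auto
qed

section \<open>Superpositions of two opposite exponentials\<close>

lemma norm_smult_complex: "norm (c *s (a :: complex^'m)) = norm c * norm a"
  by (simp add: norm_vec_def norm_mult L2_set_right_distrib)

lemma exp_fun_continuous: "continuous_on S (exp_fun u k)"
  unfolding exp_fun_def[abs_def] vector_scalar_mult_def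
  by (intro continuous_on_vec_lambda continuous_intros)

lemma smult_continuous: "continuous_on S g \<Longrightarrow> continuous_on S (\<lambda>x. c *s g x)" for g :: "real \<Rightarrow> complex^'m"
  using linear_continuous_on_compose[OF _ bounded_linear.linear[OF smult_bounded_linear]] .

lemma norm_add_squared:
  fixes a b :: complex shows "(norm (a + b))\<^sup>2 = (norm a)\<^sup>2 + (norm b)\<^sup>2 + 2 * Re (a * cnj b)"
  unfolding cmod_power2 by (simp add: power2_eq_square algebra_simps)

text \<open>The two exponentials are orthogonal as \<open>k \<noteq> 0\<close>; the cross term is an exponential of frequency \<open>2 k\<close>.\<close>

lemma two_mode_norm:
  fixes a :: "complex^'m"
  assumes "norm a = 1" "k \<noteq> 0"
  shows "integral {0..1} (\<lambda>x. (norm (u1 *s exp_fun a k x + u2 *s exp_fun a (- k) x))\<^sup>2) = (norm u1)\<^sup>2 + (norm u2)\<^sup>2"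
proof -
  let ?e = "\<lambda>p (x::real). exp (freq p * of_real x)"
  have pt: "(norm (u1 *s exp_fun a k x + u2 *s exp_fun a (- k) x))\<^sup>2
      = ((norm u1)\<^sup>2 + (norm u2)\<^sup>2) + 2 * Re ((u1 * cnj u2) * ?e (2 * k) x)" for x
  proof -
    have eq: "u1 *s exp_fun a k x + u2 *s exp_fun a (- k) x = (u1 * ?e k x + u2 * ?e (- k) x) *s a"
      by (simp add: exp_fun_def vec_eq_iff algebra_simps)
    have "(norm (u1 *s exp_fun a k x + u2 *s exp_fun a (- k) x))\<^sup>2 = (norm (u1 * ?e k x + u2 * ?e (- k) x))\<^sup>2"
      unfolding eq norm_smult_complex assms(1) by simp
    also have "\<dots> = (norm (u1 * ?e k x))\<^sup>2 + (norm (u2 * ?e (- k) x))\<^sup>2 + 2 * Re ((u1 * ?e k x) * cnj (u2 * ?e (- k) x))"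
      by (rule norm_add_squared)
    also have "(u1 * ?e k x) * cnj (u2 * ?e (- k) x) = (u1 * cnj u2) * (?e k x * cnj (?e (- k) x))" by simp
    also have "?e k x * cnj (?e (- k) x) = ?e (2 * k) x"
      by (simp add: exp_cnj freq_def mult_ac flip: exp_add)
    finally show ?thesis by (simp only: norm_mult norm_exp_freq mult_1_right)
  qed
  have ce: "continuous_on {0..1} (?e (2 * k))" by (intro continuous_intros)
  have int: "integral {0..1} (\<lambda>x. Re ((u1 * cnj u2) * ?e (2 * k) x)) = 0"
  proof -
    have "integral {0..1} (Re \<circ> (\<lambda>x. (u1 * cnj u2) * ?e (2 * k) x)) = Re (integral {0..1} (\<lambda>x. (u1 * cnj u2) * ?e (2 * k) x))"
      by (intro integral_linear bounded_linear_Re integrable_continuous_real continuous_intros)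
    also have "integral {0..1} (\<lambda>x. (u1 * cnj u2) * ?e (2 * k) x) = 0" using assms(2) by (simp add: integral_exp_freq)
    finally show ?thesis by (simp add: o_def)
  qed
  have ci: "(\<lambda>x. 2 * Re ((u1 * cnj u2) * ?e (2 * k) x)) integrable_on {0..1}"
    by (intro integrable_continuous_real continuous_intros)
  have "integral {0..1} (\<lambda>x. (norm (u1 *s exp_fun a k x + u2 *s exp_fun a (- k) x))\<^sup>2)
      = integral {0..1} (\<lambda>x::real. (norm u1)\<^sup>2 + (norm u2)\<^sup>2) + integral {0..1} (\<lambda>x. 2 * Re ((u1 * cnj u2) * ?e (2 * k) x))"
    unfolding pt by (intro integral_add ci) auto
  also have "integral {0..1} (\<lambda>x. 2 * Re ((u1 * cnj u2) * ?e (2 * k) x)) = 0"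
    unfolding integral_mult_right int by simp
  finally have "integral {0..1} (\<lambda>x. (norm (u1 *s exp_fun a k x + u2 *s exp_fun a (- k) x))\<^sup>2)
      = integral {0..1} (\<lambda>x::real. (norm u1)\<^sup>2 + (norm u2)\<^sup>2) + 0" .
  also have "\<dots> = (norm u1)\<^sup>2 + (norm u2)\<^sup>2" by simp
  finally show ?thesis .
qed

text \<open>A triangle inequality for the norm, obtained by comparing square integrals pointwise.\<close>

lemma norm_of_perturbation:
  fixes y z :: "real \<Rightarrow> complex^'m"
  assumes y: "continuous_on {0..1} y" "L2_norm y = 1" and z: "continuous_on {0..1} z"
    and close: "\<And>x. x \<in> {0..1} \<Longrightarrow> norm (y x - z x) \<le> e" and e: "0 \<le> e" "e \<le> 1"
    and r: "r\<^sup>2 = integral {0..1} (\<lambda>x. (norm (z x))\<^sup>2)" "0 \<le> r"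
  shows "\<bar>r - 1\<bar> \<le> 5 * e"
proof -
  have sq: "integral {0..1} (\<lambda>x. (norm (g x))\<^sup>2) \<le> integral {0..1} (\<lambda>x. (norm (f x))\<^sup>2) + 2 * e * I + e\<^sup>2"
    if f: "continuous_on {0..1} f" and g: "continuous_on {0..1} g" and I: "integral {0..1} (\<lambda>x. norm (f x)) \<le> I"
      and fg: "\<And>x. x \<in> {0..1} \<Longrightarrow> norm (g x) \<le> norm (f x) + e"
    for f g :: "real \<Rightarrow> complex^'m" and I
  proof -
    have i1: "(\<lambda>x. (norm (f x))\<^sup>2) integrable_on {0..1}" "(\<lambda>x. 2 * e * norm (f x)) integrable_on {0..1}"
      by (intro integrable_continuous_real continuous_intros f)+
    have "integral {0..1} (\<lambda>x. (norm (g x))\<^sup>2) \<le> integral {0..1} (\<lambda>x. ((norm (f x))\<^sup>2 + 2 * e * norm (f x)) + e\<^sup>2)"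
    proof (rule integral_le)
      fix x :: real assume "x \<in> {0..1}"
      from fg[OF this] have "(norm (g x))\<^sup>2 \<le> (norm (f x) + e)\<^sup>2" by (intro power_mono) auto
      then show "(norm (g x))\<^sup>2 \<le> ((norm (f x))\<^sup>2 + 2 * e * norm (f x)) + e\<^sup>2"
        by (simp add: power2_eq_square algebra_simps)
    qed (intro integrable_continuous_real continuous_intros f g)+
    also have "\<dots> = integral {0..1} (\<lambda>x. (norm (f x))\<^sup>2 + 2 * e * norm (f x)) + integral {0..1} (\<lambda>x::real. e\<^sup>2)"
      by (intro integral_add integrable_add i1 integrable_const_ivl)
    also have "integral {0..1} (\<lambda>x. (norm (f x))\<^sup>2 + 2 * e * norm (f x))
        = integral {0..1} (\<lambda>x. (norm (f x))\<^sup>2) + integral {0..1} (\<lambda>x. 2 * e * norm (f x))"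
      by (rule integral_add[OF i1])
    also have "integral {0..1} (\<lambda>x. 2 * e * norm (f x)) = 2 * e * integral {0..1} (\<lambda>x. norm (f x))" by simp
    also have "\<dots> \<le> 2 * e * I" using I e by (intro mult_left_mono) auto
    finally show ?thesis by simp
  qed
  note y1 = L2_norm_1_integral[OF y]
  have zy: "norm (z x) \<le> norm (y x) + e" if "x \<in> {0..1}" for x
    using close[OF that] norm_triangle_sub[of "z x" "y x"] by (simp add: norm_minus_commute)
  have yz: "norm (y x) \<le> norm (z x) + e" if "x \<in> {0..1}" for x
    using close[OF that] norm_triangle_sub[of "y x" "z x"] by simp
  have "r\<^sup>2 \<le> 1 + 2 * e * 1 + e\<^sup>2" using sq[OF y(1) z y1(2) zy] r(1) y1(1) by simp
  also have "\<dots> = (1 + e)\<^sup>2" by (simp add: power2_eq_square algebra_simps)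
  finally have up: "r \<le> 1 + e" by (rule power2_le_imp_le) (use e in simp)
  have "integral {0..1} (\<lambda>x. norm (z x)) \<le> integral {0..1} (\<lambda>x. norm (y x) + e)"
    by (intro integral_le integrable_continuous_real continuous_intros y z zy)
  also have "\<dots> = integral {0..1} (\<lambda>x. norm (y x)) + e"
    by (subst integral_add) (auto intro!: integrable_continuous_real continuous_intros y)
  also have "\<dots> \<le> 1 + e" using y1(2) by simp
  finally have "integral {0..1} (\<lambda>x. norm (z x)) \<le> 1 + e" .
  from sq[OF z y(1) this yz] have "1 \<le> r\<^sup>2 + 2 * e * (1 + e) + e\<^sup>2" using r(1) y1(1) by simp
  then have low: "1 \<le> r\<^sup>2 + 2 * e + 3 * (e * e)" by (simp add: power2_eq_square algebra_simps)
  have "e * e \<le> 1 * e" using e by (intro mult_right_mono) auto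
  then have "1 - 5 * e \<le> r\<^sup>2" using low by simp
  moreover have "r\<^sup>2 \<le> r" if "r \<le> 1" using that r(2) by (simp add: power2_eq_square mult_left_le)
  ultimately have "1 - 5 * e \<le> r" using e by (cases "r \<le> 1") auto
  then show ?thesis using up e by (simp add: abs_le_iff)
qed

lemma L2_norm_le_sup:
  fixes f :: "real \<Rightarrow> complex^'m"
  assumes f: "continuous_on {0..1} f" and B: "\<And>x. x \<in> {0..1} \<Longrightarrow> norm (f x) \<le> B"
  shows "L2_norm f \<le> B"
proof -
  have B0: "0 \<le> B" using order_trans[OF norm_ge_zero B[of 0]] by simp
  have "integral {0..1} (\<lambda>x. (norm (f x))\<^sup>2) \<le> integral {0..1} (\<lambda>x::real. B\<^sup>2)"
    using B by (intro integral_le integrable_continuous_real continuous_intros f power_mono) auto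
  then have "integral {0..1} (\<lambda>x. (norm (f x))\<^sup>2) \<le> B\<^sup>2" by simp
  then show ?thesis unfolding L2_norm_def using B0 by (simp add: real_le_lsqrt)
qed

lemma inverse_sqrt_powr: "0 < x \<Longrightarrow> x powr (-1/2) = 1 / sqrt x" for x :: real
  using powr_minus_divide[of x "1/2"] by (simp add: powr_half_sqrt)

lemma scaleR_eq_smult: "r *\<^sub>R a = complex_of_real r *s a" for a :: "complex^'m"
proof -
  have "(r *\<^sub>R a) $ i = (complex_of_real r *s a) $ i" for i
    unfolding vector_scaleR_component vector_smult_component by (rule scaleR_conv_of_real)
  then show ?thesis unfolding vec_eq_iff by blast
qed

text \<open>By orthogonality \<open>|u1|\<^sup>2 + |u2|\<^sup>2\<close> is the squared norm \<open>r\<^sup>2\<close> of the superposition, so \<open>r\<close> is close to \<open>1\<close>. Rotating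
  \<open>y\<close> makes \<open>u1\<close> positive, and dividing by \<open>r\<close> replaces \<open>|u1|\<close> by \<open>|u1| / r\<close>, which is the normalizing factor in
  the conclusion.\<close>

lemma two_mode_profile:
  fixes y :: "real \<Rightarrow> complex^'m" and a :: "complex^'m"
  assumes y: "continuous_on {0..1} y" "L2_norm y = 1" and a: "norm a = 1" and k: "k \<noteq> 0"
    and close: "\<And>x. x \<in> {0..1} \<Longrightarrow> norm (y x - (u1 *s exp_fun a k x + u2 *s exp_fun a (- k) x)) \<le> e"
    and e: "0 \<le> e" "e \<le> 1 / 10"
  shows "1 / 4 \<le> (norm u1)\<^sup>2 + (norm u2)\<^sup>2"
    and "u1 \<noteq> 0 \<Longrightarrow> \<exists>c. norm c = 1 \<and>
      L2_norm (\<lambda>x. c *s y x - (1 + (norm (u2 / u1))\<^sup>2) powr (-1/2) *\<^sub>R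
        (exp_fun a k x + (u2 / u1) *s exp_fun a (- k) x)) \<le> 11 * e"
proof -
  define M where "M = (\<lambda>x. u1 *s exp_fun a k x + u2 *s exp_fun a (- k) x)"
  have cM: "continuous_on {0..1} M"
    unfolding M_def by (intro continuous_on_add smult_continuous exp_fun_continuous)
  define r where "r = sqrt ((norm u1)\<^sup>2 + (norm u2)\<^sup>2)"
  have r0: "0 \<le> r" unfolding r_def by simp
  have r2: "r\<^sup>2 = (norm u1)\<^sup>2 + (norm u2)\<^sup>2" unfolding r_def by simp
  have r: "\<bar>r - 1\<bar> \<le> 5 * e"
  proof (rule norm_of_perturbation[OF y cM])
    show "norm (y x - M x) \<le> e" if "x \<in> {0..1}" for x unfolding M_def using close[OF that] .
    show "r\<^sup>2 = integral {0..1} (\<lambda>x. (norm (M x))\<^sup>2)" unfolding r2 M_def two_mode_norm[OF a k] ..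
  qed (use e r0 in auto)
  then have rh: "1 / 2 \<le> r" using e by linarith
  then have "(1 / 2)\<^sup>2 \<le> r\<^sup>2" by (intro power_mono) auto
  then show "1 / 4 \<le> (norm u1)\<^sup>2 + (norm u2)\<^sup>2" unfolding r2 by (simp add: power2_eq_square)
  assume u1: "u1 \<noteq> 0"
  define \<alpha> where "\<alpha> = u2 / u1"
  define s where "s = (1 + (norm \<alpha>)\<^sup>2) powr (-1/2)"
  have u2: "u2 = \<alpha> * u1" unfolding \<alpha>_def using u1 by simp
  have sr: "s = norm u1 / r"
  proof -
    have "r\<^sup>2 = (1 + (norm \<alpha>)\<^sup>2) * (norm u1)\<^sup>2" unfolding r2 u2 norm_mult by (simp add: algebra_simps power_mult_distrib)
    then have "r = sqrt (1 + (norm \<alpha>)\<^sup>2) * norm u1" using r0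
      by (metis real_sqrt_abs2 real_sqrt_mult real_sqrt_pow2 abs_norm_cancel abs_of_nonneg power2_eq_square real_sqrt_abs)
    moreover have pos: "0 < 1 + (norm \<alpha>)\<^sup>2" by (simp add: add_pos_nonneg)
    ultimately show ?thesis unfolding s_def inverse_sqrt_powr[OF pos] using u1 by simp
  qed
  \<comment> \<open>The rotation that makes the coefficient of the first exponential positive.\<close>
  define c where "c = cnj u1 / of_real (norm u1)"
  have c1: "norm c = 1" unfolding c_def using u1 by (simp add: norm_divide)
  have cu1: "c * u1 = of_real (norm u1)"
    unfolding c_def using u1 by (simp add: complex_norm_square[symmetric] power2_eq_square mult.commute[of "cnj u1"] )
  have pt: "norm (c *s y x - s *\<^sub>R (exp_fun a k x + \<alpha> *s exp_fun a (- k) x)) \<le> 11 * e" if x: "x \<in> {0..1}" for x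
  proof -
    let ?W = "exp_fun a k x + \<alpha> *s exp_fun a (- k) x"
    have ef: "norm (exp_fun a p x) = 1" for p
      by (simp only: exp_fun_def norm_smult_complex norm_exp_freq a)
    have nW: "norm ?W \<le> 1 + norm \<alpha>"
      using norm_triangle_ineq[of "exp_fun a k x" "\<alpha> *s exp_fun a (- k) x"]
      by (simp only: norm_smult_complex ef mult_1_right)
    have "c *s M x = (c * u1) *s ?W" unfolding M_def u2 by (simp add: vec_eq_iff algebra_simps)
    then have "c *s y x - s *\<^sub>R ?W = c *s (y x - M x) + (norm u1 - s) *\<^sub>R ?W"
      unfolding cu1 scaleR_eq_smult by (simp add: vec_eq_iff algebra_simps)
    then have "norm (c *s y x - s *\<^sub>R ?W) \<le> norm c * norm (y x - M x) + \<bar>norm u1 - s\<bar> * norm ?W"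
      by (metis norm_triangle_ineq norm_smult_complex norm_scaleR)
    also have "\<dots> \<le> 1 * e + \<bar>norm u1 - s\<bar> * (1 + norm \<alpha>)"
      using c1 close[OF x] nW unfolding M_def by (intro add_mono mult_left_mono) auto
    finally have "norm (c *s y x - s *\<^sub>R ?W) \<le> e + \<bar>norm u1 - s\<bar> * (1 + norm \<alpha>)" by simp
    moreover have "\<bar>norm u1 - s\<bar> * (1 + norm \<alpha>) \<le> 2 * \<bar>r - 1\<bar>"
    proof -
      have "norm u1 - s = norm u1 * ((r - 1) / r)" unfolding sr using rh by (simp add: field_simps)
      then have "\<bar>norm u1 - s\<bar> = norm u1 * (\<bar>r - 1\<bar> / r)" using rh by (simp add: abs_mult)
      then have "\<bar>norm u1 - s\<bar> * (1 + norm \<alpha>) = (norm u1 + norm u2) * (\<bar>r - 1\<bar> / r)"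
        unfolding u2 norm_mult
          by (simp only: ring_distribs mult_1_right mult.commute mult.left_commute)
      also have "\<dots> \<le> (r + r) * (\<bar>r - 1\<bar> / r)"
        using rh unfolding r_def
        by (intro mult_right_mono add_mono real_le_rsqrt divide_nonneg_nonneg) auto
      also have "\<dots> = 2 * \<bar>r - 1\<bar>" using rh by (simp add: field_simps)
      finally show ?thesis .
    qed
    ultimately have "norm (c *s y x - s *\<^sub>R ?W) \<le> e + 2 * \<bar>r - 1\<bar>"
      by (meson add_left_mono order_trans)
    moreover have "2 * \<bar>r - 1\<bar> \<le> 2 * (5 * e)" using r by (rule mult_left_mono) simp
    ultimately show ?thesis by simp
  qed
  have "L2_norm (\<lambda>x. c *s y x - s *\<^sub>R (exp_fun a k x + \<alpha> *s exp_fun a (- k) x)) \<le> 11 * e"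
    by (rule L2_norm_le_sup[OF _ pt])
      (intro continuous_on_diff continuous_on_add continuous_on_scaleR continuous_on_const smult_continuous exp_fun_continuous y)
  then show "\<exists>c. norm c = 1 \<and>
      L2_norm (\<lambda>x. c *s y x - (1 + (norm (u2 / u1))\<^sup>2) powr (-1/2) *\<^sub>R
        (exp_fun a k x + (u2 / u1) *s exp_fun a (- k) x)) \<le> 11 * e"
    using c1 unfolding s_def \<alpha>_def by blast
qed

section \<open>Relative size of the coefficients\<close>

lemma max_b_ge: "norm (b i j k) \<le> max_b b k"
proof -
  have "{norm (b i j k) | i j. True} = (\<lambda>(i, j). norm (b i j k)) ` UNIV" by auto
  then have "finite {norm (b i j k) | i j. True}" by simp
  then show ?thesis unfolding max_b_def by (intro Max_ge) auto
qed

lemma max_b_nonneg: "0 \<le> max_b b k"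
  using max_b_ge[of b undefined undefined k] norm_ge_zero order_trans by blast

lemma d_b_ge:
  assumes "\<sigma> \<in> {1, - 1 :: int}"
  shows "max_b b (\<sigma> * (2 * k)) * max_b b (- \<sigma> * (2 * k)) \<le> d_b b k" "log_ratio k \<le> d_b b k"
  using assms by (auto simp: d_b_def mult.commute)

lemma d_b_minus: "d_b b (- k) = d_b b k"
  by (simp add: d_b_def log_ratio_def mult.commute)

text \<open>Both quantities whose maximum is \<open>d_b\<close> are small relative to \<open>b s s (\<plusminus>2k)\<close>, directly by the limits. That the
  coefficients themselves tend to \<open>0\<close> is hidden in the second limit: \<open>|b s s (2k)|\<close> is at most \<open>max_b b (2k)\<close>, so the
  quotient is at least \<open>max_b b (-2k)\<close>, and conversely. The limits only concern \<open>k \<rightarrow> \<infinity>\<close>, but exchanging \<open>k\<close> and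
  \<open>- k\<close> merely exchanges the two signs.\<close>

lemma d_b_relatively_small:
  fixes b :: "'m::finite \<Rightarrow> 'm \<Rightarrow> int \<Rightarrow> complex"
  assumes nz: "\<And>s \<sigma>. \<sigma> \<in> {1, -1} \<Longrightarrow> \<forall>\<^sub>F k in at_top. b s s (\<sigma> * (2*k)) \<noteq> 0"
    and lim1: "\<And>s \<sigma>. \<sigma> \<in> {1, -1} \<Longrightarrow>
      ((\<lambda>k::int. of_real (ln (real_of_int \<bar>k\<bar>)) / (of_int k * b s s (\<sigma> * (2*k)))) \<longlongrightarrow> 0) at_top"
    and lim2: "\<And>s \<sigma>. \<sigma> \<in> {1, -1} \<Longrightarrow>
      ((\<lambda>k::int. of_real (max_b b (2*k) * max_b b (-2*k)) / b s s (\<sigma> * (2*k))) \<longlongrightarrow> 0) at_top"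
    and \<eta>: "\<eta> > 0"
  shows "\<exists>K. \<forall>k s. \<forall>\<sigma>\<in>{1, -1}. K \<le> \<bar>k\<bar> \<longrightarrow>
      b s s (\<sigma> * (2*k)) \<noteq> 0 \<and> d_b b k \<le> \<eta> * norm (b s s (\<sigma> * (2*k))) \<and> max_b b (\<sigma> * (2*k)) \<le> \<eta>"
proof -
  \<comment> \<open>The last bound has the opposite sign \<open>- \<sigma>\<close>, since this is what the second limit yields for \<open>\<sigma>\<close>.\<close>
  define Q where "Q = (\<lambda>k s \<sigma>. b s s (\<sigma> * (2*k)) \<noteq> 0 \<and> d_b b k \<le> \<eta> * norm (b s s (\<sigma> * (2*k)))
      \<and> max_b b (- \<sigma> * (2*k)) \<le> \<eta>)"
  have "\<forall>\<^sub>F k in at_top. \<forall>s. \<forall>\<sigma>\<in>{1, -1}. Q k s \<sigma>"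
  proof (intro eventually_all_finite eventually_ball_finite ballI)
    fix s and \<sigma> :: int assume \<sigma>: "\<sigma> \<in> {1, -1}"
    have e1: "\<forall>\<^sub>F k::int in at_top. norm (of_real (ln (real_of_int \<bar>k\<bar>)) / (of_int k * b s s (\<sigma> * (2*k)))) < \<eta>"
      using order_tendstoD(2)[OF tendsto_norm_zero[OF lim1[OF \<sigma>, of s]] \<eta>] .
    have e2: "\<forall>\<^sub>F k::int in at_top. norm (of_real (max_b b (2*k) * max_b b (-2*k)) / b s s (\<sigma> * (2*k))) < \<eta>"
      using order_tendstoD(2)[OF tendsto_norm_zero[OF lim2[OF \<sigma>, of s]] \<eta>] .
    show "\<forall>\<^sub>F k in at_top. Q k s \<sigma>"
      using e1 e2 nz[OF \<sigma>, of s] eventually_ge_at_top[of 1]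
    proof eventually_elim
      case (elim k)
      define \<beta> where "\<beta> = norm (b s s (\<sigma> * (2*k)))"
      have \<beta>: "\<beta> > 0" unfolding \<beta>_def using elim(3) by simp
      have k: "real_of_int k \<ge> 1" "\<bar>k\<bar> = k" using elim(4) by auto
      have "log_ratio k / \<beta> < \<eta>"
        using elim(1) k unfolding log_ratio_def \<beta>_def by (simp add: norm_divide norm_mult)
      then have 1: "log_ratio k \<le> \<eta> * \<beta>" using \<beta> by (simp add: field_simps)
      have "max_b b (2*k) * max_b b (-2*k) / \<beta> < \<eta>"
        using elim(2) max_b_nonneg[of b] unfolding \<beta>_def by (simp add: norm_divide norm_mult)
      then have 2: "max_b b (2*k) * max_b b (-2*k) \<le> \<eta> * \<beta>" using \<beta> by (simp add: field_simps)
      have m: "max_b b (2*k) * max_b b (-2*k) = max_b b (\<sigma> * (2*k)) * max_b b (- \<sigma> * (2*k))"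
        using \<sigma> by auto
      have "\<beta> * max_b b (- \<sigma> * (2*k)) \<le> max_b b (\<sigma> * (2*k)) * max_b b (- \<sigma> * (2*k))"
        unfolding \<beta>_def by (intro mult_right_mono max_b_ge max_b_nonneg)
      then have "\<beta> * max_b b (- \<sigma> * (2*k)) \<le> \<beta> * \<eta>" using 2 m by (simp add: mult.commute)
      then have "max_b b (- \<sigma> * (2*k)) \<le> \<eta>" using \<beta> by simp
      then show ?case unfolding Q_def d_b_def using 1 2 elim(3) unfolding \<beta>_def by simp
    qed
  qed auto
  then obtain K0 where K0: "\<And>k s \<sigma>. K0 \<le> k \<Longrightarrow> \<sigma> \<in> {1, -1} \<Longrightarrow> Q k s \<sigma>"
    unfolding eventually_at_top_linorder by blast
  show ?thesis
  proof (intro exI[of _ K0] allI ballI impI)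
    fix k :: int and s \<sigma> assume k: "K0 \<le> \<bar>k\<bar>" and \<sigma>: "\<sigma> \<in> {1, - 1 :: int}"
    show "b s s (\<sigma> * (2*k)) \<noteq> 0 \<and> d_b b k \<le> \<eta> * norm (b s s (\<sigma> * (2*k))) \<and> max_b b (\<sigma> * (2*k)) \<le> \<eta>"
    proof (cases "0 \<le> k")
      case True
      then have "Q k s \<sigma>" "Q k s (- \<sigma>)" using K0[of k] k \<sigma> by auto
      then show ?thesis unfolding Q_def by simp
    next
      case False
      then have "Q (- k) s \<sigma>" "Q (- k) s (- \<sigma>)" using K0[of "- k"] k \<sigma> by auto
      then show ?thesis unfolding Q_def d_b_minus by simp
    qed
  qed
qed

lemma distinct_values_separated:
  fixes \<mu> :: "'m::finite \<Rightarrow> complex"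
  assumes "inj \<mu>"
  obtains \<Delta> where "\<Delta> > 0" "\<And>i j. i \<noteq> j \<Longrightarrow> \<Delta> \<le> norm (\<mu> i - \<mu> j)"
proof -
  let ?S = "insert 1 ((\<lambda>(i, j). norm (\<mu> i - \<mu> j)) ` {(i, j). i \<noteq> j})"
  have fin: "finite ?S" by simp
  show thesis
  proof (rule that[of "Min ?S"])
    show "Min ?S > 0" using assms by (subst Min_gr_iff[OF fin]) (auto dest: injD)
    show "Min ?S \<le> norm (\<mu> i - \<mu> j)" if "i \<noteq> j" for i j
      using that by (intro Min_le[OF fin]) auto
  qed
qed

section \<open>Reduction to one pair of amplitudes\<close>

context resonant_operator
begin

abbreviation b :: "'m \<Rightarrow> 'm \<Rightarrow> int \<Rightarrow> complex" where
  "b \<equiv> coeff_b (P 2) v w"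

lemma norm_freq_power_ge: "real_of_int \<bar>k\<bar> ^ r \<le> norm (freq k ^ r)"
proof -
  have "1 * \<bar>real_of_int k\<bar> \<le> 2 * pi * \<bar>real_of_int k\<bar>" using pi_gt3 by (intro mult_right_mono) auto
  then show ?thesis unfolding norm_power norm_freq by (intro power_mono) auto
qed

lemma norm_freq_power_le: "r \<le> n \<Longrightarrow> norm (freq k ^ r) \<le> (2 * pi) ^ n * real_of_int \<bar>k\<bar> ^ r"
proof -
  assume "r \<le> n"
  then have "(2 * pi) ^ r \<le> (2 * pi) ^ n" using pi_gt3 by (intro power_increasing) auto
  then show ?thesis
    unfolding norm_power norm_freq power_mult_distrib[of "2 * pi"] of_int_abs by (rule mult_right_mono) simp
qed

text \<open>In the system for the amplitudes, those with \<open>s \<noteq> j\<close> are multiplied by \<open>l - mu_approx n \<mu> k s\<close>, which is at least of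
  order \<open>|k|\<^sup>n\<^sup>-\<^sup>2\<close>, and are therefore of order \<open>max_b b (\<plusminus>2k) + log_ratio k\<close>. In the two equations with index \<open>j\<close>
  each of them is multiplied by a coefficient \<open>b j s\<close> at the frequency of the other sign, and the product is at most of
  order \<open>d_b b k\<close>.\<close>

theorem reduced_system:
  assumes c: "0 \<le> c" and g: "0 < g"
  shows "\<exists>G K. 1 \<le> G \<and> 3 \<le> K \<and> (\<forall>k j l y. K \<le> \<bar>k\<bar> \<longrightarrow>
     norm (l - mu_approx n \<mu> k j) \<le> c * real_of_int \<bar>k\<bar> ^ (n - 2) \<longrightarrow>
     (\<forall>s. s \<noteq> j \<longrightarrow> g * real_of_int \<bar>k\<bar> ^ (n - 2) \<le> norm (l - mu_approx n \<mu> k s)) \<longrightarrow>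
     max_b b (2 * k) \<le> 1 \<longrightarrow> max_b b (- 2 * k) \<le> 1 \<longrightarrow>
     y \<in> eigenspace n P l \<longrightarrow> L2_norm y = 1 \<longrightarrow>
     (\<forall>\<sigma>\<in>{1, - 1}. norm ((l - mu_approx n \<mu> k j) / freq k ^ (n - 2) * amplitude y (\<sigma> * k) j
         - b j j (\<sigma> * (2 * k)) * amplitude y (- \<sigma> * k) j) \<le> G * d_b b k) \<and>
     (\<forall>x\<in>{0..1}. norm (y x - (amplitude y k j *s exp_fun (v j) k x + amplitude y (- k) j *s exp_fun (v j) (- k) x))
       \<le> G * (max_b b (2 * k) + max_b b (- 2 * k) + log_ratio k)) \<and>
     (\<forall>\<sigma>\<in>{1, - 1}. norm (amplitude y (\<sigma> * k) j) \<le> G))"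
proof -
  define S where "S = (\<Sum>j\<in>UNIV. norm (\<mu> j))"
  have S: "norm (\<mu> j) \<le> S" for j unfolding S_def by (rule member_le_sum) auto
  define c' where "c' = c + S * (2 * pi) ^ n"
  obtain C K where C: "0 < C" "3 \<le> K" and CK: "\<And>k l y. K \<le> \<bar>k\<bar> \<Longrightarrow>
     norm (l - freq k ^ n) \<le> c' * real_of_int \<bar>k\<bar> ^ (n - 2) \<Longrightarrow>
     y \<in> eigenspace n P l \<Longrightarrow> L2_norm y = 1 \<Longrightarrow>
     (\<forall>p\<in>{k, - k}. \<forall>s. norm ((l - mu_approx n \<mu> k s) * amplitude y p s
         - freq k ^ (n - 2) * (\<Sum>q\<in>UNIV. b s q (2 * p) * amplitude y (- p) q))
       \<le> C * real_of_int \<bar>k\<bar> ^ (n - 2) * log_ratio k) \<and>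
     (\<forall>x\<in>{0..1}. norm (y x - (\<Sum>q\<in>UNIV. amplitude y k q *s exp_fun (v q) k x + amplitude y (- k) q *s exp_fun (v q) (- k) x))
       \<le> C * log_ratio k) \<and>
     (\<forall>p\<in>{k, - k}. \<forall>s. norm (amplitude y p s) \<le> C)"
    using resonant_system[of c'] by blast
  define m where "m = real CARD('m)"
  have m0: "0 \<le> m" unfolding m_def by simp
  define H where "H = ((2 * pi) ^ n * m * C + C) / g"
  have H0: "0 \<le> H" unfolding H_def using g C m0 by simp
  define G where "G = 1 + C + 2 * (m * H)"
  have G: "1 \<le> G" "C \<le> G" unfolding G_def using C m0 H0 by (auto simp: algebra_simps)
  show ?thesis
  proof (intro exI[of _ G] exI[of _ K] conjI allI impI)
    show "1 \<le> G" "3 \<le> K" by fact+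
    fix k j l and y :: "real \<Rightarrow> complex^'m"
    assume kK: "K \<le> \<bar>k\<bar>" and lj: "norm (l - mu_approx n \<mu> k j) \<le> c * real_of_int \<bar>k\<bar> ^ (n - 2)"
      and ls: "\<forall>s. s \<noteq> j \<longrightarrow> g * real_of_int \<bar>k\<bar> ^ (n - 2) \<le> norm (l - mu_approx n \<mu> k s)"
      and b1: "max_b b (2 * k) \<le> 1" "max_b b (- 2 * k) \<le> 1"
      and y: "y \<in> eigenspace n P l" "L2_norm y = 1"
    define \<kappa> where "\<kappa> = real_of_int \<bar>k\<bar>"
    have k3: "3 \<le> \<bar>k\<bar>" using kK C by linarith
    have \<kappa>1: "1 \<le> \<kappa>" using k3 unfolding \<kappa>_def by linarith
    have LR: "0 < log_ratio k" using log_ratio_bounds(2)[OF k3] .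
    have d0: "0 \<le> d_b b k" using LR d_b_ge(2)[of 1 k b] by simp
    have M0: "0 \<le> max_b b (2 * k)" "0 \<le> max_b b (- 2 * k)" by (rule max_b_nonneg)+
    have pw: "0 < \<kappa> ^ (n - 2)" using \<kappa>1 by simp
    define F where "F = freq k ^ (n - 2)"
    have F: "\<kappa> ^ (n - 2) \<le> norm F" "norm F \<le> (2 * pi) ^ n * \<kappa> ^ (n - 2)"
      unfolding F_def \<kappa>_def using norm_freq_power_ge norm_freq_power_le by auto
    have F0: "F \<noteq> 0" using F(1) pw by auto
    have "norm (l - freq k ^ n) \<le> norm (l - mu_approx n \<mu> k j) + norm (\<mu> j * F)"
      unfolding mu_approx_def F_def using norm_triangle_ineq[of "l - mu_approx n \<mu> k j" "\<mu> j * F"]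
      by (simp add: mu_approx_def F_def algebra_simps)
    also have "\<dots> \<le> c * \<kappa> ^ (n - 2) + S * ((2 * pi) ^ n * \<kappa> ^ (n - 2))"
      unfolding norm_mult using lj F S order_trans[OF norm_ge_zero S] by (intro add_mono mult_mono) (auto simp: \<kappa>_def)
    finally have "norm (l - freq k ^ n) \<le> c' * real_of_int \<bar>k\<bar> ^ (n - 2)"
      unfolding c'_def \<kappa>_def by (simp add: algebra_simps)
    note ck = CK[OF kK this y]
    have est: "norm ((l - mu_approx n \<mu> k s) * amplitude y (\<sigma> * k) s
        - F * (\<Sum>q\<in>UNIV. b s q (\<sigma> * (2 * k)) * amplitude y (- \<sigma> * k) q)) \<le> C * \<kappa> ^ (n - 2) * log_ratio k"
      if "\<sigma> \<in> {1, - 1}" for s \<sigma>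
    proof -
      have p: "\<sigma> * k \<in> {k, - k}" using that by auto
      have eqs: "2 * (\<sigma> * k) = \<sigma> * (2 * k)" "- (\<sigma> * k) = - \<sigma> * k" by auto
      show ?thesis
        using conjunct1[OF ck, rule_format, OF p, of s] unfolding eqs F_def \<kappa>_def .
    qed
    have cb: "norm (amplitude y (\<sigma> * k) s) \<le> C" if "\<sigma> \<in> {1, - 1}" for s \<sigma>
      using ck that by auto
    then show "\<forall>\<sigma>\<in>{1, - 1}. norm (amplitude y (\<sigma> * k) j) \<le> G" using G(2) order_trans by blast
    have bnd: "max_b b (\<sigma> * (2 * k)) \<le> 1" if "\<sigma> \<in> {1, - 1}" for \<sigma> using that b1 by auto
    have minus: "- \<sigma> \<in> {1, - 1}" if "\<sigma> \<in> {1, - 1 :: int}" for \<sigma> using that by auto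
    have off: "norm (amplitude y (\<sigma> * k) s) \<le> H * (max_b b (\<sigma> * (2 * k)) + log_ratio k)"
      if \<sigma>: "\<sigma> \<in> {1, - 1}" and s: "s \<noteq> j" for \<sigma> s
    proof -
      let ?\<beta> = "max_b b (\<sigma> * (2 * k))"
      let ?T = "\<Sum>q\<in>UNIV. b s q (\<sigma> * (2 * k)) * amplitude y (- \<sigma> * k) q"
      have "norm ?T \<le> real CARD('m) * (?\<beta> * C)"
        using cb[OF minus[OF \<sigma>]] by (intro sum_norm_bound) (auto simp: norm_mult intro!: mult_mono max_b_ge max_b_nonneg)
      then have T: "norm (F * ?T) \<le> ((2 * pi) ^ n * \<kappa> ^ (n - 2)) * (m * (?\<beta> * C))"
        unfolding norm_mult m_def using F pw by (intro mult_mono) auto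
      have "(g * \<kappa> ^ (n - 2)) * norm (amplitude y (\<sigma> * k) s) \<le> norm (l - mu_approx n \<mu> k s) * norm (amplitude y (\<sigma> * k) s)"
        using ls s by (intro mult_right_mono) (auto simp: \<kappa>_def)
      also have "\<dots> = norm ((l - mu_approx n \<mu> k s) * amplitude y (\<sigma> * k) s)" by (simp add: norm_mult)
      also have "\<dots> \<le> norm (F * ?T) + C * \<kappa> ^ (n - 2) * log_ratio k"
        using est[OF \<sigma>, of s] norm_triangle_sub[of "(l - mu_approx n \<mu> k s) * amplitude y (\<sigma> * k) s" "F * ?T"] by linarith
      also have "\<dots> \<le> ((2 * pi) ^ n * \<kappa> ^ (n - 2)) * (m * (?\<beta> * C)) + C * \<kappa> ^ (n - 2) * log_ratio k"
        using T by simp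
      also have "\<dots> = \<kappa> ^ (n - 2) * ((2 * pi) ^ n * m * C * ?\<beta> + C * log_ratio k)" by (simp add: algebra_simps)
      also have "\<dots> \<le> \<kappa> ^ (n - 2) * (((2 * pi) ^ n * m * C + C) * (?\<beta> + log_ratio k))"
      proof (rule mult_left_mono)
        have "0 \<le> (2 * pi) ^ n * m * C * log_ratio k" "0 \<le> C * ?\<beta>"
          using m0 C LR max_b_nonneg[of b "\<sigma> * (2 * k)"] by auto
        then show "(2 * pi) ^ n * m * C * ?\<beta> + C * log_ratio k
            \<le> ((2 * pi) ^ n * m * C + C) * (?\<beta> + log_ratio k)" by (simp add: algebra_simps)
      qed (use pw in simp)
      finally have "\<kappa> ^ (n - 2) * (g * norm (amplitude y (\<sigma> * k) s))
          \<le> \<kappa> ^ (n - 2) * (((2 * pi) ^ n * m * C + C) * (?\<beta> + log_ratio k))" by (simp add: mult_ac)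
      then have "g * norm (amplitude y (\<sigma> * k) s) \<le> ((2 * pi) ^ n * m * C + C) * (?\<beta> + log_ratio k)"
        using pw by (subst (asm) mult_le_cancel_left_pos) auto
      then show ?thesis unfolding H_def using g by (simp add: field_simps)
    qed
    show "\<forall>\<sigma>\<in>{1, - 1}. norm ((l - mu_approx n \<mu> k j) / freq k ^ (n - 2) * amplitude y (\<sigma> * k) j
         - b j j (\<sigma> * (2 * k)) * amplitude y (- \<sigma> * k) j) \<le> G * d_b b k"
    proof
      fix \<sigma> :: int assume \<sigma>: "\<sigma> \<in> {1, - 1}"
      let ?\<beta> = "max_b b (\<sigma> * (2 * k))"
      let ?\<beta>' = "max_b b (- \<sigma> * (2 * k))"
      let ?t = "\<lambda>q. b j q (\<sigma> * (2 * k)) * amplitude y (- \<sigma> * k) q"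
      define R where "R = (l - mu_approx n \<mu> k j) * amplitude y (\<sigma> * k) j - F * (\<Sum>q\<in>UNIV. ?t q)"
      have "norm R \<le> C * \<kappa> ^ (n - 2) * log_ratio k" unfolding R_def by (rule est[OF \<sigma>])
      also have "\<dots> \<le> C * norm F * log_ratio k" using F C LR by (intro mult_right_mono mult_left_mono) auto
      finally have "norm (R / F) \<le> C * log_ratio k" using F0 by (simp add: norm_divide field_simps)
      moreover have "log_ratio k \<le> d_b b k" using d_b_ge(2)[OF \<sigma>] .
      ultimately have RF: "norm (R / F) \<le> C * d_b b k" using C mult_left_mono[of "log_ratio k" "d_b b k" C] by linarith
      have split: "(\<Sum>q\<in>UNIV. ?t q) = ?t j + (\<Sum>q\<in>UNIV - {j}. ?t q)" 
        by (rule sum.remove[of UNIV j ?t]) auto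
      \<comment> \<open>Here the two maxima with opposite signs meet, and their product is part of \<open>d_b\<close>.\<close>
      have tq: "norm (?t q) \<le> H * (2 * d_b b k)" if "q \<in> UNIV - {j}" for q
      proof -
        have "norm (?t q) \<le> ?\<beta> * (H * (?\<beta>' + log_ratio k))"
          unfolding norm_mult using off[OF minus[OF \<sigma>], of q] that
          by (intro mult_mono max_b_ge max_b_nonneg) auto
        also have "\<dots> = H * (?\<beta> * ?\<beta>' + ?\<beta> * log_ratio k)" by (simp add: algebra_simps)
        also have "\<dots> \<le> H * (d_b b k + 1 * d_b b k)"
          using d_b_ge[OF \<sigma>] bnd[OF \<sigma>] H0 LR max_b_nonneg by (intro mult_left_mono add_mono mult_mono) auto
        finally show ?thesis by simp
      qed
      have "norm (\<Sum>q\<in>UNIV - {j}. ?t q) \<le> real (card (UNIV - {j})) * (H * (2 * d_b b k))"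
        by (rule sum_norm_bound) (rule tq)
      also have "\<dots> \<le> m * (H * (2 * d_b b k))"
        unfolding m_def using H0 d0 by (intro mult_right_mono) (auto simp: card_Diff_subset)
      finally have rest: "norm (\<Sum>q\<in>UNIV - {j}. ?t q) \<le> m * (H * (2 * d_b b k))" .
      have "(l - mu_approx n \<mu> k j) / F * amplitude y (\<sigma> * k) j - ?t j = R / F + (\<Sum>q\<in>UNIV - {j}. ?t q)"
        unfolding R_def split using F0 by (simp add: field_simps)
      then have "norm ((l - mu_approx n \<mu> k j) / F * amplitude y (\<sigma> * k) j - ?t j) \<le> C * d_b b k + m * (H * (2 * d_b b k))"
        using norm_triangle_mono[OF RF rest] by simp
      also have "\<dots> \<le> G * d_b b k"
        unfolding G_def using d0 by (simp add: algebra_simps)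
      finally show "norm ((l - mu_approx n \<mu> k j) / freq k ^ (n - 2) * amplitude y (\<sigma> * k) j
         - b j j (\<sigma> * (2 * k)) * amplitude y (- \<sigma> * k) j) \<le> G * d_b b k" unfolding F_def .
    qed
    show "\<forall>x\<in>{0..1}. norm (y x - (amplitude y k j *s exp_fun (v j) k x + amplitude y (- k) j *s exp_fun (v j) (- k) x))
       \<le> G * (max_b b (2 * k) + max_b b (- 2 * k) + log_ratio k)"
    proof
      fix x :: real assume x: "x \<in> {0..1}"
      let ?E = "max_b b (2 * k) + max_b b (- 2 * k) + log_ratio k"
      let ?t = "\<lambda>q. amplitude y k q *s exp_fun (v q) k x + amplitude y (- k) q *s exp_fun (v q) (- k) x"
      have E0: "0 \<le> ?E" "log_ratio k \<le> ?E" using M0 LR by auto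
      have ef: "norm (exp_fun (v q) p x) = 1" for q p
        by (simp only: exp_fun_def norm_smult_complex norm_exp_freq norm_v)
      have tq: "norm (?t q) \<le> H * (2 * ?E)" if "q \<in> UNIV - {j}" for q
      proof -
        have "norm (?t q) \<le> norm (amplitude y k q) + norm (amplitude y (- k) q)"
          using norm_triangle_ineq[of "amplitude y k q *s exp_fun (v q) k x" "amplitude y (- k) q *s exp_fun (v q) (- k) x"]
          by (simp only: norm_smult_complex ef mult_1_right)
        also have "\<dots> \<le> H * (max_b b (2 * k) + log_ratio k) + H * (max_b b (- 2 * k) + log_ratio k)"
          using off[of 1 q] off[of "- 1" q] that by (intro add_mono) auto
        also have "\<dots> = H * ((max_b b (2 * k) + log_ratio k) + (max_b b (- 2 * k) + log_ratio k))"
          by (simp add: algebra_simps)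
        also have "\<dots> \<le> H * (2 * ?E)" using H0 M0 by (intro mult_left_mono) auto
        finally show ?thesis .
      qed
      have "norm (\<Sum>q\<in>UNIV - {j}. ?t q) \<le> real (card (UNIV - {j})) * (H * (2 * ?E))"
        by (rule sum_norm_bound) (rule tq)
      also have "\<dots> \<le> m * (H * (2 * ?E))"
        unfolding m_def using H0 E0 by (intro mult_right_mono mult_nonneg_nonneg) (auto simp: card_Diff_subset)
      finally have rest: "norm (\<Sum>q\<in>UNIV - {j}. ?t q) \<le> m * (H * (2 * ?E))" .
      have split: "(\<Sum>q\<in>UNIV. ?t q) = ?t j + (\<Sum>q\<in>UNIV - {j}. ?t q)" 
        by (rule sum.remove[of UNIV j ?t]) auto
      have "norm (y x - (\<Sum>q\<in>UNIV. ?t q)) \<le> C * log_ratio k" using ck x by blast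
      also have "\<dots> \<le> C * ?E" using C E0 by (intro mult_left_mono) auto
      finally have main: "norm (y x - (\<Sum>q\<in>UNIV. ?t q)) \<le> C * ?E" .
      have eq: "y x - ?t j = (y x - (\<Sum>q\<in>UNIV. ?t q)) + (\<Sum>q\<in>UNIV - {j}. ?t q)" unfolding split by simp
      have "norm (y x - ?t j) \<le> C * ?E + m * (H * (2 * ?E))"
        unfolding eq by (rule norm_triangle_mono[OF main rest])
      also have "\<dots> \<le> G * ?E" unfolding G_def using E0 by (simp add: algebra_simps)
      finally show "norm (y x - ?t j) \<le> G * ?E" .
    qed
  qed
qed

section \<open>Simplicity of the eigenvalues\<close>

lemma amplitude_lincomb:
  assumes "y \<in> eigenspace n P l" "z \<in> eigenspace n P l"
  shows "amplitude (\<lambda>x. \<alpha> *s y x + \<beta> *s z x) p s = \<alpha> * amplitude y p s + \<beta> * amplitude z p s"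
proof -
  have ai: "(\<lambda>x. c * y x $ i) absolutely_integrable_on {0..1}" "(\<lambda>x. c * z x $ i) absolutely_integrable_on {0..1}" for c i
    using component_continuous[OF assms(1), of 0 i] component_continuous[OF assms(2), of 0 i] n2
    by (auto intro!: absolutely_integrable_continuous_real continuous_on_mult continuous_on_const)
  have "fourier_vec (\<lambda>x. \<alpha> *s y x + \<beta> *s z x) p = \<alpha> *s fourier_vec y p + \<beta> *s fourier_vec z p"
    unfolding vec_eq_iff fourier_vec_def
    by (simp add: fourier_coeff_add[OF ai] fourier_coeff_cmult)
  then show ?thesis unfolding amplitude_def by (simp add: cdot_add cdot_scale)
qed

lemma L2_norm_scale: "L2_norm (\<lambda>x. c *s y x) = norm c * L2_norm y" for y :: "real \<Rightarrow> complex^'m"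
  unfolding L2_norm_def norm_smult_complex power_mult_distrib
  by (simp add: real_sqrt_mult)

lemma normalizable:
  assumes y: "y \<in> eigenspace n P l" "y \<noteq> (\<lambda>x. 0)"
  shows "0 < L2_norm y" "(\<lambda>x. of_real (1 / L2_norm y) *s y x) \<in> eigenspace n P l"
    "L2_norm (\<lambda>x. of_real (1 / L2_norm y) *s y x) = 1"
proof -
  interpret y: domain_function n P y by (rule domain_function[OF y(1)])
  have cy: "continuous_on {0..1} y" using y.continuous_deriv[of 0] n2 by simp
  obtain x0 where x0: "y x0 \<noteq> 0" using y(2) by auto
  then have x01: "x0 \<in> {0..1}" using y.vanishes by blast
  have nn: "0 \<le> integral {0..1} (\<lambda>x. (norm (y x))\<^sup>2)"
    by (intro integral_nonneg integrable_continuous_real continuous_intros cy) auto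
  have "integral {0..1} (\<lambda>x. (norm (y x))\<^sup>2) \<noteq> 0"
  proof
    assume "integral {0..1} (\<lambda>x. (norm (y x))\<^sup>2) = 0"
    then have "\<forall>x\<in>{0..1}. (norm (y x))\<^sup>2 = 0"
      by (subst (asm) integral_eq_0_iff) (auto intro!: continuous_intros cy)
    then show False using x0 x01 by auto
  qed
  then show pos: "0 < L2_norm y" unfolding L2_norm_def using nn by simp
  show "(\<lambda>x. of_real (1 / L2_norm y) *s y x) \<in> eigenspace n P l"
    using eigenspace_lincomb[OF n2 y(1) y(1), of "of_real (1 / L2_norm y)" 0] by simp
  show "L2_norm (\<lambda>x. of_real (1 / L2_norm y) *s y x) = 1"
    unfolding L2_norm_scale norm_of_real using pos by simp
qed

text \<open>Subtracting a suitable multiple of one normalized eigenfunction from another makes the amplitude vanish, which only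
  the zero function allows.\<close>

lemma eigenspace_one_dimensional:
  assumes l: "is_eigenvalue n P l"
    and nz: "\<And>y. y \<in> eigenspace n P l \<Longrightarrow> L2_norm y = 1 \<Longrightarrow> amplitude y p s \<noteq> 0"
  shows "geom_mult n P l = 1"
    and "\<And>y z. y \<in> eigenspace n P l \<Longrightarrow> L2_norm y = 1 \<Longrightarrow> z \<in> eigenspace n P l \<Longrightarrow> \<exists>a. z = (\<lambda>x. a *s y x)"
proof -
  show multiple: "\<exists>a. z = (\<lambda>x. a *s y x)" if y: "y \<in> eigenspace n P l" "L2_norm y = 1" and z: "z \<in> eigenspace n P l" for y z
  proof -
    define a where "a = amplitude z p s / amplitude y p s"
    define f where "f = (\<lambda>x. 1 *s z x + (- a) *s y x)"
    have fe: "f \<in> eigenspace n P l" unfolding f_def by (rule eigenspace_lincomb[OF n2 z y(1)])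
    have f0: "amplitude f p s = 0" unfolding f_def amplitude_lincomb[OF z y(1)] a_def using nz[OF y] by simp
    have "f = (\<lambda>x. 0)"
    proof (rule ccontr)
      assume ne: "f \<noteq> (\<lambda>x. 0)"
      let ?r = "complex_of_real (1 / L2_norm f)"
      have "amplitude (\<lambda>x. ?r *s f x) p s \<noteq> 0" by (rule nz[OF normalizable(2,3)[OF fe ne]])
      moreover have "amplitude (\<lambda>x. ?r *s f x + 0 *s f x) p s = 0" unfolding amplitude_lincomb[OF fe fe] f0 by simp
      ultimately show False by simp
    qed
    then have "f x = 0" for x by (simp add: fun_eq_iff)
    then have "z x = a *s y x" for x unfolding f_def by (simp add: vec_eq_iff)
    then show ?thesis by blast
  qed
  obtain y0 where y0: "y0 \<in> eigenspace n P l" "y0 \<noteq> (\<lambda>x. 0)" using l unfolding is_eigenvalue_def by blast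
  define y where "y = (\<lambda>x. complex_of_real (1 / L2_norm y0) *s y0 x)"
  have y: "y \<in> eigenspace n P l" "L2_norm y = 1" unfolding y_def using normalizable[OF y0] by auto
  have yn: "y \<noteq> 0"
  proof
    assume "y = 0"
    then have "L2_norm y = 0" by (simp add: L2_norm_def)
    then show False using y by simp
  qed
  have "eigenspace n P l \<subseteq> fun_vs.span {y}"
  proof
    fix z assume "z \<in> eigenspace n P l"
    then obtain a where "z = fun_scale a y" using multiple[OF y] unfolding fun_scale_def by blast
    then show "z \<in> fun_vs.span {y}" by (auto intro: fun_vs.span_scale fun_vs.span_base)
  qed
  moreover have "fun_vs.independent {y}" using yn by (simp add: fun_vs.dependent_single)
  ultimately have "fun_vs.dim (eigenspace n P l) = card {y}"
    using y(1) by (intro fun_vs.dim_unique[of "{y}"]) auto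
  then show "geom_mult n P l = 1" unfolding geom_mult_def by simp
qed

end

section \<open>Location of the eigenvalues and shape of the eigenfunctions\<close>

theorem theorem2:
  fixes n :: nat
    and P :: "nat \<Rightarrow> real \<Rightarrow> complex^'m^'m"
    and \<mu> :: "'m \<Rightarrow> complex"
    and v w :: "'m \<Rightarrow> complex^'m"
    and b :: "'m \<Rightarrow> 'm \<Rightarrow> int \<Rightarrow> complex"
    and q :: "int \<Rightarrow> 'm \<Rightarrow> complex"
    and N N0 :: int
    and c3 :: real
    and lam0 :: "int \<Rightarrow> 'm \<Rightarrow> complex"
    and \<Psi>0 :: "int \<Rightarrow> 'm \<Rightarrow> real \<Rightarrow> complex^'m"
  assumes n: "even n" "2 \<le> n"
    and summable_P: "\<And>\<nu> i j. 2 \<le> \<nu> \<Longrightarrow> \<nu> \<le> n \<Longrightarrow>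
          (\<lambda>x. P \<nu> x $ i $ j) absolutely_integrable_on {0..1}"
    and eigenvalues_C: "\<And>z. det (mat z - mean_matrix (P 2)) = (\<Prod>j\<in>UNIV. z - \<mu> j)"
    and simple_C: "inj \<mu>"
    and v: "\<And>j. mean_matrix (P 2) *v v j = \<mu> j *s v j" "\<And>j. norm (v j) = 1"
    and w: "\<And>j. adjoint_matrix (mean_matrix (P 2)) *v w j = cnj (\<mu> j) *s w j"
           "\<And>j. cdot (w j) (v j) = 1"
    and b: "b = coeff_b (P 2) v w"
    and q: "\<And>k j. (q k j)\<^sup>2 = b j j k * b j j (-k)"
    and N: "1 \<le> N"
    and sequences: "eigenvalue_sequences n P N lam0"
    and eigenfunctions: "\<And>k j. N \<le> \<bar>k\<bar> \<Longrightarrow> normalized_eigenfunction n P (lam0 k j) (\<Psi>0 k j)"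
    and c3: "0 < c3"
      "\<And>k j s \<sigma>. N \<le> \<bar>k\<bar> \<Longrightarrow> \<sigma> \<in> {1, -1} \<Longrightarrow>
         norm ((lam0 k j - mu_approx n \<mu> k s) * L2_inner (\<Psi>0 k j) (exp_fun (w s) (\<sigma> * k)))
           < c3 * real_of_int k ^ (n-2) * (max_b b (\<sigma> * (2*k)) + log_ratio k)"
    and N0: "N \<le> N0"
      "\<And>k i j. N0 \<le> \<bar>k\<bar> \<Longrightarrow> i \<noteq> j \<Longrightarrow>
         ball (mu_approx n \<mu> k i) (eps_radius n c3 v b k)
           \<inter> ball (mu_approx n \<mu> k j) (eps_radius n c3 v b k) = {}"
      "\<And>k j. N0 \<le> \<bar>k\<bar> \<Longrightarrow>
         lam0 k j \<in> (\<Union>s. ball (mu_approx n \<mu> k s) (eps_radius n c3 v b k))"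
      "\<And>k j. N0 \<le> \<bar>k\<bar> \<Longrightarrow>
         num_eigenvalues_in n P (ball (mu_approx n \<mu> k j) (eps_radius n c3 v b k)) = 2"
    and b_nonzero: "\<And>s \<sigma>. \<sigma> \<in> {1, -1} \<Longrightarrow> \<forall>\<^sub>F k in at_top. b s s (\<sigma> * (2*k)) \<noteq> 0"
    and lim1: "\<And>s \<sigma>. \<sigma> \<in> {1, -1} \<Longrightarrow>
      ((\<lambda>k::int. of_real (ln (real_of_int \<bar>k\<bar>)) / (of_int k * b s s (\<sigma> * (2*k)))) \<longlongrightarrow> 0) at_top"
    and lim2: "\<And>s \<sigma>. \<sigma> \<in> {1, -1} \<Longrightarrow>
      ((\<lambda>k::int. of_real (max_b b (2*k) * max_b b (-2*k)) / b s s (\<sigma> * (2*k))) \<longlongrightarrow> 0) at_top"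
  shows "\<exists>c4>0. \<exists>N1\<ge>N0. \<forall>lam :: int \<Rightarrow> 'm \<Rightarrow> complex.
    (\<forall>k j. N0 \<le> \<bar>k\<bar> \<longrightarrow> is_eigenvalue n P (lam k j) \<and>
        lam k j \<in> ball (mu_approx n \<mu> k j) (eps_radius n c3 v b k)) \<longrightarrow>
    (\<forall>k j. N1 \<le> \<bar>k\<bar> \<longrightarrow>
        lam k j \<in> U_disk n \<mu> b q c4 (-1) k j \<union> U_disk n \<mu> b q c4 1 k j \<and>
        U_disk n \<mu> b q c4 1 k j \<inter> U_disk n \<mu> b q c4 (-1) k j = {}) \<and>
    (\<forall>k j. N1 \<le> \<bar>k\<bar> \<longrightarrow> geom_mult n P (lam k j) = 1) \<and>
    (\<exists>(\<alpha> :: int \<Rightarrow> int \<Rightarrow> 'm \<Rightarrow> complex) (\<rho> :: int \<Rightarrow> int \<Rightarrow> 'm \<Rightarrow> complex) (K :: real).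
       (\<forall>\<sigma>\<in>{1, -1}. \<forall>j. ((\<lambda>k. \<rho> \<sigma> k j) \<longlongrightarrow> 0) cofinite) \<and>
       (\<forall>\<sigma>\<in>{1, -1}. \<forall>k j. N1 \<le> \<bar>k\<bar> \<longrightarrow>
          \<alpha> \<sigma> k j = of_int \<sigma> * (q (2*k) j / b j j (2*k)) * (1 + \<rho> \<sigma> k j)) \<and>
       (\<forall>\<sigma>\<in>{1, -1}. \<forall>k j \<Psi>. N1 \<le> \<bar>k\<bar> \<longrightarrow> lam k j \<in> U_disk n \<mu> b q c4 \<sigma> k j \<longrightarrow>
          normalized_eigenfunction n P (lam k j) \<Psi> \<longrightarrow>
          (\<exists>c. norm c = 1 \<and>
             L2_norm (\<lambda>x. c *s \<Psi> x - (1 + (norm (\<alpha> \<sigma> k j))\<^sup>2) powr (-1/2) *\<^sub>R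
                (exp_fun (v j) k x + \<alpha> \<sigma> k j *s exp_fun (v j) (-k) x))
             \<le> K * (max_b b (2*k) + max_b b (-2*k) + log_ratio k))))"
proof -
  interpret R: resonant_operator n P \<mu> v w
    by unfold_locales (use n summable_P simple_C v w in auto)
  obtain \<Delta> where \<Delta>: "\<Delta> > 0" "\<And>i j. i \<noteq> j \<Longrightarrow> \<Delta> \<le> norm (\<mu> i - \<mu> j)"
    by (rule distinct_values_separated[OF simple_C]) blast
  define V where "V = onorm (\<lambda>x. (\<chi> i j. v j $ i) *v x)"
  \<comment> \<open>A bound for the radius \<open>eps_radius\<close> in units of \<open>|k| ^ (n - 2)\<close>; the factor \<open>3\<close> stands for the terms
    \<open>max_b b (2k)\<close>, \<open>max_b b (-2k)\<close> and \<open>log_ratio k\<close>, each of which will be at most \<open>\<eta> \<le> 1\<close>.\<close>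
  define c where "c = 2 * real CARD('m) * c3 * 3 * \<bar>V\<bar>"
  have c0: "0 \<le> c" unfolding c_def using c3(1) by simp
  have g0: "0 < \<Delta> / 2" using \<Delta> by simp
  obtain G K1 where G: "1 \<le> G" "3 \<le> K1" and reduced: "\<And>k j l y. K1 \<le> \<bar>k\<bar> \<Longrightarrow>
     norm (l - mu_approx n \<mu> k j) \<le> c * real_of_int \<bar>k\<bar> ^ (n - 2) \<Longrightarrow>
     (\<forall>s. s \<noteq> j \<longrightarrow> \<Delta> / 2 * real_of_int \<bar>k\<bar> ^ (n - 2) \<le> norm (l - mu_approx n \<mu> k s)) \<Longrightarrow>
     max_b b (2 * k) \<le> 1 \<Longrightarrow> max_b b (- 2 * k) \<le> 1 \<Longrightarrow>
     y \<in> eigenspace n P l \<Longrightarrow> L2_norm y = 1 \<Longrightarrow>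
     (\<forall>\<sigma>\<in>{1, - 1}. norm ((l - mu_approx n \<mu> k j) / freq k ^ (n - 2) * R.amplitude y (\<sigma> * k) j
         - b j j (\<sigma> * (2 * k)) * R.amplitude y (- \<sigma> * k) j) \<le> G * d_b b k) \<and>
     (\<forall>x\<in>{0..1}. norm (y x - (R.amplitude y k j *s exp_fun (v j) k x + R.amplitude y (- k) j *s exp_fun (v j) (- k) x))
       \<le> G * (max_b b (2 * k) + max_b b (- 2 * k) + log_ratio k)) \<and>
     (\<forall>\<sigma>\<in>{1, - 1}. norm (R.amplitude y (\<sigma> * k) j) \<le> G)"
    using R.reduced_system[OF c0 g0] unfolding b[symmetric] by blast
  \<comment> \<open>The constant \<open>6 G\<close> comes from \<open>near_square_root\<close>, the power of \<open>2 \<pi>\<close> from rescaling by \<open>freq k ^ (n - 2)\<close>.\<close>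
  define c4 where "c4 = (2 * pi) ^ n * (6 * G) + 1"
  have c4: "1 \<le> c4" "(2 * pi) ^ n * (6 * G) < c4" unfolding c4_def using G by auto
  define G2 where "G2 = G + c4"
  have G2: "0 < G2" "G \<le> G2" "c4 \<le> G2" unfolding G2_def using G c4 by auto
  \<comment> \<open>In this order the bounds on \<open>\<eta>\<close> make the coefficients at most \<open>1\<close>, keep \<open>l\<close> away from the other values
    \<open>mu_approx n \<mu> k s\<close>, make the remainder of \<open>y\<close> at most \<open>1 / 10\<close>, allow \<open>amplitude_ratio\<close>, and separate the two disks.\<close>
  define \<eta> where "\<eta> = Min {1, \<Delta> / (2 * (c + 1)), 1 / (30 * G), 1 / (32 * G2 * G), 1 / c4}"
  have \<eta>: "\<eta> \<le> 1" "\<eta> \<le> \<Delta> / (2 * (c + 1))" "\<eta> \<le> 1 / (30 * G)" "\<eta> \<le> 1 / (32 * G2 * G)" "\<eta> \<le> 1 / c4"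
    unfolding \<eta>_def by (intro Min_le; simp)+
  have \<eta>0: "\<eta> > 0" unfolding \<eta>_def using \<Delta> c0 G G2 c4 by simp
  have small_coefficients: "\<exists>K. \<forall>k s. \<forall>\<sigma>\<in>{1, -1}. K \<le> \<bar>k\<bar> \<longrightarrow>
      b s s (\<sigma> * (2*k)) \<noteq> 0 \<and> d_b b k \<le> e * norm (b s s (\<sigma> * (2*k))) \<and> max_b b (\<sigma> * (2*k)) \<le> e"
    if "e > 0" for e
    by (rule d_b_relatively_small[OF _ _ _ that]) (rule b_nonzero lim1 lim2, assumption)+
  obtain K2 where K2: "\<And>k s \<sigma>. K2 \<le> \<bar>k\<bar> \<Longrightarrow> \<sigma> \<in> {1, -1} \<Longrightarrow>
      b s s (\<sigma> * (2*k)) \<noteq> 0 \<and> d_b b k \<le> \<eta> * norm (b s s (\<sigma> * (2*k))) \<and> max_b b (\<sigma> * (2*k)) \<le> \<eta>"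
    using small_coefficients[OF \<eta>0] by blast
  define N1 where "N1 = max N0 (max K1 K2)"
  define E where "E = (\<lambda>k. max_b b (2 * k) + max_b b (- 2 * k) + log_ratio k)"
  define F where "F = (\<lambda>k. freq k ^ (n - 2))"
  have even2: "even (n - 2)" using n by simp
  have kpow: "real_of_int k ^ (n - 2) = real_of_int \<bar>k\<bar> ^ (n - 2)" for k
    using even2 by (simp add: power_even_abs)
  have F: "real_of_int k ^ (n - 2) \<le> norm (F k)" "norm (F k) \<le> (2 * pi) ^ n * real_of_int k ^ (n - 2)" for k
    unfolding F_def kpow[of k] using R.norm_freq_power_ge R.norm_freq_power_le by auto
  have large: "3 \<le> \<bar>k\<bar>" "0 < real_of_int k ^ (n - 2)" "F k \<noteq> 0" "0 < d_b b k" "0 < log_ratio k" "log_ratio k \<le> \<eta>"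
      "0 \<le> E k" "E k \<le> 3 * \<eta>"
    if k: "N1 \<le> \<bar>k\<bar>" for k
  proof -
    show k3: "3 \<le> \<bar>k\<bar>" using k G unfolding N1_def by linarith
    show kp: "0 < real_of_int k ^ (n - 2)" unfolding kpow[of k] using k3 by auto
    show "F k \<noteq> 0" using F(1)[of k] kp by auto
    show lr: "0 < log_ratio k" by (rule log_ratio_bounds(2)[OF k3])
    then show "0 < d_b b k" using d_b_ge(2)[of 1 k b] by simp
    have kK: "K2 \<le> \<bar>k\<bar>" using k unfolding N1_def by linarith
    let ?s = "undefined :: 'm"
    have mb: "max_b b (2 * k) \<le> \<eta>" "max_b b (- 2 * k) \<le> \<eta>"
      using K2[OF kK, of 1] K2[OF kK, of "- 1"] by auto
    have "log_ratio k \<le> d_b b k" using d_b_ge(2)[of 1 k b] by simp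
    also have "\<dots> \<le> \<eta> * norm (b ?s ?s (2 * k))" using K2[OF kK, of 1 ?s] by simp
    also have "\<dots> \<le> \<eta> * 1"
      using \<eta>0 \<eta>(1) mb(1) max_b_ge[of b ?s ?s "2 * k"] by (intro mult_left_mono) auto
    finally show le: "log_ratio k \<le> \<eta>" by simp
    show "0 \<le> E k" unfolding E_def using lr max_b_nonneg[of b "2 * k"] max_b_nonneg[of b "- 2 * k"] by linarith
    show "E k \<le> 3 * \<eta>" unfolding E_def using le mb by linarith
  qed
  have coeffs: "b j j (2 * k) \<noteq> 0" "b j j (- (2 * k)) \<noteq> 0"
      "d_b b k \<le> \<eta> * norm (b j j (2 * k))" "d_b b k \<le> \<eta> * norm (b j j (- (2 * k)))"
      "max_b b (2 * k) \<le> 1" "max_b b (- 2 * k) \<le> 1"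
    if k: "N1 \<le> \<bar>k\<bar>" for k j
  proof -
    have kK: "K2 \<le> \<bar>k\<bar>" using k unfolding N1_def by linarith
    show "b j j (2 * k) \<noteq> 0" "b j j (- (2 * k)) \<noteq> 0"
      "d_b b k \<le> \<eta> * norm (b j j (2 * k))" "d_b b k \<le> \<eta> * norm (b j j (- (2 * k)))"
      "max_b b (2 * k) \<le> 1" "max_b b (- 2 * k) \<le> 1"
      using K2[OF kK, of 1 j] K2[OF kK, of "- 1" j] \<eta>(1) by auto
  qed
  have qsq: "(q (2 * k) j)\<^sup>2 = b j j (2 * k) * b j j (- (2 * k))" for k j by (rule q)
  have \<gamma>_eq: "gamma_b b (2 * k) j = max (sqrt (norm (b j j (2 * k)) / norm (b j j (- (2 * k)))))
      (sqrt (norm (b j j (- (2 * k))) / norm (b j j (2 * k))))" for k j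
    by (simp add: gamma_b_def)
  have \<gamma>1: "1 \<le> gamma_b b (2 * k) j" if "N1 \<le> \<bar>k\<bar>" for k j
    by (rule pair_geometric(3)[OF qsq coeffs(1,2)[OF that] \<gamma>_eq])
  \<comment> \<open>The rescaled eigenvalue, which solves the perturbed two-by-two system.\<close>
  define X where "X = (\<lambda>k j l. (l - mu_approx n \<mu> k j) / F k)"
  have center: "norm (l - h_center n \<mu> q \<sigma> k j) = norm (F k) * norm (X k j l - of_int \<sigma> * q (2 * k) j)"
    if k: "N1 \<le> \<bar>k\<bar>" for k j l \<sigma>
  proof -
    have "l - h_center n \<mu> q \<sigma> k j = F k * (X k j l - of_int \<sigma> * q (2 * k) j)"
      unfolding X_def h_center_def mu_approx_def using large(3)[OF k]
      by (simp add: field_simps F_def)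
    then show ?thesis by (simp add: norm_mult)
  qed
  have system: "norm (X k j l * R.amplitude y k j - b j j (2 * k) * R.amplitude y (- k) j) \<le> G * d_b b k"
      "norm (X k j l * R.amplitude y (- k) j - b j j (- (2 * k)) * R.amplitude y k j) \<le> G * d_b b k"
      "norm (R.amplitude y k j) \<le> G" "norm (R.amplitude y (- k) j) \<le> G"
      "1 / 4 \<le> (norm (R.amplitude y k j))\<^sup>2 + (norm (R.amplitude y (- k) j))\<^sup>2"
      "R.amplitude y k j \<noteq> 0 \<Longrightarrow> \<exists>z. norm z = 1 \<and>
        L2_norm (\<lambda>x. z *s y x - (1 + (norm (R.amplitude y (- k) j / R.amplitude y k j))\<^sup>2) powr (-1/2) *\<^sub>R
          (exp_fun (v j) k x + (R.amplitude y (- k) j / R.amplitude y k j) *s exp_fun (v j) (- k) x)) \<le> 11 * (G * E k)"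
    if k: "N1 \<le> \<bar>k\<bar>" and l: "l \<in> ball (mu_approx n \<mu> k j) (eps_radius n c3 v b k)"
      and y: "y \<in> eigenspace n P l" "L2_norm y = 1" for k j l y
  proof -
    let ?\<kappa> = "real_of_int \<bar>k\<bar> ^ (n - 2)"
    have \<kappa>: "0 < ?\<kappa>" using large(2)[OF k] unfolding kpow[of k] .
    have dist: "norm (l - mu_approx n \<mu> k j) < eps_radius n c3 v b k"
      using l by (simp add: dist_norm norm_minus_commute)
    also have "eps_radius n c3 v b k = 2 * real CARD('m) * c3 * ?\<kappa> * E k * V"
      unfolding eps_radius_def E_def V_def kpow[of k] by simp
    also have "\<dots> \<le> 2 * real CARD('m) * c3 * ?\<kappa> * E k * \<bar>V\<bar>"
      using c3(1) \<kappa> large(7)[OF k] by (intro mult_left_mono) auto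
    also have "\<dots> \<le> 2 * real CARD('m) * c3 * ?\<kappa> * (3 * \<eta>) * \<bar>V\<bar>"
      using c3(1) \<kappa> large(7,8)[OF k] \<eta>0 by (intro mult_mono) auto
    also have "\<dots> = c * \<eta> * ?\<kappa>" unfolding c_def by simp
    finally have near: "norm (l - mu_approx n \<mu> k j) < c * \<eta> * ?\<kappa>" .
    have near1: "norm (l - mu_approx n \<mu> k j) \<le> c * ?\<kappa>"
    proof -
      have "c * \<eta> * ?\<kappa> \<le> c * 1 * ?\<kappa>" using c0 \<eta>(1) \<kappa> by (intro mult_right_mono mult_left_mono) auto
      then show ?thesis using near by simp
    qed
    have "c * \<eta> \<le> (c + 1) * (\<Delta> / (2 * (c + 1)))" using c0 \<eta>(2) \<eta>0 by (intro mult_mono) auto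
    also have "\<dots> = \<Delta> / 2" using c0 by (simp add: field_simps)
    finally have "c * \<eta> * ?\<kappa> \<le> \<Delta> / 2 * ?\<kappa>" using \<kappa> by (intro mult_right_mono) auto
    then have near2: "norm (l - mu_approx n \<mu> k j) \<le> \<Delta> / 2 * ?\<kappa>" using near by linarith
    have far: "\<forall>s. s \<noteq> j \<longrightarrow> \<Delta> / 2 * ?\<kappa> \<le> norm (l - mu_approx n \<mu> k s)"
    proof (intro allI impI)
      fix s assume s: "s \<noteq> j"
      have "mu_approx n \<mu> k j - mu_approx n \<mu> k s = (\<mu> j - \<mu> s) * F k"
        unfolding mu_approx_def F_def by (simp add: algebra_simps)
      moreover have "\<Delta> * ?\<kappa> \<le> norm (\<mu> j - \<mu> s) * norm (F k)"
        using \<Delta> s F(1)[of k] \<kappa> unfolding kpow[of k] by (intro mult_mono) auto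
      ultimately have "\<Delta> * ?\<kappa> \<le> norm (mu_approx n \<mu> k j - mu_approx n \<mu> k s)" by (simp add: norm_mult)
      also have "\<dots> \<le> norm (l - mu_approx n \<mu> k s) + norm (l - mu_approx n \<mu> k j)"
        using norm_triangle_ineq4[of "l - mu_approx n \<mu> k s" "l - mu_approx n \<mu> k j"] by simp
      finally show "\<Delta> / 2 * ?\<kappa> \<le> norm (l - mu_approx n \<mu> k s)" using near2 by linarith
    qed
    have kK: "K1 \<le> \<bar>k\<bar>" using k unfolding N1_def by linarith
    note red = reduced[OF kK near1 far coeffs(5,6)[OF k] y]
    show "norm (X k j l * R.amplitude y k j - b j j (2 * k) * R.amplitude y (- k) j) \<le> G * d_b b k"
      using bspec[OF conjunct1[OF red], of 1] unfolding X_def F_def by simp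
    show "norm (X k j l * R.amplitude y (- k) j - b j j (- (2 * k)) * R.amplitude y k j) \<le> G * d_b b k"
      using bspec[OF conjunct1[OF red], of "- 1"] unfolding X_def F_def by simp
    show "norm (R.amplitude y k j) \<le> G" "norm (R.amplitude y (- k) j) \<le> G"
      using bspec[OF conjunct2[OF conjunct2[OF red]], of 1] bspec[OF conjunct2[OF conjunct2[OF red]], of "- 1"] by auto
    interpret y: domain_function n P y by (rule R.domain_function[OF y(1)])
    have cy: "continuous_on {0..1} y" using y.continuous_deriv[of 0] n by simp
    have k0: "k \<noteq> 0" using large(1)[OF k] by auto
    have sup: "norm (y x - (R.amplitude y k j *s exp_fun (v j) k x + R.amplitude y (- k) j *s exp_fun (v j) (- k) x)) \<le> G * E k"
      if "x \<in> {0..1}" for x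
      using bspec[OF conjunct1[OF conjunct2[OF red]] that] unfolding E_def .
    have e0: "0 \<le> G * E k" using G large(7)[OF k] by simp
    have "G * E k \<le> G * (3 * (1 / (30 * G)))"
      using large(8)[OF k] \<eta>(3) G by (intro mult_left_mono) auto
    also have "\<dots> = 1 / 10" using G by simp
    finally have e1: "G * E k \<le> 1 / 10" .
    note prof = two_mode_profile[OF cy y(2) v(2) k0 sup e0 e1]
    show "1 / 4 \<le> (norm (R.amplitude y k j))\<^sup>2 + (norm (R.amplitude y (- k) j))\<^sup>2" by (rule prof(1))
    show "R.amplitude y k j \<noteq> 0 \<Longrightarrow> \<exists>z. norm z = 1 \<and>
        L2_norm (\<lambda>x. z *s y x - (1 + (norm (R.amplitude y (- k) j / R.amplitude y k j))\<^sup>2) powr (-1/2) *\<^sub>R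
          (exp_fun (v j) k x + (R.amplitude y (- k) j / R.amplitude y k j) *s exp_fun (v j) (- k) x)) \<le> 11 * (G * E k)"
      by (rule prof(2))
  qed
  have normalized_exists: "\<exists>y. y \<in> eigenspace n P l \<and> L2_norm y = 1" if "is_eigenvalue n P l" for l
    using that R.normalizable unfolding is_eigenvalue_def by blast
  have localized: "l \<in> U_disk n \<mu> b q c4 (-1) k j \<union> U_disk n \<mu> b q c4 1 k j"
    if k: "N1 \<le> \<bar>k\<bar>" and l: "l \<in> ball (mu_approx n \<mu> k j) (eps_radius n c3 v b k)"
      and ev: "is_eigenvalue n P l" for k j l
  proof -
    obtain y where y: "y \<in> eigenspace n P l" "L2_norm y = 1" using normalized_exists[OF ev] by blast
    note sys = system[OF k l y]
    define d1 where "d1 = X k j l * R.amplitude y k j - b j j (2 * k) * R.amplitude y (- k) j"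
    define d2 where "d2 = X k j l * R.amplitude y (- k) j - b j j (- (2 * k)) * R.amplitude y k j"
    have "norm (X k j l - q (2 * k) j) \<le> 6 * (G * d_b b k) * gamma_b b (2 * k) j
        \<or> norm (X k j l + q (2 * k) j) \<le> 6 * (G * d_b b k) * gamma_b b (2 * k) j"
    proof (rule near_square_root[OF _ _ _ _ qsq coeffs(1,2)[OF k] sys(5) \<gamma>_eq])
      show "X k j l * R.amplitude y k j = b j j (2 * k) * R.amplitude y (- k) j + d1" unfolding d1_def by simp
      show "X k j l * R.amplitude y (- k) j = b j j (- (2 * k)) * R.amplitude y k j + d2" unfolding d2_def by simp
      show "norm d1 \<le> G * d_b b k" "norm d2 \<le> G * d_b b k" unfolding d1_def d2_def by (rule sys)+
    qed
    then obtain \<sigma> :: int where \<sigma>: "\<sigma> \<in> {1, - 1}"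
      and near: "norm (X k j l - of_int \<sigma> * q (2 * k) j) \<le> 6 * (G * d_b b k) * gamma_b b (2 * k) j"
      by (metis (no_types, opaque_lifting) diff_minus_eq_add insertCI mult_minus1 of_int_1 of_int_minus mult_1)
    have pos: "0 < real_of_int k ^ (n - 2) * gamma_b b (2 * k) j * d_b b k"
      using large(2,4)[OF k] \<gamma>1[OF k, of j] by (intro mult_pos_pos) auto
    have "norm (l - h_center n \<mu> q \<sigma> k j)
        \<le> ((2 * pi) ^ n * real_of_int k ^ (n - 2)) * (6 * (G * d_b b k) * gamma_b b (2 * k) j)"
      unfolding center[OF k] using F(2)[of k] near large(2)[OF k] by (intro mult_mono) auto
    also have "\<dots> = ((2 * pi) ^ n * (6 * G)) * (real_of_int k ^ (n - 2) * gamma_b b (2 * k) j * d_b b k)" by simp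
    also have "\<dots> < c4 * (real_of_int k ^ (n - 2) * gamma_b b (2 * k) j * d_b b k)"
      using c4(2) pos by (intro mult_strict_right_mono)
    finally have "l \<in> U_disk n \<mu> b q c4 \<sigma> k j" unfolding U_disk_def by (simp add: mult.assoc)
    then show ?thesis using \<sigma> by auto
  qed
  have in_disk: "norm (X k j l - of_int \<sigma> * q (2 * k) j) \<le> c4 * gamma_b b (2 * k) j * d_b b k"
    if k: "N1 \<le> \<bar>k\<bar>" and l: "l \<in> U_disk n \<mu> b q c4 \<sigma> k j" for k j l \<sigma>
  proof -
    let ?\<kappa> = "real_of_int k ^ (n - 2)"
    have "?\<kappa> * norm (X k j l - of_int \<sigma> * q (2 * k) j) \<le> norm (F k) * norm (X k j l - of_int \<sigma> * q (2 * k) j)"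
      using F(1) by (intro mult_right_mono) auto
    also have "\<dots> \<le> ?\<kappa> * (c4 * gamma_b b (2 * k) j * d_b b k)"
      using l unfolding center[OF k, symmetric] U_disk_def by (simp add: mult_ac)
    finally show ?thesis using large(2)[OF k] by simp
  qed
  \<comment> \<open>The two centers are \<open>2 |q| = 2 \<gamma> m\<close> apart, in units of the factor \<open>F k\<close>, where \<open>m\<close> is the smaller coefficient; the radii
    are proportional to \<open>\<gamma> d_b\<close>, and \<open>d_b\<close> is negligible against \<open>m\<close>.\<close>
  have disjoint: "U_disk n \<mu> b q c4 1 k j \<inter> U_disk n \<mu> b q c4 (-1) k j = {}" if k: "N1 \<le> \<bar>k\<bar>" for k j
  proof (rule ccontr)
    assume "U_disk n \<mu> b q c4 1 k j \<inter> U_disk n \<mu> b q c4 (-1) k j \<noteq> {}"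
    then obtain l where l: "l \<in> U_disk n \<mu> b q c4 1 k j" "l \<in> U_disk n \<mu> b q c4 (-1) k j" by blast
    let ?\<kappa> = "real_of_int k ^ (n - 2)"
    let ?\<gamma> = "gamma_b b (2 * k) j"
    define m where "m = min (norm (b j j (2 * k))) (norm (b j j (- (2 * k))))"
    note pg = pair_geometric[OF qsq[of k j] coeffs(1,2)[OF k, of j] \<gamma>_eq, folded m_def]
    have m: "d_b b k \<le> \<eta> * m" using coeffs(3,4)[OF k, of j] unfolding m_def by (simp add: min_def)
    have m0: "0 \<le> m" unfolding m_def by simp
    have "c4 * d_b b k \<le> c4 * (1 / c4 * m)"
      using m \<eta>(5) m0 c4 mult_right_mono[OF \<eta>(5) m0] by (intro mult_left_mono) auto
    then have dm: "c4 * d_b b k \<le> m" using c4 by simp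
    have "norm (F k) * (2 * norm (q (2 * k) j)) = norm (h_center n \<mu> q 1 k j - h_center n \<mu> q (-1) k j)"
      unfolding h_center_def F_def by (simp add: norm_mult flip: mult_2)
    also have "\<dots> \<le> norm (l - h_center n \<mu> q (-1) k j) + norm (l - h_center n \<mu> q 1 k j)"
      using norm_triangle_ineq4[of "l - h_center n \<mu> q (-1) k j" "l - h_center n \<mu> q 1 k j"] by simp
    also have "\<dots> < 2 * (c4 * ?\<kappa> * ?\<gamma> * d_b b k)" using l unfolding U_disk_def by simp
    also have "\<dots> = ?\<kappa> * (2 * (?\<gamma> * (c4 * d_b b k)))" by simp
    also have "\<dots> \<le> ?\<kappa> * (2 * (?\<gamma> * m))"
      using dm pg(3) large(2)[OF k] by (intro mult_left_mono) auto
    also have "\<dots> \<le> norm (F k) * (2 * norm (q (2 * k) j))"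
      unfolding pg(1) using F(1)[of k] pg(3) m0 by (intro mult_right_mono) auto
    finally show False by simp
  qed
  have ratio: "R.amplitude y k j \<noteq> 0"
      "norm ((R.amplitude y (- k) j / R.amplitude y k j) / (of_int \<sigma> * q (2 * k) j / b j j (2 * k)) - 1)
        \<le> 32 * G2 * G * d_b b k / min (norm (b j j (2 * k))) (norm (b j j (- (2 * k))))"
    if k: "N1 \<le> \<bar>k\<bar>" and l: "l \<in> ball (mu_approx n \<mu> k j) (eps_radius n c3 v b k)"
      and \<sigma>: "\<sigma> \<in> {1, - 1}" and U: "l \<in> U_disk n \<mu> b q c4 \<sigma> k j"
      and y: "y \<in> eigenspace n P l" "L2_norm y = 1" for k j l y and \<sigma> :: int
  proof -
    note sys = system[OF k l y]
    define d1 where "d1 = X k j l * R.amplitude y k j - b j j (2 * k) * R.amplitude y (- k) j"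
    define d2 where "d2 = X k j l * R.amplitude y (- k) j - b j j (- (2 * k)) * R.amplitude y k j"
    have d0: "0 \<le> d_b b k" using large(4)[OF k] by simp
    have GG: "G * d_b b k \<le> G2 * d_b b k" using G2 d0 by (intro mult_right_mono)
    have e1: "X k j l * R.amplitude y k j = b j j (2 * k) * R.amplitude y (- k) j + d1" unfolding d1_def by simp
    have e2: "X k j l * R.amplitude y (- k) j = b j j (- (2 * k)) * R.amplitude y k j + d2" unfolding d2_def by simp
    have d12: "norm d1 \<le> G2 * d_b b k" "norm d2 \<le> G2 * d_b b k"
      unfolding d1_def d2_def by (rule order_trans[OF sys(1) GG] order_trans[OF sys(2) GG])+
    have q': "(of_int \<sigma> * q (2 * k) j)\<^sup>2 = b j j (2 * k) * b j j (- (2 * k))"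
      using \<sigma> qsq[of k j] by (auto simp: power_mult_distrib)
    have "c4 * gamma_b b (2 * k) j * d_b b k \<le> G2 * gamma_b b (2 * k) j * d_b b k"
      using G2 \<gamma>1[OF k, of j] d0 by (intro mult_right_mono) auto
    then have xq: "norm (X k j l - of_int \<sigma> * q (2 * k) j) \<le> G2 * gamma_b b (2 * k) j * d_b b k"
      using in_disk[OF k U] by linarith
    have sm: "32 * G2 * G * d_b b k \<le> \<beta>" if "d_b b k \<le> \<eta> * \<beta>" "0 \<le> \<beta>" for \<beta>
    proof -
      have "d_b b k \<le> 1 / (32 * G2 * G) * \<beta>" using that mult_right_mono[OF \<eta>(4) that(2)] by linarith
      then have "(32 * G2 * G) * d_b b k \<le> (32 * G2 * G) * (1 / (32 * G2 * G) * \<beta>)"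
        using G2 G by (intro mult_left_mono) auto
      then show ?thesis using G2 G by simp
    qed
    note ar = amplitude_ratio[OF e1 e2 d12 q' coeffs(1,2)[OF k] sys(5,3,4) \<gamma>_eq xq _ G(1) d0
        sm[OF coeffs(3)[OF k] norm_ge_zero] sm[OF coeffs(4)[OF k] norm_ge_zero]]
    show "R.amplitude y k j \<noteq> 0" using ar(1) G2 by simp
    show "norm ((R.amplitude y (- k) j / R.amplitude y k j) / (of_int \<sigma> * q (2 * k) j / b j j (2 * k)) - 1)
        \<le> 32 * G2 * G * d_b b k / min (norm (b j j (2 * k))) (norm (b j j (- (2 * k))))"
      using ar(3) G2 by simp
  qed
  show ?thesis
  proof (intro exI[of _ c4] exI[of _ N1] conjI allI impI)
    show "0 < c4" using c4 by simp
    show "N0 \<le> N1" unfolding N1_def by simp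
    fix lam :: "int \<Rightarrow> 'm \<Rightarrow> complex"
    assume lam: "\<forall>k j. N0 \<le> \<bar>k\<bar> \<longrightarrow> is_eigenvalue n P (lam k j) \<and>
        lam k j \<in> ball (mu_approx n \<mu> k j) (eps_radius n c3 v b k)"
    have ev: "is_eigenvalue n P (lam k j)"
      and ball: "lam k j \<in> ball (mu_approx n \<mu> k j) (eps_radius n c3 v b k)" if "N1 \<le> \<bar>k\<bar>" for k j
      using lam that unfolding N1_def by auto
    have some_disk: "\<exists>\<sigma>\<in>{1, - 1}. lam k j \<in> U_disk n \<mu> b q c4 \<sigma> k j" if "N1 \<le> \<bar>k\<bar>" for k j
      using localized[OF that ball[OF that] ev[OF that], of j] by blast
    have nonzero: "R.amplitude y k j \<noteq> 0"
      if "N1 \<le> \<bar>k\<bar>" "y \<in> eigenspace n P (lam k j)" "L2_norm y = 1" for k j y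
      using some_disk[OF that(1), of j] ratio(1)[OF that(1) ball[OF that(1)] _ _ that(2,3)] by blast
    show "lam k j \<in> U_disk n \<mu> b q c4 (-1) k j \<union> U_disk n \<mu> b q c4 1 k j" if "N1 \<le> \<bar>k\<bar>" for k j
      by (rule localized[OF that ball[OF that] ev[OF that]])
    show "U_disk n \<mu> b q c4 1 k j \<inter> U_disk n \<mu> b q c4 (-1) k j = {}" if "N1 \<le> \<bar>k\<bar>" for k j
      by (rule disjoint[OF that])
    show "geom_mult n P (lam k j) = 1" if "N1 \<le> \<bar>k\<bar>" for k j
      by (rule R.eigenspace_one_dimensional(1)[OF ev[OF that] nonzero[OF that]])
    \<comment> \<open>The ratio of amplitudes is the same for all eigenfunctions, so one of them may define \<open>\<alpha>\<close>. For the sign whose disk does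
      not contain the eigenvalue, \<open>\<alpha>\<close> is set to its limiting expression, with \<open>\<rho> = 0\<close>.\<close>
    define Y where "Y = (\<lambda>k j. SOME y. y \<in> eigenspace n P (lam k j) \<and> L2_norm y = 1)"
    have Y: "Y k j \<in> eigenspace n P (lam k j)" "L2_norm (Y k j) = 1" if "N1 \<le> \<bar>k\<bar>" for k j
      using someI_ex[OF normalized_exists[OF ev[OF that, of j]]] unfolding Y_def by auto
    define \<alpha> where "\<alpha> = (\<lambda>\<sigma> k j. if N1 \<le> \<bar>k\<bar> \<and> lam k j \<in> U_disk n \<mu> b q c4 \<sigma> k j
      then R.amplitude (Y k j) (- k) j / R.amplitude (Y k j) k j else of_int \<sigma> * (q (2 * k) j / b j j (2 * k)))"
    define \<rho> where "\<rho> = (\<lambda>\<sigma> k j. if N1 \<le> \<bar>k\<bar>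
      then \<alpha> \<sigma> k j / (of_int \<sigma> * q (2 * k) j / b j j (2 * k)) - 1 else 0)"
    have q0: "q (2 * k) j \<noteq> 0" if "N1 \<le> \<bar>k\<bar>" for k j using qsq[of k j] coeffs(1,2)[OF that, of j] by auto
    have \<rho>_lim: "((\<lambda>k. \<rho> \<sigma> k j) \<longlongrightarrow> 0) cofinite" if \<sigma>: "\<sigma> \<in> {1, - 1 :: int}" for \<sigma> j
    proof (rule tendstoI)
      fix \<epsilon> :: real assume \<epsilon>: "\<epsilon> > 0"
      define \<eta>' where "\<eta>' = \<epsilon> / (64 * G2 * G)"
      have \<eta>': "\<eta>' > 0" unfolding \<eta>'_def using \<epsilon> G2 G by simp
      obtain K3 where K3: "\<And>k s \<sigma>. K3 \<le> \<bar>k\<bar> \<Longrightarrow> \<sigma> \<in> {1, -1} \<Longrightarrow>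
        b s s (\<sigma> * (2*k)) \<noteq> 0 \<and> d_b b k \<le> \<eta>' * norm (b s s (\<sigma> * (2*k))) \<and> max_b b (\<sigma> * (2*k)) \<le> \<eta>'"
        using small_coefficients[OF \<eta>'] by blast
      have cancel: "32 * G2 * G * (\<eta>' * z) / z = \<epsilon> / 2" if "z > 0" for z
        using that G2 G unfolding \<eta>'_def by simp
      have small: "dist (\<rho> \<sigma> k j) 0 < \<epsilon>" if k: "K3 \<le> \<bar>k\<bar>" for k
      proof (cases "N1 \<le> \<bar>k\<bar> \<and> lam k j \<in> U_disk n \<mu> b q c4 \<sigma> k j")
        case True
        then have kN: "N1 \<le> \<bar>k\<bar>" and U: "lam k j \<in> U_disk n \<mu> b q c4 \<sigma> k j" by auto
        let ?m = "min (norm (b j j (2 * k))) (norm (b j j (- (2 * k))))"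
        have m: "d_b b k \<le> \<eta>' * ?m" using K3[OF k, of 1 j] K3[OF k, of "- 1" j] by (simp add: min_def)
        have m0: "?m > 0" using coeffs(1,2)[OF kN, of j] by simp
        have "norm (\<rho> \<sigma> k j) \<le> 32 * G2 * G * d_b b k / ?m"
          using ratio(2)[OF kN ball[OF kN] \<sigma> U Y[OF kN]] True unfolding \<rho>_def \<alpha>_def by simp
        also have "\<dots> \<le> 32 * G2 * G * (\<eta>' * ?m) / ?m"
          using m m0 G2 G by (intro divide_right_mono mult_left_mono) auto
        also have "\<dots> = \<epsilon> / 2" by (rule cancel[OF m0])
        finally show ?thesis using \<epsilon> by simp
      next
        case False
        then have "\<rho> \<sigma> k j = 0"
          using q0[of k j] coeffs(1)[of k j] \<sigma> unfolding \<rho>_def \<alpha>_def by auto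
        then show ?thesis using \<epsilon> by simp
      qed
      have "{k. \<not> dist (\<rho> \<sigma> k j) 0 < \<epsilon>} \<subseteq> {- K3..K3}"
      proof
        fix k assume "k \<in> {k. \<not> dist (\<rho> \<sigma> k j) 0 < \<epsilon>}"
        then have "\<not> K3 \<le> \<bar>k\<bar>" using small[of k] by blast
        then show "k \<in> {- K3..K3}" by auto
      qed
      then show "\<forall>\<^sub>F k in cofinite. dist (\<rho> \<sigma> k j) 0 < \<epsilon>"
        unfolding eventually_cofinite by (rule finite_subset) simp
    qed
    have \<alpha>_eq: "\<alpha> \<sigma> k j = of_int \<sigma> * (q (2*k) j / b j j (2*k)) * (1 + \<rho> \<sigma> k j)"
      if "\<sigma> \<in> {1, - 1}" "N1 \<le> \<bar>k\<bar>" for \<sigma> :: int and k j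
      using q0[OF that(2), of j] coeffs(1)[OF that(2), of j] that unfolding \<rho>_def by auto
    have profile: "\<exists>z. norm z = 1 \<and>
             L2_norm (\<lambda>x. z *s \<Psi> x - (1 + (norm (\<alpha> \<sigma> k j))\<^sup>2) powr (-1/2) *\<^sub>R
                (exp_fun (v j) k x + \<alpha> \<sigma> k j *s exp_fun (v j) (-k) x))
             \<le> 11 * G * (max_b b (2*k) + max_b b (-2*k) + log_ratio k)"
      if k: "N1 \<le> \<bar>k\<bar>" and U: "lam k j \<in> U_disk n \<mu> b q c4 \<sigma> k j"
        and \<Psi>: "normalized_eigenfunction n P (lam k j) \<Psi>" for \<sigma> :: int and k j \<Psi>
    proof -
      have \<Psi>': "\<Psi> \<in> eigenspace n P (lam k j)" "L2_norm \<Psi> = 1"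
        using \<Psi> unfolding normalized_eigenfunction_def by auto
      obtain a where a: "\<Psi> = (\<lambda>x. a *s Y k j x)"
        using R.eigenspace_one_dimensional(2)[OF ev[OF k] nonzero[OF k] Y[OF k] \<Psi>'(1)] by blast
      have ca: "R.amplitude \<Psi> p j = a * R.amplitude (Y k j) p j" for p
        using R.amplitude_lincomb[OF Y(1)[OF k] Y(1)[OF k], where \<alpha> = a and \<beta> = 0 and p = p and s = j] unfolding a by simp
      have nz: "R.amplitude \<Psi> k j \<noteq> 0" by (rule nonzero[OF k \<Psi>'])
      have "R.amplitude \<Psi> (- k) j / R.amplitude \<Psi> k j = \<alpha> \<sigma> k j"
        using nz k U unfolding ca \<alpha>_def by simp
      then show ?thesis
        using system(6)[OF k ball[OF k] \<Psi>' nz] unfolding E_def by (simp add: mult.assoc)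
    qed
    show "\<exists>(\<alpha> :: int \<Rightarrow> int \<Rightarrow> 'm \<Rightarrow> complex) (\<rho> :: int \<Rightarrow> int \<Rightarrow> 'm \<Rightarrow> complex) (K :: real).
       (\<forall>\<sigma>\<in>{1, -1}. \<forall>j. ((\<lambda>k. \<rho> \<sigma> k j) \<longlongrightarrow> 0) cofinite) \<and>
       (\<forall>\<sigma>\<in>{1, -1}. \<forall>k j. N1 \<le> \<bar>k\<bar> \<longrightarrow>
          \<alpha> \<sigma> k j = of_int \<sigma> * (q (2*k) j / b j j (2*k)) * (1 + \<rho> \<sigma> k j)) \<and>
       (\<forall>\<sigma>\<in>{1, -1}. \<forall>k j \<Psi>. N1 \<le> \<bar>k\<bar> \<longrightarrow> lam k j \<in> U_disk n \<mu> b q c4 \<sigma> k j \<longrightarrow>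
          normalized_eigenfunction n P (lam k j) \<Psi> \<longrightarrow>
          (\<exists>c. norm c = 1 \<and>
             L2_norm (\<lambda>x. c *s \<Psi> x - (1 + (norm (\<alpha> \<sigma> k j))\<^sup>2) powr (-1/2) *\<^sub>R
                (exp_fun (v j) k x + \<alpha> \<sigma> k j *s exp_fun (v j) (-k) x))
             \<le> K * (max_b b (2*k) + max_b b (-2*k) + log_ratio k)))"
      by (intro exI[of _ \<alpha>] exI[of _ \<rho>] exI[of _ "11 * G"] conjI ballI allI impI \<rho>_lim \<alpha>_eq profile)
  qed
qed

end
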